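(* Assume that $\downarrow$-loveliness is first-order and let $\langle\mathfrak C,P\rangle$ be a monster model of $T^d$. Let $\bar b\in\mathfrak C^n$ be P-independent. For a set $Y\subseteq P^m$ the following are equivalent: (1) $Y$ is $T^d$-definable over $\bar b$ (i.e. definable in $\langle\mathfrak C,P\rangle$ by an $\mathcal L^2$-formula with parameters $\bar b$); (2) there exists $Z\subseteq\mathfrak C^m$ that is $T$-definable over $\bar b$ (i.e. definable by an $\mathcal L$-formula with parameters $\bar b$) such that $Y=Z\cap P^m$.
   Context: $T$ is a complete first-order theory in a language $\mathcal L$ and $\mathfrak C$ is a monster model of $T$; "small" means of cardinality smaller than the monstrosity of $\mathfrak C$ (its degree of saturation and strong homogeneity); tuples have small length. Juxtaposition denotes union, and tuples are identified with their sets of entries. An independence relation on $\mathfrak C$ is a ternary relation $A\downarrow_C B$ on small subsets of $\mathfrak C$ such that for all small $A,B,C,D$: (Invariance) $A\downarrow_B C\Rightarrow\sigma(A)\downarrow_{\sigma(B)}\sigma(C)$ for $\sigma\in\mathrm{Aut}(\mathfrak C)$; (Normality) $A\downarrow_C B\Rightarrow AC\downarrow_C B$; (Symmetry) $A\downarrow_B C\Rightarrow C\downarrow_B A$; (Transitivity) if $B\subseteq C\subseteq D$, then $A\downarrow_B D$ iff $A\downarrow_B C$ and $A\downarrow_C D$; (Finite character) $A\downarrow_B C$ iff $A_0\downarrow_B C$ for all finite $A_0\subseteq A$; (Extension) there is $A'\equiv_B A$ with $A'\downarrow_B C$; (Local character) there is a small cardinal $\lambda$ depending only on $\downarrow$ such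 that for all small $A,C$ there is $C_0\subseteq C$ with $|C_0|<\lambda+|A|^+$ and $A\downarrow_{C_0}C$. For arbitrary $A,B,C\subseteq\mathfrak C$, $A\downarrow_B C$ means: for all small $A'\subseteq A$, $B'\subseteq B$, $C'\subseteq C$ there is a small $B''$ with $B'\subseteq B''\subseteq B$ and $A'\downarrow_{B''}C'$. Fix an independence relation $\downarrow$ on $\mathfrak C$. $\kappa_0$ is the least regular cardinal $\mu$ such that for every finite tuple $\bar a$ and small set $B$ there is $B_0\subseteq B$ with $|B_0|<\mu$ and $\bar a\downarrow_{B_0}B$. $\mathcal L^2=\mathcal L\cup\{P\}$ with $P$ a new unary predicate; $T^2$ is the theory of all expansions of $T$ to $\mathcal L^2$. A superscript 1 (resp. 2) on a model-theoretic notion refers to $\mathcal L$ (resp. $\mathcal L^2$). Models of $T$ are elementary substructures of $\mathfrak C$; a model of $T^2$ is written $M_P=\langle M,P(M)\rangle$, and $P(A)=P(M)\cap A$ for $A\subseteq M$. For a complete type $q$ over $A\supseteq B$, $q\downarrow_B A$ means $c\downarrow_B A$ for a realization $c$ of $q$ in $\mathfrak C$. Fix a small cardinal $\kappa>\max(\kappa_0,|T|)$; a set or tuple is very small if its cardinality is $<\kappa$. $M_P\models T^2$ is a ($\downarrow$-)lovely pair if: (1) $M$ is a small model of $T$; (2) (Density property) for every very small $A\subset M$ and $q\in S^1_1(A)$ with $q\downarrow_{P(A)}A$, $q$ is realized in $P(M)$; (3) (Extension property) for every very small $A\subset M$ and $q\in S^1_1(A)$ there is $b\in M$ realizing $q$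 with $b\downarrow_A P(M)$. $T^d$ is the $\mathcal L^2$-theory of $\downarrow$-lovely pairs. "Loveliness is first-order" means that every sufficiently saturated model of $T^d$ is a lovely pair. $\langle\mathfrak C,P\rangle$ is a monster model of $T^d$ whose $\mathcal L$-reduct is $\mathfrak C$. A set (or tuple) $A\subseteq\mathfrak C$ is P-independent if $A\downarrow_{A\cap P}P$. *)

theory Defs
  imports Main
begin

unbundle cardinal_syntax

section \<open>First-order logic\<close>

text \<open>Symbols come with their arity, so a language may be empty and constants are function symbols
  of arity 0. Well-formedness and the interpretations read the arity off the argument list.\<close>

record ('f, 'r) lang =
  funs :: "('f \<times> nat) set"
  rels :: "('r \<times> nat) set"

datatype 'f tm = Var nat | App 'f "'f tm list"

datatype ('f, 'r) fm =
    Bot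
  | Eq "'f tm" "'f tm"
  | Rel 'r "'f tm list"
  | Imp "('f, 'r) fm" "('f, 'r) fm"
  | All nat "('f, 'r) fm"

abbreviation Neg :: "('f, 'r) fm \<Rightarrow> ('f, 'r) fm" where
  "Neg \<phi> \<equiv> Imp \<phi> Bot"

primrec tm_vars :: "'f tm \<Rightarrow> nat set" where
  "tm_vars (Var x) = {x}"
| "tm_vars (App f ts) = \<Union> (set (map tm_vars ts))"

primrec fv :: "('f, 'r) fm \<Rightarrow> nat set" where
  "fv Bot = {}"
| "fv (Eq s t) = tm_vars s \<union> tm_vars t"
| "fv (Rel r ts) = (\<Union>t\<in>set ts. tm_vars t)"
| "fv (Imp \<phi> \<psi>) = fv \<phi> \<union> fv \<psi>"
| "fv (All x \<phi>) = fv \<phi> - {x}"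

primrec wf_tm :: "('f, 'r) lang \<Rightarrow> 'f tm \<Rightarrow> bool" where
  "wf_tm L (Var x) = True"
| "wf_tm L (App f ts) = ((f, length ts) \<in> funs L \<and> list_all id (map (wf_tm L) ts))"

primrec wf_fm :: "('f, 'r) lang \<Rightarrow> ('f, 'r) fm \<Rightarrow> bool" where
  "wf_fm L Bot = True"
| "wf_fm L (Eq s t) = (wf_tm L s \<and> wf_tm L t)"
| "wf_fm L (Rel r ts) = ((r, length ts) \<in> rels L \<and> (\<forall>t\<in>set ts. wf_tm L t))"
| "wf_fm L (Imp \<phi> \<psi>) = (wf_fm L \<phi> \<and> wf_fm L \<psi>)"
| "wf_fm L (All x \<phi>) = wf_fm L \<phi>"

definition formulas :: "('f, 'r) lang \<Rightarrow> ('f, 'r) fm set" where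
  "formulas L = {\<phi>. wf_fm L \<phi>}"

definition sentences :: "('f, 'r) lang \<Rightarrow> ('f, 'r) fm set" where
  "sentences L = {\<phi> \<in> formulas L. fv \<phi> = {}}"

record ('f, 'r, 'a) struct =
  universe :: "'a set"
  fun_int :: "'f \<Rightarrow> 'a list \<Rightarrow> 'a"
  rel_int :: "'r \<Rightarrow> 'a list \<Rightarrow> bool"

definition is_struct :: "('f, 'r) lang \<Rightarrow> ('f, 'r, 'a) struct \<Rightarrow> bool" where
  "is_struct L M \<longleftrightarrow> universe M \<noteq> {} \<and>
     (\<forall>(f, k) \<in> funs L. \<forall>xs. length xs = k \<and> set xs \<subseteq> universe M \<longrightarrow> fun_int M f xs \<in> universe M)"

primrec eval_tm :: "('f, 'r, 'a) struct \<Rightarrow> (nat \<Rightarrow> 'a) \<Rightarrow> 'f tm \<Rightarrow> 'a" where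
  "eval_tm M v (Var x) = v x"
| "eval_tm M v (App f ts) = fun_int M f (map (eval_tm M v) ts)"

primrec sat :: "('f, 'r, 'a) struct \<Rightarrow> (nat \<Rightarrow> 'a) \<Rightarrow> ('f, 'r) fm \<Rightarrow> bool" where
  "sat M v Bot = False"
| "sat M v (Eq s t) = (eval_tm M v s = eval_tm M v t)"
| "sat M v (Rel r ts) = rel_int M r (map (eval_tm M v) ts)"
| "sat M v (Imp \<phi> \<psi>) = (sat M v \<phi> \<longrightarrow> sat M v \<psi>)"
| "sat M v (All x \<phi>) = (\<forall>a \<in> universe M. sat M (v(x := a)) \<phi>)"

definition models :: "('f, 'r, 'a) struct \<Rightarrow> ('f, 'r) fm set \<Rightarrow> bool" where
  "models M T \<longleftrightarrow> (\<forall>\<phi>\<in>T. \<forall>v. range v \<subseteq> universe M \<longrightarrow> sat M v \<phi>)"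

text \<open>Theories are taken to be deductively closed; consistency of a complete theory is not part of
  this definition, it comes from having a model.\<close>

definition complete_theory :: "('f, 'r) lang \<Rightarrow> ('f, 'r) fm set \<Rightarrow> bool" where
  "complete_theory L T \<longleftrightarrow> T \<subseteq> sentences L \<and> (\<forall>\<phi>\<in>sentences L. \<phi> \<in> T \<or> Neg \<phi> \<in> T)"

text \<open>The language \<open>L(A)\<close>: every \<open>a \<in> A\<close> becomes a constant symbol \<open>Inr a\<close> naming itself.\<close>

definition lang_par :: "('f, 'r) lang \<Rightarrow> 'a set \<Rightarrow> ('f + 'a, 'r) lang" where
  "lang_par L A =
     \<lparr>funs = {(Inl f, k) | f k. (f, k) \<in> funs L} \<union> {(Inr a, 0) | a. a \<in> A}, rels = rels L\<rparr>"

definition struct_par :: "('f, 'r, 'a) struct \<Rightarrow> ('f + 'a, 'r, 'a) struct" where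
  "struct_par M = \<lparr>universe = universe M,
     fun_int = (\<lambda>g xs. case g of Inl f \<Rightarrow> fun_int M f xs | Inr a \<Rightarrow> a), rel_int = rel_int M\<rparr>"

text \<open>Tuples are lists: subsets of the \<open>m\<close>-th power of the universe that are definable over \<open>A\<close>.\<close>

definition definable ::
    "('f, 'r) lang \<Rightarrow> ('f, 'r, 'a) struct \<Rightarrow> 'a set \<Rightarrow> nat \<Rightarrow> 'a list set \<Rightarrow> bool" where
  "definable L M A m Y \<longleftrightarrow> (\<exists>\<phi> \<in> formulas (lang_par L A). fv \<phi> \<subseteq> {..<m} \<and>
     Y = {xs. length xs = m \<and> set xs \<subseteq> universe M \<and> sat (struct_par M) (\<lambda>i. xs ! i) \<phi>})"

definition elementary_sub :: "('f, 'r) lang \<Rightarrow> ('f, 'r, 'a) struct \<Rightarrow> 'a set \<Rightarrow> bool" where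
  "elementary_sub L C M \<longleftrightarrow> M \<subseteq> universe C \<and> is_struct L (C\<lparr>universe := M\<rparr>) \<and>
     (\<forall>\<phi> \<in> formulas L. \<forall>v. range v \<subseteq> M \<longrightarrow> (sat (C\<lparr>universe := M\<rparr>) v \<phi> \<longleftrightarrow> sat C v \<phi>))"

definition elementary_map ::
    "('f, 'r) lang \<Rightarrow> ('f, 'r, 'a) struct \<Rightarrow> 'a set \<Rightarrow> ('a \<Rightarrow> 'a) \<Rightarrow> bool" where
  "elementary_map L M A f \<longleftrightarrow> A \<subseteq> universe M \<and> f ` A \<subseteq> universe M \<and>
     (\<forall>\<phi> \<in> formulas L. \<forall>v. v ` fv \<phi> \<subseteq> A \<longrightarrow> (sat M v \<phi> \<longleftrightarrow> sat M (f \<circ> v) \<phi>))"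

text \<open>\<open>A' \<equiv>\<^sub>B A\<close> for sets identified with tuples: some enumeration of \<open>A'\<close> has the type over \<open>B\<close>
  of an enumeration of \<open>A\<close>.\<close>

definition equiv_over ::
    "('f, 'r) lang \<Rightarrow> ('f, 'r, 'a) struct \<Rightarrow> 'a set \<Rightarrow> 'a set \<Rightarrow> 'a set \<Rightarrow> bool" where
  "equiv_over L M B A' A \<longleftrightarrow>
     (\<exists>f. elementary_map (lang_par L B) (struct_par M) A f \<and> f ` A = A')"

definition automorphism :: "('f, 'r) lang \<Rightarrow> ('f, 'r, 'a) struct \<Rightarrow> ('a \<Rightarrow> 'a) \<Rightarrow> bool" where
  "automorphism L M \<sigma> \<longleftrightarrow> bij_betw \<sigma> (universe M) (universe M) \<and>
     (\<forall>(f, k) \<in> funs L. \<forall>xs. length xs = k \<and> set xs \<subseteq> universe M \<longrightarrow>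
        \<sigma> (fun_int M f xs) = fun_int M f (map \<sigma> xs)) \<and>
     (\<forall>(r, k) \<in> rels L. \<forall>xs. length xs = k \<and> set xs \<subseteq> universe M \<longrightarrow>
        (rel_int M r xs \<longleftrightarrow> rel_int M r (map \<sigma> xs)))"

definition realizes ::
    "('f, 'r, 'a) struct \<Rightarrow> 'a \<Rightarrow> ('f + 'a, 'r) fm set \<Rightarrow> bool" where
  "realizes M c p \<longleftrightarrow> (\<forall>\<phi>\<in>p. sat (struct_par M) (\<lambda>_. c) \<phi>)"

text \<open>\<open>S\<^sub>1(A)\<close>: the complete 1-types over \<open>A\<close>, in the variable 0.\<close>

definition types1 ::
    "('f, 'r) lang \<Rightarrow> ('f, 'r, 'a) struct \<Rightarrow> 'a set \<Rightarrow> ('f + 'a, 'r) fm set set" where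
  "types1 L M A = {p. p \<subseteq> {\<phi> \<in> formulas (lang_par L A). fv \<phi> \<subseteq> {0}} \<and>
     (\<forall>p\<^sub>0. finite p\<^sub>0 \<and> p\<^sub>0 \<subseteq> p \<longrightarrow> (\<exists>c \<in> universe M. realizes M c p\<^sub>0)) \<and>
     (\<forall>\<phi> \<in> formulas (lang_par L A). fv \<phi> \<subseteq> {0} \<longrightarrow> \<phi> \<in> p \<or> Neg \<phi> \<in> p)}"

definition saturated :: "('f, 'r) lang \<Rightarrow> 'k rel \<Rightarrow> ('f, 'r, 'a) struct \<Rightarrow> bool" where
  "saturated L \<mu> M \<longleftrightarrow> (\<forall>A. A \<subseteq> universe M \<and> |A| <o \<mu> \<longrightarrow>
     (\<forall>p \<in> types1 L M A. \<exists>c \<in> universe M. realizes M c p))"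

definition strongly_homogeneous :: "('f, 'r) lang \<Rightarrow> 'k rel \<Rightarrow> ('f, 'r, 'a) struct \<Rightarrow> bool" where
  "strongly_homogeneous L \<mu> M \<longleftrightarrow> (\<forall>A f. |A| <o \<mu> \<and> elementary_map L M A f \<longrightarrow>
     (\<exists>\<sigma>. automorphism L M \<sigma> \<and> (\<forall>a\<in>A. \<sigma> a = f a)))"

text \<open>\<open>\<Omega>\<close> is the monstrosity throughout.\<close>

definition monster_model ::
    "('f, 'r) lang \<Rightarrow> ('f, 'r) fm set \<Rightarrow> 'k rel \<Rightarrow> ('f, 'r, 'a) struct \<Rightarrow> bool" where
  "monster_model L T \<Omega> C \<longleftrightarrow> is_struct L C \<and> models C T \<and> Card_order \<Omega> \<and>
     saturated L \<Omega> C \<and> strongly_homogeneous L \<Omega> C"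


section \<open>Independence relations\<close>

definition small :: "('f, 'r, 'a) struct \<Rightarrow> 'k rel \<Rightarrow> 'a set \<Rightarrow> bool" where
  "small C \<Omega> A \<longleftrightarrow> A \<subseteq> universe C \<and> |A| <o \<Omega>"

text \<open>\<open>ind A B C\<close> stands for \<open>A \<down>\<^sub>B C\<close>; the base is the second argument. Values of \<open>ind\<close> on sets
  that are not small are never used. Every cardinal below \<open>\<Omega>\<close> has a copy on the type of \<open>\<Omega>\<close>, so
  quantifying over relations on that type is no restriction.\<close>

definition independence_relation ::
    "('f, 'r) lang \<Rightarrow> ('f, 'r, 'a) struct \<Rightarrow> 'k rel \<Rightarrow> ('a set \<Rightarrow> 'a set \<Rightarrow> 'a set \<Rightarrow> bool) \<Rightarrow> bool" where
  "independence_relation L \<CC> (\<Omega> :: 'k rel) ind \<longleftrightarrow>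
     \<comment> \<open>Invariance\<close>
     (\<forall>A B C \<sigma>. small \<CC> \<Omega> A \<and> small \<CC> \<Omega> B \<and> small \<CC> \<Omega> C \<and> automorphism L \<CC> \<sigma> \<and> ind A B C \<longrightarrow>
        ind (\<sigma> ` A) (\<sigma> ` B) (\<sigma> ` C)) \<and>
     \<comment> \<open>Normality\<close>
     (\<forall>A B C. small \<CC> \<Omega> A \<and> small \<CC> \<Omega> B \<and> small \<CC> \<Omega> C \<and> ind A C B \<longrightarrow> ind (A \<union> C) C B) \<and>
     \<comment> \<open>Symmetry\<close>
     (\<forall>A B C. small \<CC> \<Omega> A \<and> small \<CC> \<Omega> B \<and> small \<CC> \<Omega> C \<and> ind A B C \<longrightarrow> ind C B A) \<and>
     \<comment> \<open>Transitivity\<close>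
     (\<forall>A B C D. small \<CC> \<Omega> A \<and> small \<CC> \<Omega> D \<and> B \<subseteq> C \<and> C \<subseteq> D \<longrightarrow>
        (ind A B D \<longleftrightarrow> ind A B C \<and> ind A C D)) \<and>
     \<comment> \<open>Finite character\<close>
     (\<forall>A B C. small \<CC> \<Omega> A \<and> small \<CC> \<Omega> B \<and> small \<CC> \<Omega> C \<longrightarrow>
        (ind A B C \<longleftrightarrow> (\<forall>A\<^sub>0. finite A\<^sub>0 \<and> A\<^sub>0 \<subseteq> A \<longrightarrow> ind A\<^sub>0 B C))) \<and>
     \<comment> \<open>Extension\<close>
     (\<forall>A B C. small \<CC> \<Omega> A \<and> small \<CC> \<Omega> B \<and> small \<CC> \<Omega> C \<longrightarrow>
        (\<exists>A'. equiv_over L \<CC> B A' A \<and> ind A' B C)) \<and>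
     \<comment> \<open>Local character\<close>
     (\<exists>\<nu> :: 'k rel. Card_order \<nu> \<and> \<nu> <o \<Omega> \<and>
        (\<forall>A C. small \<CC> \<Omega> A \<and> small \<CC> \<Omega> C \<longrightarrow>
           (\<exists>C\<^sub>0. C\<^sub>0 \<subseteq> C \<and> |C\<^sub>0| <o \<nu> +c cardSuc |A| \<and> ind A C\<^sub>0 C)))"

text \<open>The extension of \<open>\<down>\<close> to arbitrary subsets of the monster.\<close>

definition indep_large ::
    "('f, 'r, 'a) struct \<Rightarrow> 'k rel \<Rightarrow> ('a set \<Rightarrow> 'a set \<Rightarrow> 'a set \<Rightarrow> bool) \<Rightarrow>
     'a set \<Rightarrow> 'a set \<Rightarrow> 'a set \<Rightarrow> bool" where
  "indep_large \<CC> \<Omega> ind A B C \<longleftrightarrow>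
     (\<forall>A' B' C'. small \<CC> \<Omega> A' \<and> A' \<subseteq> A \<and> small \<CC> \<Omega> B' \<and> B' \<subseteq> B \<and> small \<CC> \<Omega> C' \<and> C' \<subseteq> C \<longrightarrow>
        (\<exists>B''. small \<CC> \<Omega> B'' \<and> B' \<subseteq> B'' \<and> B'' \<subseteq> B \<and> ind A' B'' C'))"

definition P_independent ::
    "('f, 'r, 'a) struct \<Rightarrow> 'k rel \<Rightarrow> ('a set \<Rightarrow> 'a set \<Rightarrow> 'a set \<Rightarrow> bool) \<Rightarrow> 'a set \<Rightarrow> 'a set \<Rightarrow> bool" where
  "P_independent \<CC> \<Omega> ind P A \<longleftrightarrow> indep_large \<CC> \<Omega> ind A (A \<inter> P) P"

definition finite_local_bound ::
    "('f, 'r, 'a) struct \<Rightarrow> 'k rel \<Rightarrow> ('a set \<Rightarrow> 'a set \<Rightarrow> 'a set \<Rightarrow> bool) \<Rightarrow> 'k rel \<Rightarrow> bool" where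
  "finite_local_bound \<CC> \<Omega> ind \<mu> \<longleftrightarrow>
     (\<forall>A B. finite A \<and> A \<subseteq> universe \<CC> \<and> small \<CC> \<Omega> B \<longrightarrow>
        (\<exists>B\<^sub>0. B\<^sub>0 \<subseteq> B \<and> |B\<^sub>0| <o \<mu> \<and> ind A B\<^sub>0 B))"

text \<open>\<open>\<kappa>\<^sub>0\<close> up to isomorphism; regular cardinals are infinite.\<close>

definition is_kappa0 ::
    "('f, 'r, 'a) struct \<Rightarrow> 'k rel \<Rightarrow> ('a set \<Rightarrow> 'a set \<Rightarrow> 'a set \<Rightarrow> bool) \<Rightarrow> 'k rel \<Rightarrow> bool" where
  "is_kappa0 \<CC> (\<Omega> :: 'k rel) ind \<kappa>\<^sub>0 \<longleftrightarrow>
     Cinfinite \<kappa>\<^sub>0 \<and> regularCard \<kappa>\<^sub>0 \<and> finite_local_bound \<CC> \<Omega> ind \<kappa>\<^sub>0 \<and>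
     (\<forall>\<mu> :: 'k rel. Cinfinite \<mu> \<and> regularCard \<mu> \<and> finite_local_bound \<CC> \<Omega> ind \<mu> \<longrightarrow> \<kappa>\<^sub>0 \<le>o \<mu>)"


section \<open>Lovely pairs\<close>

text \<open>The new unary predicate \<open>P\<close> is the relation symbol \<open>None\<close>.\<close>

definition pair_lang :: "('f, 'r) lang \<Rightarrow> ('f, 'r option) lang" where
  "pair_lang L = \<lparr>funs = funs L, rels = {(Some r, k) | r k. (r, k) \<in> rels L} \<union> {(None, 1)}\<rparr>"

definition pair_struct :: "('f, 'r, 'a) struct \<Rightarrow> 'a set \<Rightarrow> ('f, 'r option, 'a) struct" where
  "pair_struct M P = \<lparr>universe = universe M, fun_int = fun_int M,
     rel_int = (\<lambda>r xs. case r of Some r' \<Rightarrow> rel_int M r' xs | None \<Rightarrow> hd xs \<in> P)\<rparr>"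

text \<open>\<open>q \<down>\<^sub>B A\<close> for a type \<open>q\<close> over \<open>A\<close>. By invariance the choice of the realization is immaterial.\<close>

definition type_indep ::
    "('f, 'r, 'a) struct \<Rightarrow> ('a set \<Rightarrow> 'a set \<Rightarrow> 'a set \<Rightarrow> bool) \<Rightarrow>
     ('f + 'a, 'r) fm set \<Rightarrow> 'a set \<Rightarrow> 'a set \<Rightarrow> bool" where
  "type_indep \<CC> ind q B A \<longleftrightarrow> (\<exists>c \<in> universe \<CC>. realizes \<CC> c q \<and> ind {c} B A)"

text \<open>Here \<open>P\<close> is \<open>P(M)\<close>; the type spaces over subsets of \<open>M\<close> may be computed in the monster.\<close>

definition lovely_pair ::
    "('f, 'r) lang \<Rightarrow> ('f, 'r, 'a) struct \<Rightarrow> 'k rel \<Rightarrow> ('a set \<Rightarrow> 'a set \<Rightarrow> 'a set \<Rightarrow> bool) \<Rightarrow>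
     'k rel \<Rightarrow> 'a set \<Rightarrow> 'a set \<Rightarrow> bool" where
  "lovely_pair L \<CC> \<Omega> ind \<kappa> M P \<longleftrightarrow>
     elementary_sub L \<CC> M \<and> small \<CC> \<Omega> M \<and> P \<subseteq> M \<and>
     \<comment> \<open>Density property\<close>
     (\<forall>A q. A \<subseteq> M \<and> |A| <o \<kappa> \<and> q \<in> types1 L \<CC> A \<and> type_indep \<CC> ind q (P \<inter> A) A \<longrightarrow>
        (\<exists>c\<in>P. realizes \<CC> c q)) \<and>
     \<comment> \<open>Extension property\<close>
     (\<forall>A q. A \<subseteq> M \<and> |A| <o \<kappa> \<and> q \<in> types1 L \<CC> A \<longrightarrow>
        (\<exists>b\<in>M. realizes \<CC> b q \<and> ind {b} A P))"

abbreviation sub_pair ::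
    "('f, 'r, 'a) struct \<Rightarrow> 'a set \<Rightarrow> 'a set \<Rightarrow> ('f, 'r option, 'a) struct" where
  "sub_pair \<CC> M P \<equiv> pair_struct (\<CC>\<lparr>universe := M\<rparr>) P"

definition lovely_theory ::
    "('f, 'r) lang \<Rightarrow> ('f, 'r, 'a) struct \<Rightarrow> 'k rel \<Rightarrow> ('a set \<Rightarrow> 'a set \<Rightarrow> 'a set \<Rightarrow> bool) \<Rightarrow>
     'k rel \<Rightarrow> ('f, 'r option) fm set" where
  "lovely_theory L \<CC> \<Omega> ind \<kappa> = {\<phi> \<in> sentences (pair_lang L).
     \<forall>M P. lovely_pair L \<CC> \<Omega> ind \<kappa> M P \<longrightarrow> models (sub_pair \<CC> M P) {\<phi>}}"

text \<open>``Sufficiently saturated'' means \<open>\<mu>\<close>-saturated for a suitable \<open>\<mu>\<close>. Lovely pairs are small, so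
  this only concerns small models, and the monstrosity has to be large enough compared with \<open>\<mu>\<close> for
  small \<open>\<mu>\<close>-saturated models to exist: otherwise the condition would be vacuous. That is what the
  bound on \<open>2\<close> to the power \<open>\<mu> + |T|\<close> expresses; if \<open>\<Omega>\<close> is a strong limit, it only says that \<open>\<mu>\<close>
  (and \<open>|T|\<close>) are small.\<close>

definition loveliness_first_order ::
    "('f, 'r) lang \<Rightarrow> ('f, 'r, 'a) struct \<Rightarrow> 'k rel \<Rightarrow> ('a set \<Rightarrow> 'a set \<Rightarrow> 'a set \<Rightarrow> bool) \<Rightarrow>
     'k rel \<Rightarrow> bool" where
  "loveliness_first_order L \<CC> (\<Omega> :: 'k rel) ind \<kappa> \<longleftrightarrow>
     (\<exists>\<mu> :: 'k rel. Card_order \<mu> \<and> ctwo ^c (\<mu> +c |formulas L| ) <o \<Omega> \<and>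
        (\<forall>M P. elementary_sub L \<CC> M \<and> small \<CC> \<Omega> M \<and> P \<subseteq> M \<and>
           models (sub_pair \<CC> M P) (lovely_theory L \<CC> \<Omega> ind \<kappa>) \<and>
           saturated (pair_lang L) \<mu> (sub_pair \<CC> M P) \<longrightarrow>
           lovely_pair L \<CC> \<Omega> ind \<kappa> M P))"

end

theory Submission
  imports Defs
begin

text \<open>Only one direction has content: a set of tuples from \<open>P\<close> that is definable over \<open>b\<close> with the help of
\<open>P\<close> is the trace of an \<open>L\<close>-definable set. By compactness (lemma \<open>finitely_many_formulas_decide\<close>, which
uses the saturation of the pair for \<open>2m\<close> variables) it is enough that two \<open>m\<close>-tuples \<open>c\<close>, \<open>c'\<close> from \<open>P\<close>
with the same \<open>L\<close>-type over \<open>b\<close> satisfy the same formulas of the pair language over \<open>b\<close>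
(\<open>P_tuples_type_transfer\<close>): \<open>Y\<close> is then, among tuples of \<open>P\<close>, a Boolean combination of finitely many
\<open>L\<close>-formulas over \<open>b\<close>.

For such \<open>c\<close>, \<open>c'\<close>, first pass to a small elementary substructure \<open>(M, P \<inter> M)\<close> of the pair that contains
\<open>b\<close>, \<open>c\<close>, \<open>c'\<close> and is so saturated that it is a lovely pair (\<open>lovely_elementary_substructure\<close>). Its
existence is a matter of cardinality: if \<open>K\<close> is infinite, closing at most \<open>|K|\<close> elements under
at most \<open>2\<close> to the \<open>|K|\<close> operations of arity \<open>K\<close> does not lead beyond the cardinal \<open>2\<close> to the \<open>|K|\<close>
(\<open>closure_card_bound\<close>).

Since \<open>b\<close> is \<open>P\<close>-independent, so are \<open>b c\<close> and \<open>b c'\<close>, because adding elements of \<open>P\<close> preserves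
\<open>P\<close>-independence (\<open>pind_Un\<close>). Hence the map that fixes \<open>b\<close> and sends \<open>c\<close> to \<open>c'\<close> belongs to a back-and-forth system in \<open>(M, P \<inter> M)\<close>: the very small partial \<open>L\<close>-elementary maps that
respect \<open>P\<close>, have \<open>P\<close>-independent domain and range, and have only finitely many points outside \<open>P\<close> in
their domain. To add a point \<open>d\<close> to the domain \<open>A\<close> of such a map (\<open>back_forth_extend\<close>), local character and density
enlarge \<open>A\<close> by points of \<open>P\<close> until \<open>A d\<close> is independent from \<open>P\<close> over \<open>A \<inter> P\<close>; then the extension property
gives an image \<open>d'\<close> of \<open>d\<close> that is independent from \<open>P\<close> over the image of \<open>A\<close>. The point to check is that
\<open>d'\<close> is not in \<open>P\<close> unless \<open>d\<close> is; if it were, then \<open>d'\<close> and hence \<open>d\<close> would be independent from itself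
over the domain, and density would put \<open>d\<close> into \<open>P\<close> (\<open>self_independent_in_P\<close>).\<close>

section \<open>Formulas: substitution, renaming and parameters\<close>

text \<open>The defining equation of \<open>wf_tm\<close> on applications, freed from \<open>list_all\<close>.\<close>
lemma wf_tm_App [simp]: "wf_tm L (App f ts) \<longleftrightarrow> (f, length ts) \<in> funs L \<and> (\<forall>t\<in>set ts. wf_tm L t)"
  by (simp add: list_all_iff)

declare wf_tm.simps(2) [simp del]

lemma finite_tm_vars [simp]: "finite (tm_vars t)"
  by (induction t) auto

lemma finite_fv [simp]: "finite (fv \<phi>)"
  by (induction \<phi>) auto

lemma eval_tm_cong: "(\<And>x. x \<in> tm_vars t \<Longrightarrow> v x = w x) \<Longrightarrow> eval_tm M v t = eval_tm M w t"
proof (induction t)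
  case (App f ts)
  then have "map (eval_tm M v) ts = map (eval_tm M w) ts" by (intro map_cong) auto
  then show ?case by (simp del: map_eq_conv)
qed auto

lemma sat_cong: "(\<And>x. x \<in> fv \<phi> \<Longrightarrow> v x = w x) \<Longrightarrow> sat M v \<phi> \<longleftrightarrow> sat M w \<phi>"
proof (induction \<phi> arbitrary: v w)
  case (Eq s t)
  have "eval_tm M v s = eval_tm M w s" "eval_tm M v t = eval_tm M w t"
    by (rule eval_tm_cong, use Eq in simp)+
  then show ?case by simp
next
  case (Rel r ts)
  then have "map (eval_tm M v) ts = map (eval_tm M w) ts"
    by (intro map_cong refl eval_tm_cong) auto
  then show ?case by (simp del: map_eq_conv)
next
  case (Imp \<phi> \<psi>)
  have "sat M v \<phi> = sat M w \<phi>" by (rule Imp.IH(1)) (simp add: Imp.prems)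
  moreover have "sat M v \<psi> = sat M w \<psi>" by (rule Imp.IH(2)) (simp add: Imp.prems)
  ultimately
  show ?case by simp
next
  case (All x \<phi>)
  have "sat M (v(x := a)) \<phi> = sat M (w(x := a)) \<phi>" for a by (rule All.IH) (use All.prems in auto)
  then show ?case by simp
qed auto

lemma eval_tm_in_universe:
  "is_struct L M \<Longrightarrow> wf_tm L t \<Longrightarrow> v ` tm_vars t \<subseteq> universe M \<Longrightarrow> eval_tm M v t \<in> universe M"
proof (induction t)
  case (App f ts)
  then have "set (map (eval_tm M v) ts) \<subseteq> universe M" by auto
  moreover have "(f, length (map (eval_tm M v) ts)) \<in> funs L" using App.prems by simp
  ultimately have "fun_int M f (map (eval_tm M v) ts) \<in> universe M"
    using App.prems(1) unfolding is_struct_def by fast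
  then show ?case by simp
qed auto

text \<open>Conjunction, finite conjunctions and blocks of universal quantifiers.\<close>
definition Conj :: "('f, 'r) fm \<Rightarrow> ('f, 'r) fm \<Rightarrow> ('f, 'r) fm" where
  "Conj \<phi> \<psi> = Neg (Imp \<phi> (Neg \<psi>))"

definition Conjs :: "('f, 'r) fm list \<Rightarrow> ('f, 'r) fm" where
  "Conjs \<phi>s = foldr Conj \<phi>s (Neg Bot)"

definition Alls :: "nat list \<Rightarrow> ('f, 'r) fm \<Rightarrow> ('f, 'r) fm" where
  "Alls xs \<phi> = foldr All xs \<phi>"

lemma sat_Conj [simp]: "sat M v (Conj \<phi> \<psi>) \<longleftrightarrow> sat M v \<phi> \<and> sat M v \<psi>"
  by (auto simp: Conj_def)

lemma wf_Conj [simp]: "wf_fm L (Conj \<phi> \<psi>) \<longleftrightarrow> wf_fm L \<phi> \<and> wf_fm L \<psi>"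
  by (auto simp: Conj_def)

lemma fv_Conj [simp]: "fv (Conj \<phi> \<psi>) = fv \<phi> \<union> fv \<psi>"
  by (auto simp: Conj_def)

lemma sat_Conjs [simp]: "sat M v (Conjs \<phi>s) \<longleftrightarrow> (\<forall>\<phi>\<in>set \<phi>s. sat M v \<phi>)"
  by (induction \<phi>s) (auto simp: Conjs_def)

lemma wf_Conjs [simp]: "wf_fm L (Conjs \<phi>s) \<longleftrightarrow> (\<forall>\<phi>\<in>set \<phi>s. wf_fm L \<phi>)"
  by (induction \<phi>s) (auto simp: Conjs_def)

lemma fv_Conjs [simp]: "fv (Conjs \<phi>s) = (\<Union>\<phi>\<in>set \<phi>s. fv \<phi>)"
  by (induction \<phi>s) (auto simp: Conjs_def)

lemma wf_Alls [simp]: "wf_fm L (Alls xs \<phi>) \<longleftrightarrow> wf_fm L \<phi>"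
  by (induction xs) (auto simp: Alls_def)

lemma fv_Alls [simp]: "fv (Alls xs \<phi>) = fv \<phi> - set xs"
  by (induction xs) (auto simp: Alls_def)

lemma sat_Alls:
  "sat M v (Alls xs \<phi>) \<longleftrightarrow>
     (\<forall>w. (\<forall>i. i \<notin> set xs \<longrightarrow> w i = v i) \<and> w ` set xs \<subseteq> universe M \<longrightarrow> sat M w \<phi>)"
proof (induction xs arbitrary: v)
  case Nil
  then show ?case by (auto simp: Alls_def fun_eq_iff[symmetric])
next
  case (Cons x xs)
  have "sat M v (Alls (x # xs) \<phi>) \<longleftrightarrow> (\<forall>a\<in>universe M. sat M (v(x := a)) (Alls xs \<phi>))"
    by (simp add: Alls_def)
  also have "\<dots> \<longleftrightarrow> (\<forall>w. (\<forall>i. i \<notin> set (x # xs) \<longrightarrow> w i = v i) \<and> w ` set (x # xs) \<subseteq> universe M \<longrightarrow> sat M w \<phi>)"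
    (is "?l \<longleftrightarrow> ?r")
  proof
    assume l: ?l
    show ?r
    proof (intro allI impI, elim conjE)
      fix w assume w: "\<forall>i. i \<notin> set (x # xs) \<longrightarrow> w i = v i" "w ` set (x # xs) \<subseteq> universe M"
      then have "sat M (v(x := w x)) (Alls xs \<phi>)" using l by auto
      then show "sat M w \<phi>" using w unfolding Cons.IH by auto
    qed
  next
    assume r: ?r
    show ?l unfolding Cons.IH
    proof (intro ballI allI impI, elim conjE)
      fix a w assume a: "a \<in> universe M" "\<forall>i. i \<notin> set xs \<longrightarrow> w i = (v(x := a)) i" "w ` set xs \<subseteq> universe M"
      have "w x \<in> universe M" using a by (cases "x \<in> set xs") auto
      then show "sat M w \<phi>" using a by (intro r[rule_format]) auto
    qed
  qed
  finally show ?case .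
qed

text \<open>A translation between languages: variables, bound ones included, are renamed by \<open>\<rho>\<close>, relation symbols
are replaced along \<open>k\<close>, and a function symbol \<open>f\<close> becomes the function symbol \<open>g\<close> if \<open>h f = Inl g\<close>. If
\<open>h f = Inr j\<close>, every term headed by \<open>f\<close> becomes the variable \<open>j\<close>; this is meant for constants only, and
for \<open>j\<close> outside the range of \<open>\<rho>\<close>, so that no quantifier captures it.\<close>
primrec tr_tm :: "(nat \<Rightarrow> nat) \<Rightarrow> ('f \<Rightarrow> 'g + nat) \<Rightarrow> 'f tm \<Rightarrow> 'g tm" where
  "tr_tm \<rho> h (Var x) = Var (\<rho> x)"
| "tr_tm \<rho> h (App f ts) = (case h f of Inl g \<Rightarrow> App g (map (tr_tm \<rho> h) ts) | Inr j \<Rightarrow> Var j)"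

primrec tr :: "(nat \<Rightarrow> nat) \<Rightarrow> ('f \<Rightarrow> 'g + nat) \<Rightarrow> ('r \<Rightarrow> 's) \<Rightarrow> ('f, 'r) fm \<Rightarrow> ('g, 's) fm" where
  "tr \<rho> h k Bot = Bot"
| "tr \<rho> h k (Eq s t) = Eq (tr_tm \<rho> h s) (tr_tm \<rho> h t)"
| "tr \<rho> h k (Rel r ts) = Rel (k r) (map (tr_tm \<rho> h) ts)"
| "tr \<rho> h k (Imp \<phi> \<psi>) = Imp (tr \<rho> h k \<phi>) (tr \<rho> h k \<psi>)"
| "tr \<rho> h k (All x \<phi>) = All (\<rho> x) (tr \<rho> h k \<phi>)"

lemma wf_tr_tm:
  assumes "\<And>f n. (f, n) \<in> funs L \<Longrightarrow> (case h f of Inl g \<Rightarrow> (g, n) \<in> funs L' | Inr j \<Rightarrow> True)"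
  shows "wf_tm L t \<Longrightarrow> wf_tm L' (tr_tm \<rho> h t)"
proof (induction t)
  case (App f ts)
  then show ?case using assms[of f "length ts"] by (auto split: sum.splits)
qed auto

lemma wf_tr:
  assumes "\<And>f n. (f, n) \<in> funs L \<Longrightarrow> (case h f of Inl g \<Rightarrow> (g, n) \<in> funs L' | Inr j \<Rightarrow> True)"
    and "\<And>r n. (r, n) \<in> rels L \<Longrightarrow> (k r, n) \<in> rels L'"
  shows "wf_fm L \<phi> \<Longrightarrow> wf_fm L' (tr \<rho> h k \<phi>)"
  using wf_tr_tm[where L = L and h = h and L' = L', OF assms(1)] assms(2) by (induction \<phi>) auto

lemma vars_tr_tm:
  "wf_tm L t \<Longrightarrow> tm_vars (tr_tm \<rho> h t) \<subseteq> \<rho> ` tm_vars t \<union> {j. \<exists>f n. (f, n) \<in> funs L \<and> h f = Inr j}"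
proof (induction t)
  case (App f ts)
  show ?case
  proof (cases "h f")
    case (Inl g)
    have "tm_vars (tr_tm \<rho> h (App f ts)) = (\<Union>t\<in>set ts. tm_vars (tr_tm \<rho> h t))" using Inl by auto
    also have "\<dots> \<subseteq> (\<Union>t\<in>set ts. \<rho> ` tm_vars t \<union> {j. \<exists>f n. (f, n) \<in> funs L \<and> h f = Inr j})"
      using App by (intro UN_mono) auto
    finally have "tm_vars (tr_tm \<rho> h (App f ts)) \<subseteq> (\<Union>t\<in>set ts. \<rho> ` tm_vars t \<union> {j. \<exists>f n. (f, n) \<in> funs L \<and> h f = Inr j})" .
    also have "\<dots> \<subseteq> \<rho> ` tm_vars (App f ts) \<union> {j. \<exists>f n. (f, n) \<in> funs L \<and> h f = Inr j}" by auto
    finally show ?thesis .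
  next
    case (Inr j)
    then show ?thesis using App.prems by auto
  qed
qed auto

lemma fv_tr:
  assumes "inj \<rho>"
  shows "wf_fm L \<phi> \<Longrightarrow> fv (tr \<rho> h k \<phi>) \<subseteq> \<rho> ` fv \<phi> \<union> {j. \<exists>f n. (f, n) \<in> funs L \<and> h f = Inr j}"
proof (induction \<phi>)
  case (Eq s t)
  then show ?case using vars_tr_tm[of L s \<rho> h] vars_tr_tm[of L t \<rho> h] by auto
next
  case (Rel r ts)
  have "fv (tr \<rho> h k (Rel r ts)) = (\<Union>t\<in>set ts. tm_vars (tr_tm \<rho> h t))" by simp
  also have "\<dots> \<subseteq> (\<Union>t\<in>set ts. \<rho> ` tm_vars t \<union> {j. \<exists>f n. (f, n) \<in> funs L \<and> h f = Inr j})"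
    using Rel vars_tr_tm[of L _ \<rho> h] by (intro UN_mono) auto
  also have "\<dots> \<subseteq> \<rho> ` fv (Rel r ts) \<union> {j. \<exists>f n. (f, n) \<in> funs L \<and> h f = Inr j}" by auto
  finally show ?case .
next
  case (All x \<phi>)
  then show ?case using assms by (auto dest: injD)
qed auto

text \<open>The condition under which a formula holds in \<open>N\<close> iff its translation holds in \<open>M\<close>: the symbols of \<open>L\<close>
and their translations have the same interpretation, where the variables that replace constants
are evaluated by \<open>v\<close>.\<close>
definition tr_compat where
  "tr_compat L \<rho> h k M N v \<longleftrightarrow> universe M = universe N \<and>
     (\<forall>f n xs. (f, n) \<in> funs L \<and> length xs = n \<longrightarrow>
        (case h f of Inl g \<Rightarrow> fun_int M g xs = fun_int N f xs
                   | Inr j \<Rightarrow> j \<notin> range \<rho> \<and> v j = fun_int N f xs)) \<and>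
     (\<forall>r n xs. (r, n) \<in> rels L \<and> length xs = n \<longrightarrow> rel_int M (k r) xs = rel_int N r xs)"

lemma eval_tr_tm:
  assumes "tr_compat L \<rho> h k M N v"
  shows "wf_tm L t \<Longrightarrow> eval_tm M v (tr_tm \<rho> h t) = eval_tm N (\<lambda>i. v (\<rho> i)) t"
proof (induction t)
  case (App f ts)
  have eq: "map (eval_tm M v) (map (tr_tm \<rho> h) ts) = map (eval_tm N (\<lambda>i. v (\<rho> i))) ts"
    using App by auto
  have "(f, length ts) \<in> funs L" using App.prems by simp
  then have *: "\<forall>xs. length xs = length ts \<longrightarrow>
      (case h f of Inl g \<Rightarrow> fun_int M g xs = fun_int N f xs
                 | Inr j \<Rightarrow> j \<notin> range \<rho> \<and> v j = fun_int N f xs)"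
    using assms unfolding tr_compat_def by blast
  show ?case
    using *[rule_format, of "map (eval_tm N (\<lambda>i. v (\<rho> i))) ts"] eq
    by (cases "h f") (simp_all del: map_map map_eq_conv)
qed auto

lemma sat_tr:
  assumes "inj \<rho>"
  shows "tr_compat L \<rho> h k M N v \<Longrightarrow> wf_fm L \<phi> \<Longrightarrow> sat M v (tr \<rho> h k \<phi>) \<longleftrightarrow> sat N (\<lambda>i. v (\<rho> i)) \<phi>"
proof (induction \<phi> arbitrary: v)
  case (Eq s t)
  then show ?case by (simp add: eval_tr_tm)
next
  case (Rel r ts)
  have eq: "map (eval_tm M v) (map (tr_tm \<rho> h) ts) = map (eval_tm N (\<lambda>i. v (\<rho> i))) ts"
    using Rel eval_tr_tm[of L \<rho> h k M N v] by auto
  have "rel_int M (k r) xs = rel_int N r xs" if "length xs = length ts" for xs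
    using Rel that unfolding tr_compat_def by auto
  then show ?case using eq by (simp del: map_map map_eq_conv)
next
  case (All x \<phi>)
  have "sat M (v(\<rho> x := a)) (tr \<rho> h k \<phi>) \<longleftrightarrow> sat N ((\<lambda>i. v (\<rho> i))(x := a)) \<phi>" for a
  proof -
    have "tr_compat L \<rho> h k M N (v(\<rho> x := a))"
      using All.prems(1) unfolding tr_compat_def by (auto split: sum.splits) blast
    moreover have "wf_fm L \<phi>" using All.prems(2) by simp
    ultimately have "sat M (v(\<rho> x := a)) (tr \<rho> h k \<phi>) \<longleftrightarrow> sat N (\<lambda>i. (v(\<rho> x := a)) (\<rho> i)) \<phi>"
      by (rule All.IH)
    also have "(\<lambda>i. (v(\<rho> x := a)) (\<rho> i)) = (\<lambda>i. v (\<rho> i))(x := a)"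
      using assms by (auto simp: fun_eq_iff dest: injD)
    finally show ?thesis .
  qed
  moreover have "universe M = universe N" using All.prems(1) unfolding tr_compat_def by simp
  ultimately show ?case by simp
qed auto

lemma funs_lang_par: "(g, n) \<in> funs (lang_par L A) \<longleftrightarrow>
    (\<exists>f. g = Inl f \<and> (f, n) \<in> funs L) \<or> (\<exists>a\<in>A. g = Inr a \<and> n = 0)"
  by (auto simp: lang_par_def)

lemma rels_lang_par [simp]: "rels (lang_par L A) = rels L"
  by (simp add: lang_par_def)

lemma struct_par_sel [simp]:
  "universe (struct_par M) = universe M" "rel_int (struct_par M) = rel_int M"
  "fun_int (struct_par M) (Inl f) xs = fun_int M f xs" "fun_int (struct_par M) (Inr a) xs = a"
  by (auto simp: struct_par_def)

lemma formulas_iff: "\<phi> \<in> formulas L \<longleftrightarrow> wf_fm L \<phi>"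
  by (simp add: formulas_def)

text \<open>Simultaneous substitution of terms of \<open>L(B)\<close> for the free variables of an \<open>L\<close>-formula. Capture is
avoided by shifting all variables of \<open>\<phi>\<close> by \<open>m\<close> and writing ``for all values of the shifted variables,
if they equal the terms, then \<open>\<phi>\<close>''.\<close>
lemma subst_formula:
  fixes B :: "'a set"
  assumes \<phi>: "\<phi> \<in> formulas L"
    and t: "\<And>i. i \<in> fv \<phi> \<Longrightarrow> wf_tm (lang_par L B) (t i) \<and> tm_vars (t i) \<subseteq> {..<m}"
  shows "\<exists>\<psi>\<in>formulas (lang_par L B). fv \<psi> \<subseteq> {..<m} \<and>
    (\<forall>N v. (\<forall>i\<in>fv \<phi>. eval_tm (struct_par N) v (t i) \<in> universe N) \<longrightarrow>
       (sat (struct_par N) v \<psi> \<longleftrightarrow> sat N (\<lambda>i. eval_tm (struct_par N) v (t i)) \<phi>))"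
proof -
  define vs where "vs = sorted_list_of_set (fv \<phi>)"
  have set_vs: "set vs = fv \<phi>" by (simp add: vs_def)
  define \<rho> where "\<rho> = (\<lambda>i. i + m)"
  have inj: "inj \<rho>" by (auto simp: \<rho>_def inj_def)
  define \<phi>' :: "(_ + 'a, _) fm" where "\<phi>' = tr \<rho> (\<lambda>f. Inl (Inl f)) (\<lambda>r. r) \<phi>"
  have wf': "wf_fm (lang_par L B) \<phi>'" unfolding \<phi>'_def
    by (rule wf_tr[where L = L]) (use \<phi> in \<open>auto simp: funs_lang_par formulas_iff\<close>)
  have fv': "fv \<phi>' \<subseteq> \<rho> ` fv \<phi>" unfolding \<phi>'_def
    using fv_tr[OF inj, of L \<phi> "(\<lambda>f. Inl (Inl f))" "(\<lambda>r. r)"] \<phi> by (auto simp: formulas_iff)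
  have sat': "sat (struct_par N) v \<phi>' \<longleftrightarrow> sat N (\<lambda>i. v (\<rho> i)) \<phi>" for N v
    unfolding \<phi>'_def by (rule sat_tr[OF inj]) (use \<phi> in \<open>auto simp: tr_compat_def formulas_iff\<close>)
  define \<psi> where "\<psi> = Alls (map \<rho> vs) (Imp (Conjs (map (\<lambda>i. Eq (Var (\<rho> i)) (t i)) vs)) \<phi>')"
  have "wf_fm (lang_par L B) \<psi>" using wf' t by (auto simp: \<psi>_def set_vs)
  moreover have "fv \<psi> \<subseteq> {..<m}" using fv' t by (fastforce simp: \<psi>_def set_vs)
  moreover have "sat (struct_par N) v \<psi> \<longleftrightarrow> sat N (\<lambda>i. eval_tm (struct_par N) v (t i)) \<phi>"
    if U: "\<forall>i\<in>fv \<phi>. eval_tm (struct_par N) v (t i) \<in> universe N" for N v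
  proof -
    define e where "e = (\<lambda>i. eval_tm (struct_par N) v (t i))"
    have ev: "eval_tm (struct_par N) w (t i) = e i"
      if "\<forall>j. j \<notin> \<rho> ` fv \<phi> \<longrightarrow> w j = v j" "i \<in> fv \<phi>" for w i
    proof -
      have "x \<notin> \<rho> ` fv \<phi>" if "x < m" for x using that by (auto simp: \<rho>_def)
      then have "\<forall>x\<in>tm_vars (t i). w x = v x" using t[OF that(2)] that(1) by blast
      then show ?thesis unfolding e_def by (intro eval_tm_cong) auto
    qed
    have "sat (struct_par N) v \<psi> \<longleftrightarrow>
       (\<forall>w. (\<forall>j. j \<notin> \<rho> ` fv \<phi> \<longrightarrow> w j = v j) \<and> w ` \<rho> ` fv \<phi> \<subseteq> universe N \<longrightarrow>
          (\<forall>i\<in>fv \<phi>. w (\<rho> i) = e i) \<longrightarrow> sat N (\<lambda>i. w (\<rho> i)) \<phi>)"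
      unfolding \<psi>_def sat_Alls using ev by (auto simp: set_vs sat')
    also have "\<dots> \<longleftrightarrow> sat N e \<phi>"
    proof
      assume l: "\<forall>w. (\<forall>j. j \<notin> \<rho> ` fv \<phi> \<longrightarrow> w j = v j) \<and> w ` \<rho> ` fv \<phi> \<subseteq> universe N \<longrightarrow>
          (\<forall>i\<in>fv \<phi>. w (\<rho> i) = e i) \<longrightarrow> sat N (\<lambda>i. w (\<rho> i)) \<phi>"
      define w where "w j = (if j \<in> \<rho> ` fv \<phi> then e (j - m) else v j)" for j
      have w: "w (\<rho> i) = e i" if "i \<in> fv \<phi>" for i using that by (auto simp: w_def \<rho>_def)
      have "sat N (\<lambda>i. w (\<rho> i)) \<phi>" 
        by (rule l[rule_format]) (use w U in \<open>auto simp: e_def[symmetric]\<close>, auto simp: w_def e_def)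
      then show "sat N e \<phi>" using w sat_cong[of \<phi> "\<lambda>i. w (\<rho> i)" e N] by auto
    next
      assume e: "sat N e \<phi>"
      show "\<forall>w. (\<forall>j. j \<notin> \<rho> ` fv \<phi> \<longrightarrow> w j = v j) \<and> w ` \<rho> ` fv \<phi> \<subseteq> universe N \<longrightarrow>
          (\<forall>i\<in>fv \<phi>. w (\<rho> i) = e i) \<longrightarrow> sat N (\<lambda>i. w (\<rho> i)) \<phi>"
      proof (intro allI impI)
        fix w assume "\<forall>i\<in>fv \<phi>. w (\<rho> i) = e i"
        then show "sat N (\<lambda>i. w (\<rho> i)) \<phi>" using e sat_cong[of \<phi> "\<lambda>i. w (\<rho> i)" e N] by simp
      qed
    qed
    finally show ?thesis unfolding e_def .
  qed
  ultimately show ?thesis unfolding formulas_iff[symmetric] by blast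
qed

lemma wf_tm_lang_par_mono: "A \<subseteq> B \<Longrightarrow> wf_tm (lang_par L A) t \<Longrightarrow> wf_tm (lang_par L B) t"
  by (induction t) (auto simp: funs_lang_par)

lemma wf_tm_finite_par: "wf_tm (lang_par L A) t \<Longrightarrow> \<exists>A0. finite A0 \<and> A0 \<subseteq> A \<and> wf_tm (lang_par L A0) t"
proof (induction t)
  case (App g ts)
  then have "\<forall>t\<in>set ts. \<exists>A0. finite A0 \<and> A0 \<subseteq> A \<and> wf_tm (lang_par L A0) t" by auto
  then obtain F where F: "\<And>t. t \<in> set ts \<Longrightarrow> finite (F t) \<and> F t \<subseteq> A \<and> wf_tm (lang_par L (F t)) t"
    by metis
  have "\<exists>A1. finite A1 \<and> A1 \<subseteq> A \<and> (g, length ts) \<in> funs (lang_par L A1)"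
  proof (cases g)
    case (Inl f)
    then show ?thesis using App.prems by (intro exI[of _ "{}"]) (auto simp: funs_lang_par)
  next
    case (Inr a)
    then show ?thesis using App.prems by (intro exI[of _ "{a}"]) (auto simp: funs_lang_par)
  qed
  then obtain A1 where A1: "finite A1" "A1 \<subseteq> A" "(g, length ts) \<in> funs (lang_par L A1)" by blast
  define A0 where "A0 = A1 \<union> (\<Union>t\<in>set ts. F t)"
  have "wf_tm (lang_par L A0) t" if "t \<in> set ts" for t
    by (rule wf_tm_lang_par_mono[of "F t"]) (use F that in \<open>auto simp: A0_def\<close>)
  moreover have "(g, length ts) \<in> funs (lang_par L A0)" using A1(3) by (auto simp: A0_def funs_lang_par)
  ultimately have "wf_tm (lang_par L A0) (App g ts)" by simp
  moreover have "finite A0" "A0 \<subseteq> A" using A1 F by (auto simp: A0_def)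
  ultimately show ?case by blast
qed auto

lemma wf_fm_lang_par_mono: "A \<subseteq> B \<Longrightarrow> wf_fm (lang_par L A) \<phi> \<Longrightarrow> wf_fm (lang_par L B) \<phi>"
  by (induction \<phi>) (auto simp: wf_tm_lang_par_mono)

lemma wf_fm_finite_par: "wf_fm (lang_par L A) \<phi> \<Longrightarrow> \<exists>A0. finite A0 \<and> A0 \<subseteq> A \<and> wf_fm (lang_par L A0) \<phi>"
proof (induction \<phi>)
  case (Eq s t)
  then obtain A1 A2 where "finite A1" "A1 \<subseteq> A" "wf_tm (lang_par L A1) s"
    "finite A2" "A2 \<subseteq> A" "wf_tm (lang_par L A2) t" using wf_tm_finite_par[of L A] by (metis wf_fm.simps(2))
  then show ?case by (intro exI[of _ "A1 \<union> A2"]) (auto intro: wf_tm_lang_par_mono)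
next
  case (Rel r ts)
  then have "\<forall>t\<in>set ts. \<exists>A0. finite A0 \<and> A0 \<subseteq> A \<and> wf_tm (lang_par L A0) t"
    using wf_tm_finite_par[of L A] by auto
  then obtain F where F: "\<And>t. t \<in> set ts \<Longrightarrow> finite (F t) \<and> F t \<subseteq> A \<and> wf_tm (lang_par L (F t)) t"
    by metis
  have "wf_tm (lang_par L (\<Union>t\<in>set ts. F t)) t" if "t \<in> set ts" for t
    by (rule wf_tm_lang_par_mono[of "F t"]) (use F that in auto)
  then show ?case using F Rel.prems by (intro exI[of _ "\<Union>t\<in>set ts. F t"]) auto
next
  case (Imp \<phi> \<psi>)
  then obtain A1 A2 where "finite A1" "A1 \<subseteq> A" "wf_fm (lang_par L A1) \<phi>"
    "finite A2" "A2 \<subseteq> A" "wf_fm (lang_par L A2) \<psi>" by auto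
  then show ?case by (intro exI[of _ "A1 \<union> A2"]) (auto intro: wf_fm_lang_par_mono)
qed auto

text \<open>The reverse direction: parameters \<open>a\<close> are turned into variables \<open>e a\<close> kept apart from the renamed
variables of the formula.\<close>
lemma sat_unpar:
  assumes "inj \<rho>" "range \<rho> \<inter> range e = {}" "\<phi> \<in> formulas (lang_par L A)" "\<And>a. a \<in> A \<Longrightarrow> v (e a) = a"
  shows "sat N v (tr \<rho> (map_sum id e) (\<lambda>r. r) \<phi>) \<longleftrightarrow> sat (struct_par N) (\<lambda>i. v (\<rho> i)) \<phi>"
  by (rule sat_tr[OF assms(1), where L = "lang_par L A"])
    (use assms in \<open>auto simp: tr_compat_def formulas_iff funs_lang_par\<close>)

lemma wf_unpar:
  "\<phi> \<in> formulas (lang_par L A) \<Longrightarrow> tr \<rho> (map_sum id e) (\<lambda>r. r) \<phi> \<in> formulas L"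
  unfolding formulas_iff by (erule wf_tr[rotated 2]) (auto simp: funs_lang_par)

lemma fv_unpar:
  "inj \<rho> \<Longrightarrow> \<phi> \<in> formulas (lang_par L A) \<Longrightarrow> fv (tr \<rho> (map_sum id e) (\<lambda>r. r) \<phi>) \<subseteq> \<rho> ` fv \<phi> \<union> e ` A"
  unfolding formulas_iff
  using fv_tr[of \<rho> "lang_par L A" \<phi> "map_sum id e" "(\<lambda>r. r)"] by (fastforce simp: funs_lang_par)

text \<open>The assignment with the values of \<open>v\<close> at the even variables and the entries of \<open>xs\<close> at the odd ones.\<close>
definition asg :: "(nat \<Rightarrow> 'a) \<Rightarrow> 'a list \<Rightarrow> nat \<Rightarrow> 'a" where
  "asg v xs i = (if even i then v (i div 2) else xs ! (i div 2))"

lemma parameters_to_variables: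
  assumes "\<phi> \<in> formulas (lang_par L A)"
  shows "\<exists>\<psi>\<in>formulas L. \<exists>xs. set xs \<subseteq> A \<and>
      fv \<psi> \<subseteq> (\<lambda>i. 2 * i) ` fv \<phi> \<union> {2 * j + 1 | j. j < length xs} \<and>
      (\<forall>N v. sat (struct_par N) v \<phi> \<longleftrightarrow> sat N (asg v xs) \<psi>)"
proof -
  obtain A0 where A0: "finite A0" "A0 \<subseteq> A" "\<phi> \<in> formulas (lang_par L A0)"
    using wf_fm_finite_par[of L A \<phi>] assms unfolding formulas_iff by auto
  obtain xs where xs: "set xs = A0" using A0(1) finite_list by blast
  define ix where "ix a = (SOME j. j < length xs \<and> xs ! j = a)" for a
  have ix: "ix a < length xs \<and> xs ! ix a = a" if "a \<in> A0" for a
    unfolding ix_def by (rule someI_ex) (use that xs in \<open>auto simp: in_set_conv_nth\<close>)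
  define \<rho> where "\<rho> = (\<lambda>i::nat. 2 * i)"
  define e where "e a = 2 * ix a + 1" for a
  have inj: "inj \<rho>" by (auto simp: \<rho>_def inj_def)
  have dis: "range \<rho> \<inter> range e = {}" 
  proof -
    have "2 * i \<noteq> Suc (2 * j)" for i j :: nat by arith
    then show ?thesis by (auto simp: \<rho>_def e_def)
  qed
  define \<psi> where "\<psi> = tr \<rho> (map_sum id e) (\<lambda>r. r) \<phi>"
  have "sat N (asg v xs) \<psi> \<longleftrightarrow> sat (struct_par N) v \<phi>" for N v
  proof -
    have "asg v xs (e a) = a" if "a \<in> A0" for a using ix[OF that] by (simp add: asg_def e_def)
    moreover have "(\<lambda>i. asg v xs (\<rho> i)) = v" by (auto simp: asg_def \<rho>_def)
    ultimately show ?thesis unfolding \<psi>_def using sat_unpar[OF inj dis A0(3)] by auto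
  qed
  moreover have "\<psi> \<in> formulas L" unfolding \<psi>_def by (rule wf_unpar[OF A0(3)])
  moreover have "fv \<psi> \<subseteq> (\<lambda>i. 2 * i) ` fv \<phi> \<union> {2 * j + 1 | j. j < length xs}"
    using fv_unpar[OF inj A0(3), of e] ix unfolding \<psi>_def by (fastforce simp: \<rho>_def e_def)
  ultimately show ?thesis using xs A0(2) by (intro bexI[of _ \<psi>] exI[of _ xs]) auto
qed

text \<open>For finite \<open>\<Psi>\<close>, every condition on which members of \<open>\<Psi>\<close> hold is expressed by a formula.\<close>
lemma pattern_formula:
  fixes L :: "('f, 'r) lang"
  assumes "finite \<Psi>" "\<Psi> \<subseteq> formulas L"
  shows "\<exists>\<chi>\<in>formulas L. fv \<chi> \<subseteq> (\<Union>\<psi>\<in>\<Psi>. fv \<psi>) \<and> (\<forall>(M :: ('f, 'r, 'a) struct) v. sat M v \<chi> \<longleftrightarrow> {\<psi>\<in>\<Psi>. sat M v \<psi>} \<in> \<S>)"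
  using assms
proof (induction \<Psi> arbitrary: \<S>)
  case empty
  show ?case
  proof (cases "{} \<in> \<S>")
    case True
    then show ?thesis by (intro bexI[of _ "Neg Bot"]) (auto simp: formulas_iff)
  next
    case False
    then show ?thesis by (intro bexI[of _ Bot]) (auto simp: formulas_iff)
  qed
next
  case (insert \<psi> \<Psi>)
  obtain \<chi>1 where 1: "\<chi>1 \<in> formulas L" "fv \<chi>1 \<subseteq> (\<Union>\<psi>\<in>\<Psi>. fv \<psi>)"
    "\<And>(M :: ('f, 'r, 'a) struct) v. sat M v \<chi>1 \<longleftrightarrow> {\<psi>\<in>\<Psi>. sat M v \<psi>} \<in> {S. insert \<psi> S \<in> \<S>}"
    using insert.IH[of "{S. insert \<psi> S \<in> \<S>}"] insert.prems by auto
  obtain \<chi>2 where 2: "\<chi>2 \<in> formulas L" "fv \<chi>2 \<subseteq> (\<Union>\<psi>\<in>\<Psi>. fv \<psi>)"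
    "\<And>(M :: ('f, 'r, 'a) struct) v. sat M v \<chi>2 \<longleftrightarrow> {\<psi>\<in>\<Psi>. sat M v \<psi>} \<in> \<S>"
    using insert.IH[of \<S>] insert.prems by auto
  define \<chi> where "\<chi> = Conj (Imp \<psi> \<chi>1) (Imp (Neg \<psi>) \<chi>2)"
  have "sat M v \<chi> \<longleftrightarrow> {\<psi>'\<in>insert \<psi> \<Psi>. sat M v \<psi>'} \<in> \<S>" for M :: "('f, 'r, 'a) struct" and v
  proof -
    have "{\<psi>'\<in>insert \<psi> \<Psi>. sat M v \<psi>'} =
      (if sat M v \<psi> then insert \<psi> {\<psi>'\<in>\<Psi>. sat M v \<psi>'} else {\<psi>'\<in>\<Psi>. sat M v \<psi>'})" by auto
    then show ?thesis using 1(3) 2(3) by (simp add: \<chi>_def)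
  qed
  moreover have "\<chi> \<in> formulas L" "fv \<chi> \<subseteq> (\<Union>\<psi>\<in>insert \<psi> \<Psi>. fv \<psi>)"
    using 1 2 insert.prems by (auto simp: \<chi>_def formulas_iff)
  ultimately show ?case by blast
qed

section \<open>Types and saturation\<close>

text \<open>The complete type of \<open>c\<close> over \<open>A\<close>, in the variable 0.\<close>
definition tp :: "('f, 'r) lang \<Rightarrow> ('f, 'r, 'a) struct \<Rightarrow> 'a set \<Rightarrow> 'a \<Rightarrow> ('f + 'a, 'r) fm set" where
  "tp L M A c = {\<phi> \<in> formulas (lang_par L A). fv \<phi> \<subseteq> {0} \<and> sat (struct_par M) (\<lambda>_. c) \<phi>}"

lemma realizes_tp: "realizes M c (tp L M A c)"
  by (auto simp: realizes_def tp_def)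

lemma tp_in_types1:
  assumes "c \<in> universe M"
  shows "tp L M A c \<in> types1 L M A"
proof -
  have "\<exists>c\<in>universe M. realizes M c p" if "p \<subseteq> tp L M A c" for p
    using that assms realizes_tp[of M c L A] by (auto simp: realizes_def)
  then show ?thesis unfolding types1_def by (auto simp: tp_def formulas_iff)
qed

lemma realizes_tp_iff:
  assumes "realizes M d (tp L M A c)" "\<phi> \<in> formulas (lang_par L A)" "fv \<phi> \<subseteq> {0}"
  shows "sat (struct_par M) (\<lambda>_. d) \<phi> \<longleftrightarrow> sat (struct_par M) (\<lambda>_. c) \<phi>"
proof -
  have "\<psi> \<in> tp L M A c \<Longrightarrow> sat (struct_par M) (\<lambda>_. d) \<psi>" for \<psi>
    using assms(1) by (auto simp: realizes_def)
  from this[of \<phi>] this[of "Neg \<phi>"] show ?thesis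
    using assms(2,3) by (auto simp: tp_def formulas_iff)
qed

lemma realizes_tp_in:
  assumes "c \<in> A" "realizes M d (tp L M A c)"
  shows "d = c"
  using realizes_tp_iff[OF assms(2), of "Eq (Var 0) (App (Inr c) [])"] assms(1)
  by (auto simp: formulas_iff funs_lang_par)

text \<open>Lindenbaum's lemma for 1-types, by Zorn's lemma.\<close>
lemma extend_to_type:
  assumes \<Phi>: "\<Phi> \<subseteq> {\<phi> \<in> formulas (lang_par L A). fv \<phi> \<subseteq> {0}}"
    and fs: "\<And>F. finite F \<Longrightarrow> F \<subseteq> \<Phi> \<Longrightarrow> \<exists>c\<in>universe M. realizes M c F"
  shows "\<exists>p\<in>types1 L M A. \<Phi> \<subseteq> p"
proof -
  define X where "X = {p. p \<subseteq> {\<phi> \<in> formulas (lang_par L A). fv \<phi> \<subseteq> {0}} \<and> \<Phi> \<subseteq> p \<and>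
     (\<forall>F. finite F \<and> F \<subseteq> p \<longrightarrow> (\<exists>c\<in>universe M. realizes M c F))}"
  have "\<exists>p\<in>X. \<forall>q\<in>X. p \<subseteq> q \<longrightarrow> q = p"
  proof (rule subset_Zorn_nonempty)
    have "\<Phi> \<in> X" unfolding X_def mem_Collect_eq using \<Phi> fs by simp
    then show "X \<noteq> {}" by blast
  next
    fix C assume C: "C \<noteq> {}" "subset.chain X C"
    have "C \<subseteq> X" using C(2) by (simp add: subset_chain_def)
    then have "\<Union>C \<subseteq> {\<phi> \<in> formulas (lang_par L A). fv \<phi> \<subseteq> {0}}" "\<Phi> \<subseteq> \<Union>C"
      using C(1) unfolding X_def by blast+
    moreover have "\<exists>c\<in>universe M. realizes M c F" if F: "finite F" "F \<subseteq> \<Union>C" for F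
    proof -
      obtain p where "p \<in> C" "F \<subseteq> p"
        using finite_subset_Union_chain[OF F C] by blast
      then show ?thesis using F \<open>C \<subseteq> X\<close> by (auto simp: X_def)
    qed
    ultimately show "\<Union>C \<in> X" unfolding X_def by blast
  qed
  then obtain p where p: "p \<in> X" and max: "\<And>q. q \<in> X \<Longrightarrow> p \<subseteq> q \<Longrightarrow> q = p" by blast
  have compl: "\<phi> \<in> p \<or> Neg \<phi> \<in> p" if \<phi>: "\<phi> \<in> formulas (lang_par L A)" "fv \<phi> \<subseteq> {0}" for \<phi>
  proof (rule ccontr)
    assume n: "\<not> (\<phi> \<in> p \<or> Neg \<phi> \<in> p)"
    have *: "\<exists>F. finite F \<and> F \<subseteq> p \<and> (\<forall>c\<in>universe M. realizes M c F \<longrightarrow> \<not> sat (struct_par M) (\<lambda>_. c) \<psi>)"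
      if \<psi>: "\<psi> \<in> formulas (lang_par L A)" "fv \<psi> \<subseteq> {0}" "\<psi> \<notin> p" for \<psi>
    proof -
      have "insert \<psi> p \<notin> X" using max[of "insert \<psi> p"] \<psi>(3) by auto
      then obtain F where F: "finite F" "F \<subseteq> insert \<psi> p" "\<not> (\<exists>c\<in>universe M. realizes M c F)"
        using p \<psi> unfolding X_def by auto
      then show ?thesis by (intro exI[of _ "F - {\<psi>}"]) (auto simp: realizes_def)
    qed
    obtain F1 where F1: "finite F1" "F1 \<subseteq> p"
      "\<forall>c\<in>universe M. realizes M c F1 \<longrightarrow> \<not> sat (struct_par M) (\<lambda>_. c) \<phi>" using *[of \<phi>] \<phi> n by auto
    obtain F2 where F2: "finite F2" "F2 \<subseteq> p"
      "\<forall>c\<in>universe M. realizes M c F2 \<longrightarrow> \<not> sat (struct_par M) (\<lambda>_. c) (Neg \<phi>)"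
      using *[of "Neg \<phi>"] \<phi> n by (auto simp: formulas_iff)
    have "finite (F1 \<union> F2)" "F1 \<union> F2 \<subseteq> p" using F1 F2 by auto
    then obtain c where "c \<in> universe M" "realizes M c (F1 \<union> F2)" using p unfolding X_def by blast
    then show False using F1 F2 by (auto simp: realizes_def)
  qed
  have "p \<in> types1 L M A" unfolding types1_def using p compl by (auto simp: X_def)
  moreover have "\<Phi> \<subseteq> p" using p by (simp add: X_def)
  ultimately show ?thesis by blast
qed

text \<open>All free variables of \<open>\<phi>\<close> but \<open>k\<close> are replaced by parameters, and \<open>k\<close> is renamed to 0.\<close>
lemma one_variable_formula:
  fixes L :: "('f, 'r) lang" and v :: "nat \<Rightarrow> 'a"
  assumes \<phi>: "\<phi> \<in> formulas L" and B: "v ` (fv \<phi> - {k}) \<subseteq> B"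
  shows "\<exists>\<psi>\<in>formulas (lang_par L B). fv \<psi> \<subseteq> {0} \<and>
    (\<forall>N a. a \<in> universe N \<and> v ` (fv \<phi> - {k}) \<subseteq> universe N \<longrightarrow>
       (sat (struct_par N) (\<lambda>_. a) \<psi> \<longleftrightarrow> sat N (v(k := a)) \<phi>))"
proof -
  define t :: "nat \<Rightarrow> ('f + 'a) tm" where "t i = (if i = k then Var 0 else App (Inr (v i)) [])" for i
  have ev: "(\<lambda>i. eval_tm (struct_par N) (\<lambda>_. a) (t i)) = v(k := a)" for N and a :: 'a
    by (auto simp: t_def)
  have t: "wf_tm (lang_par L B) (t i) \<and> tm_vars (t i) \<subseteq> {..<1}" if "i \<in> fv \<phi>" for i
    using that B by (auto simp: t_def funs_lang_par)
  obtain \<psi> where \<psi>: "\<psi> \<in> formulas (lang_par L B)" "fv \<psi> \<subseteq> {..<1}"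
      "\<And>N v. (\<forall>i\<in>fv \<phi>. eval_tm (struct_par N) v (t i) \<in> universe N) \<Longrightarrow>
       (sat (struct_par N) v \<psi> \<longleftrightarrow> sat N (\<lambda>i. eval_tm (struct_par N) v (t i)) \<phi>)"
    using subst_formula[of \<phi> L B t 1, OF \<phi> t] by blast
  have "sat (struct_par N) (\<lambda>_. a) \<psi> \<longleftrightarrow> sat N (v(k := a)) \<phi>"
    if "a \<in> universe N" "v ` (fv \<phi> - {k}) \<subseteq> universe N" for N a
  proof -
    have "\<forall>i\<in>fv \<phi>. eval_tm (struct_par N) (\<lambda>_. a) (t i) \<in> universe N"
      using that by (auto simp: t_def)
    from \<psi>(3)[OF this] show ?thesis unfolding ev .
  qed
  then show ?thesis using \<psi>(1,2) by (intro bexI[of _ \<psi>]) (auto simp: lessThan_Suc)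
qed

lemma saturated_realizes_one:
  assumes sat: "saturated L \<mu> M" and U: "range v \<subseteq> universe M" and small: "|range v| <o \<mu>"
    and \<Phi>: "\<Phi> \<subseteq> formulas L"
    and fs: "\<And>F. finite F \<Longrightarrow> F \<subseteq> \<Phi> \<Longrightarrow> \<exists>a\<in>universe M. \<forall>\<phi>\<in>F. sat M (v(k := a)) \<phi>"
  shows "\<exists>a\<in>universe M. \<forall>\<phi>\<in>\<Phi>. sat M (v(k := a)) \<phi>"
proof -
  have "\<exists>\<psi>. \<psi> \<in> formulas (lang_par L (range v)) \<and> fv \<psi> \<subseteq> {0} \<and>
      (\<forall>a\<in>universe M. sat (struct_par M) (\<lambda>_. a) \<psi> \<longleftrightarrow> sat M (v(k := a)) \<phi>)" if "\<phi> \<in> \<Phi>" for \<phi>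
  proof -
    have "\<phi> \<in> formulas L" using that \<Phi> by blast
    moreover have "v ` (fv \<phi> - {k}) \<subseteq> range v" by auto
    moreover have "v ` (fv \<phi> - {k}) \<subseteq> universe M" using U by auto
    ultimately show ?thesis using one_variable_formula[of \<phi> L v k "range v"] by blast
  qed
  then obtain g where g: "\<And>\<phi>. \<phi> \<in> \<Phi> \<Longrightarrow> g \<phi> \<in> formulas (lang_par L (range v)) \<and> fv (g \<phi>) \<subseteq> {0} \<and>
      (\<forall>a\<in>universe M. sat (struct_par M) (\<lambda>_. a) (g \<phi>) \<longleftrightarrow> sat M (v(k := a)) \<phi>)" by metis
  have "\<exists>p\<in>types1 L M (range v). g ` \<Phi> \<subseteq> p"
  proof (rule extend_to_type)
    show "g ` \<Phi> \<subseteq> {\<phi> \<in> formulas (lang_par L (range v)). fv \<phi> \<subseteq> {0}}" using g by auto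
  next
    fix F assume "finite F" "F \<subseteq> g ` \<Phi>"
    then obtain F' where F': "finite F'" "F' \<subseteq> \<Phi>" "F = g ` F'" by (metis finite_subset_image)
    then obtain a where "a \<in> universe M" "\<forall>\<phi>\<in>F'. sat M (v(k := a)) \<phi>" using fs by blast
    then have "realizes M a F" using F' g by (auto simp: realizes_def subset_iff)
    then show "\<exists>c\<in>universe M. realizes M c F" using \<open>a \<in> universe M\<close> by blast
  qed
  then obtain p where p: "p \<in> types1 L M (range v)" "g ` \<Phi> \<subseteq> p" by blast
  then obtain c where c: "c \<in> universe M" "realizes M c p"
    using sat U small unfolding saturated_def by blast
  then show ?thesis using p g by (auto simp: realizes_def) blast
qed

lemma countable_range_small:
  assumes "natLeq <o (\<mu> :: 'k rel)"
  shows "|range (v :: nat \<Rightarrow> 'a)| <o \<mu>"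
proof -
  have "|range v| \<le>o |UNIV :: nat set|" by (rule card_of_image)
  also have "|UNIV :: nat set| =o natLeq" by (rule card_of_nat)
  finally show ?thesis using assms by (rule ordLeq_ordLess_trans)
qed

text \<open>A saturated structure realizes finitely satisfiable sets of formulas in finitely many variables \<open>V\<close>;
the other variables carry parameters given by \<open>v\<close>. The induction on \<open>V\<close> fixes the value of one variable
at a time, using the formulas that say that the remaining ones can still be found.\<close>
lemma saturated_realizes_finite:
  assumes sat: "saturated L (\<mu> :: 'k rel) M" and \<mu>: "natLeq <o \<mu>" and \<Phi>: "\<Phi> \<subseteq> formulas L"
    and V: "finite V" and U: "range v \<subseteq> universe M"
    and fs: "\<And>F. finite F \<Longrightarrow> F \<subseteq> \<Phi> \<Longrightarrow>
      \<exists>w. range w \<subseteq> universe M \<and> (\<forall>i. i \<notin> V \<longrightarrow> w i = v i) \<and> (\<forall>\<phi>\<in>F. sat M w \<phi>)"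
  shows "\<exists>w. range w \<subseteq> universe M \<and> (\<forall>i. i \<notin> V \<longrightarrow> w i = v i) \<and> (\<forall>\<phi>\<in>\<Phi>. sat M w \<phi>)"
  using V U fs
proof (induction V arbitrary: v)
  case empty
  have "sat M v \<phi>" if "\<phi> \<in> \<Phi>" for \<phi>
  proof -
    have "\<exists>w. range w \<subseteq> universe M \<and> (\<forall>i. i \<notin> {} \<longrightarrow> w i = v i) \<and> (\<forall>\<phi>\<in>{\<phi>}. sat M w \<phi>)"
      by (rule empty.prems(2)) (use that in auto)
    then obtain w where "\<forall>i. w i = v i" "sat M w \<phi>" by auto
    then show ?thesis using sat_cong[of \<phi> w v M] by simp
  qed
  then show ?case using empty.prems(1) by blast
next
  case (insert k V)
  \<comment> \<open>\<open>E F\<close> says that values for \<open>V\<close> satisfying all of \<open>F\<close> exist.\<close>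
  define E where "E F = Neg (Alls (sorted_list_of_set V) (Neg (Conjs F)))" for F :: "('a, 'b) fm list"
  have E: "sat M w (E F) \<longleftrightarrow>
      (\<exists>w'. (\<forall>i. i \<notin> V \<longrightarrow> w' i = w i) \<and> w' ` V \<subseteq> universe M \<and> (\<forall>\<phi>\<in>set F. sat M w' \<phi>))" for w F
    using insert.hyps(1) by (auto simp: E_def sat_Alls)
  have "\<exists>a\<in>universe M. \<forall>\<psi>\<in>E ` lists \<Phi>. sat M (v(k := a)) \<psi>"
  proof (rule saturated_realizes_one[OF sat insert.prems(1) countable_range_small[OF \<mu>]])
    show "E ` lists \<Phi> \<subseteq> formulas L" using \<Phi> by (auto simp: E_def formulas_iff subset_iff)
  next
    fix G assume "finite G" "G \<subseteq> E ` lists \<Phi>"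
    then obtain G' where G': "finite G'" "G' \<subseteq> lists \<Phi>" "G = E ` G'" by (metis finite_subset_image)
    have "finite (\<Union>(set ` G'))" "\<Union>(set ` G') \<subseteq> \<Phi>" using G' by auto
    then obtain w where w: "range w \<subseteq> universe M" "\<forall>i. i \<notin> insert k V \<longrightarrow> w i = v i"
      "\<forall>\<phi>\<in>\<Union>(set ` G'). sat M w \<phi>" using insert.prems(2) by meson
    have "sat M (v(k := w k)) (E F)" if "F \<in> G'" for F
      unfolding E by (rule exI[of _ w]) (use w that in auto)
    then have "\<forall>\<psi>\<in>G. sat M (v(k := w k)) \<psi>" using G'(3) by blast
    moreover have "w k \<in> universe M" using w(1) by blast
    ultimately show "\<exists>a\<in>universe M. \<forall>\<psi>\<in>G. sat M (v(k := a)) \<psi>" by blast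
  qed
  then obtain a where a: "a \<in> universe M" "\<And>F. F \<in> lists \<Phi> \<Longrightarrow> sat M (v(k := a)) (E F)" by auto
  have U': "range (v(k := a)) \<subseteq> universe M" using insert.prems(1) a(1) by auto
  have "\<exists>w. range w \<subseteq> universe M \<and> (\<forall>i. i \<notin> V \<longrightarrow> w i = (v(k := a)) i) \<and> (\<forall>\<phi>\<in>\<Phi>. sat M w \<phi>)"
  proof (rule insert.IH[OF U'])
    fix F assume "finite F" "F \<subseteq> \<Phi>"
    then obtain Fl where "set Fl = F" "Fl \<in> lists \<Phi>" using finite_list by (metis in_listsI subsetD)
    then obtain w where w: "\<forall>i. i \<notin> V \<longrightarrow> w i = (v(k := a)) i" "w ` V \<subseteq> universe M" "\<forall>\<phi>\<in>F. sat M w \<phi>"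
      using a(2) unfolding E by blast
    have "w i \<in> universe M" for i
    proof (cases "i \<in> V")
      case False
      then have "w i \<in> range (v(k := a))" using w(1) by (metis rangeI)
      then show ?thesis using U' by blast
    qed (use w(2) in blast)
    then show "\<exists>w. range w \<subseteq> universe M \<and> (\<forall>i. i \<notin> V \<longrightarrow> w i = (v(k := a)) i) \<and> (\<forall>\<phi>\<in>F. sat M w \<phi>)"
      using w by blast
  qed
  then obtain w where "range w \<subseteq> universe M" "\<forall>i. i \<notin> V \<longrightarrow> w i = (v(k := a)) i" "\<forall>\<phi>\<in>\<Phi>. sat M w \<phi>"
    by blast
  then show ?case using insert.hyps(2) by (intro exI[of _ w]) auto
qed

section \<open>Closure under infinitary operations\<close>

lemma finite_card_le_infinite: "finite A \<Longrightarrow> infinite K \<Longrightarrow> |A| \<le>o |K|"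
  using ordLeq_total[OF card_of_Well_order card_of_Well_order, of A K] card_of_ordLeq_finite[of K A] by blast

lemma card_lists_infinite:
  assumes "infinite K"
  shows "|lists K| \<le>o |K|"
proof -
  define N where "N n = {xs \<in> lists K. length xs = n}" for n
  have K: "K \<noteq> {}" using assms by auto
  have "|N n| \<le>o |K|" for n
  proof (induction n)
    case 0
    have "N 0 = {[]}" by (auto simp: N_def)
    then show ?case using card_of_singl_ordLeq[OF K] by metis
  next
    case (Suc n)
    have "N (Suc n) \<subseteq> (\<lambda>(x, xs). x # xs) ` (K \<times> N n)"
      by (auto simp: N_def length_Suc_conv image_iff)
    then have "|N (Suc n)| \<le>o |(\<lambda>(x, xs). x # xs) ` (K \<times> N n)|" by (rule card_of_mono1)
    also have "|(\<lambda>(x, xs). x # xs) ` (K \<times> N n)| \<le>o |K \<times> N n|" by (rule card_of_image)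
    also have "|K \<times> N n| \<le>o |K|"
      by (rule card_of_Sigma_ordLeq_infinite[OF assms]) (use Suc in \<open>auto simp: card_of_refl ordIso_imp_ordLeq\<close>)
    finally show ?case .
  qed
  moreover have "|UNIV :: nat set| \<le>o |K|" using assms infinite_iff_card_of_nat by blast
  ultimately have "|\<Union>n\<in>UNIV. N n| \<le>o |K|" using card_of_UNION_ordLeq_infinite[OF assms] by blast
  moreover have "(\<Union>n\<in>UNIV. N n) = lists K" by (auto simp: N_def)
  ultimately show ?thesis by simp
qed

text \<open>To bound the closure of \<open>X\<close> under the operations \<open>F _ s\<close> with \<open>s \<in> S\<close>, whose arguments are families
indexed by \<open>K\<close>, its elements are coded by subsets of \<open>K\<close>; no ordinals are needed. Here \<open>i\<close> and \<open>j\<close> code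
\<open>X\<close> and \<open>S\<close>, and \<open>p\<close> is an injection of the disjoint union of \<open>K \<times> K\<close>, \<open>K\<close> and \<open>K\<close> into \<open>K\<close>. The code of
\<open>F a s\<close> packs codes \<open>g k\<close> of all the arguments \<open>a k\<close> together with the code of \<open>s\<close>. An element may have
many codes, but each code belongs to at most one element.\<close>
inductive decodes ::
    "'k set \<Rightarrow> ('k \<times> 'k + 'k + 'k \<Rightarrow> 'k) \<Rightarrow> ('s \<Rightarrow> 'k set) \<Rightarrow> ('a \<Rightarrow> 'k) \<Rightarrow>
     (('k \<Rightarrow> 'a) \<Rightarrow> 's \<Rightarrow> 'a) \<Rightarrow> 's set \<Rightarrow> 'a set \<Rightarrow> 'k set \<Rightarrow> 'a \<Rightarrow> bool"
  for K p j i F S X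
  where
    base: "x \<in> X \<Longrightarrow> decodes K p j i F S X (p ` {Inr (Inr (i x))}) x"
  | step: "s \<in> S \<Longrightarrow> \<forall>k\<in>K. decodes K p j i F S X (g k) (a k) \<Longrightarrow>
      decodes K p j i F S X (p ` (Inl ` (SIGMA k:K. g k) \<union> Inr ` Inl ` j s)) (F a s)"

lemma base_code_subset: "i ` X \<subseteq> K \<Longrightarrow> x \<in> X \<Longrightarrow> {Inr (Inr (i x))} \<subseteq> K \<times> K <+> K <+> K"
  by auto

lemma step_code_subset:
  "(\<And>k. k \<in> K \<Longrightarrow> g k \<subseteq> K) \<Longrightarrow> j ` S \<subseteq> Pow K \<Longrightarrow> s \<in> S \<Longrightarrow>
    Inl ` (SIGMA k:K. g k) \<union> Inr ` Inl ` j s \<subseteq> K \<times> K <+> K <+> K"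
  by auto

lemma decodes_subset:
  assumes "p ` (K \<times> K <+> K <+> K) \<subseteq> K" "j ` S \<subseteq> Pow K" "i ` X \<subseteq> K"
  shows "decodes K p j i F S X c x \<Longrightarrow> c \<subseteq> K"
proof (induction rule: decodes.induct)
  case (base x)
  then show ?case using base_code_subset[OF assms(3)] assms(1) by (meson image_mono subset_trans)
next
  case (step s g a)
  then have "g k \<subseteq> K" if "k \<in> K" for k using that by blast
  from step_code_subset[OF this assms(2) step.hyps(1)]
  show ?case using assms(1) by (meson image_mono subset_trans)
qed

lemma decodes_unique:
  fixes K :: "'k set"
  assumes p: "inj_on p (K \<times> K <+> K <+> K)" "p ` (K \<times> K <+> K <+> K) \<subseteq> K"
    and j: "inj_on j S" "j ` S \<subseteq> Pow K"
    and i: "inj_on i X" "i ` X \<subseteq> K"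
    and F: "\<And>s a a'. s \<in> S \<Longrightarrow> (\<And>k. k \<in> K \<Longrightarrow> a k = a' k) \<Longrightarrow> F a s = F a' s"
  shows "decodes K p j i F S X c x \<Longrightarrow> decodes K p j i F S X c y \<Longrightarrow> x = y"
proof (induction arbitrary: y rule: decodes.induct)
  case (base x)
  have D: "{Inr (Inr (i x))} \<subseteq> K \<times> K <+> K <+> K" by (rule base_code_subset[OF i(2) base(1)])
  from base(2) show ?case
  proof cases
    case base
    have "{Inr (Inr (i y))} \<subseteq> K \<times> K <+> K <+> K" by (rule base_code_subset[OF i(2) base(2)])
    then have "{Inr (Inr (i x))} = ({Inr (Inr (i y))} :: ('k \<times> 'k + 'k + 'k) set)"
      using base(1) D p(1) by (metis inj_on_image_eq_iff)
    then show ?thesis using base \<open>x \<in> X\<close> i(1) by (auto dest: inj_onD)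
  next
    case (step s g a)
    have "Inl ` (SIGMA k:K. g k) \<union> Inr ` Inl ` j s \<subseteq> K \<times> K <+> K <+> K"
      by (rule step_code_subset[OF _ j(2) step(3)]) (use step(4) decodes_subset[OF p(2) j(2) i(2)] in blast)
    then have "{Inr (Inr (i x))} = Inl ` (SIGMA k:K. g k) \<union> Inr ` Inl ` j s"
      using step(1) D p(1) by (metis inj_on_image_eq_iff)
    then show ?thesis by auto
  qed
next
  case (step s g a)
  have D: "Inl ` (SIGMA k:K. g k) \<union> Inr ` Inl ` j s \<subseteq> K \<times> K <+> K <+> K"
    by (rule step_code_subset[OF _ j(2) step.hyps(1)])
      (use step.IH decodes_subset[OF p(2) j(2) i(2)] in blast)
  from step.prems show ?case
  proof cases
    case base
    have "{Inr (Inr (i y))} \<subseteq> K \<times> K <+> K <+> K" by (rule base_code_subset[OF i(2) base(2)])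
    then have "{Inr (Inr (i y))} = Inl ` (SIGMA k:K. g k) \<union> Inr ` Inl ` j s"
      using base(1) D p(1) by (metis inj_on_image_eq_iff)
    then show ?thesis by auto
  next
    case (step s' g' a')
    have D': "Inl ` (SIGMA k:K. g' k) \<union> Inr ` Inl ` j s' \<subseteq> K \<times> K <+> K <+> K"
      by (rule step_code_subset[OF _ j(2) step(3)]) (use step(4) decodes_subset[OF p(2) j(2) i(2)] in blast)
    have eq: "Inl ` (SIGMA k:K. g k) \<union> Inr ` Inl ` j s =
        (Inl ` (SIGMA k:K. g' k) \<union> Inr ` Inl ` j s' :: ('k \<times> 'k + 'k + 'k) set)"
      using step(1) D D' p(1) by (metis inj_on_image_eq_iff)
    have g: "g k = g' k" if "k \<in> K" for k
    proof -
      have "l \<in> g k \<longleftrightarrow> l \<in> g' k" for l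
        using arg_cong[OF eq, of "\<lambda>Z. Inl (k, l) \<in> Z"] that by auto
      then show ?thesis by blast
    qed
    have "l \<in> j s \<longleftrightarrow> l \<in> j s'" for l
      using arg_cong[OF eq, of "\<lambda>Z. Inr (Inl l) \<in> Z"] by auto
    then have "j s = j s'" by blast
    have "s = s'" using \<open>j s = j s'\<close> \<open>s \<in> S\<close> step(3) j(1) by (auto dest: inj_onD)
    moreover have "a k = a' k" if "k \<in> K" for k
      using step.IH that step(4) g by metis
    ultimately show ?thesis using F[of s a a'] step(2) \<open>s \<in> S\<close> by metis
  qed
qed

text \<open>The hypothesis \<open>F\<close> says that the operations depend only on the arguments with index in \<open>K\<close>.\<close>
lemma closure_card_bound:
  fixes F :: "('k \<Rightarrow> 'a) \<Rightarrow> 's \<Rightarrow> 'a"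
  assumes K: "infinite K" and S: "|S| \<le>o |Pow K|" and X: "|X| \<le>o |K|" "X \<subseteq> U"
    and F: "\<And>s a a'. s \<in> S \<Longrightarrow> (\<And>k. k \<in> K \<Longrightarrow> a k = a' k) \<Longrightarrow> F a s = F a' s"
    and U: "\<And>s a. s \<in> S \<Longrightarrow> a ` K \<subseteq> U \<Longrightarrow> F a s \<in> U"
  shows "\<exists>M. X \<subseteq> M \<and> M \<subseteq> U \<and> |M| \<le>o |Pow K| \<and> (\<forall>a s. a ` K \<subseteq> M \<longrightarrow> s \<in> S \<longrightarrow> F a s \<in> M)"
proof -
  obtain j where j: "inj_on j S" "j ` S \<subseteq> Pow K" using S by (metis card_of_ordLeq)
  obtain i where i: "inj_on i X" "i ` X \<subseteq> K" using X by (metis card_of_ordLeq)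
  have KK: "|K| \<le>o |K|" by (simp add: card_of_refl ordIso_imp_ordLeq)
  have "|K \<times> K <+> K <+> K| \<le>o |K|"
    using K KK card_of_Times_same_infinite[OF K] card_of_Plus_infinite
    by (metis Field_card_of card_of_Card_order card_of_Plus_ordLeq_infinite_Field ordIso_imp_ordLeq)
  then obtain p where p: "inj_on p (K \<times> K <+> K <+> K)" "p ` (K \<times> K <+> K <+> K) \<subseteq> K"
    by (metis card_of_ordLeq)
  let ?D = "decodes K p j i F S X"
  define M where "M = {x. \<exists>c. ?D c x}"
  define code where "code x = (SOME c. ?D c x)" for x
  have code: "?D (code x) x" if "x \<in> M" for x
    unfolding code_def by (rule someI_ex) (use that in \<open>simp add: M_def\<close>)
  have uniq: "?D c x \<Longrightarrow> ?D c y \<Longrightarrow> x = y" for c x y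
    using decodes_unique[OF p j i] F by metis
  have "inj_on code M" 
  proof (rule inj_onI)
    fix x y assume "x \<in> M" "y \<in> M" "code x = code y"
    then show "x = y" using code[of x] code[of y] uniq by simp
  qed
  moreover have "code ` M \<subseteq> Pow K" using code decodes_subset[OF p(2) j(2) i(2)] by blast
  ultimately have "|M| \<le>o |Pow K|" by (metis card_of_ordLeq)
  moreover have "X \<subseteq> M" unfolding M_def by (auto intro: decodes.base)
  moreover have "?D c x \<Longrightarrow> x \<in> U" for c x
    by (induction rule: decodes.induct) (use X U in \<open>auto simp: image_subset_iff\<close>)
  then have "M \<subseteq> U" unfolding M_def by blast
  moreover have "F a s \<in> M" if "a ` K \<subseteq> M" "s \<in> S" for a s
  proof -
    have "\<forall>k\<in>K. ?D (code (a k)) (a k)" using that(1) code by auto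
    from decodes.step[OF that(2), of K p j i F X "\<lambda>k. code (a k)" a, OF this] show ?thesis unfolding M_def by blast
  qed
  ultimately show ?thesis by blast
qed

section \<open>Small saturated elementary substructures\<close>

text \<open>Every set of formulas in the variable 0 with at most \<open>|K|\<close> parameters from \<open>M\<close> that is realized in \<open>N\<close>
is realized by an element of \<open>M\<close>. For infinite \<open>K\<close> and nonempty \<open>M\<close> this yields that \<open>M\<close> is an elementary substructure (the
Tarski-Vaught test) and that it inherits saturation.\<close>
definition realization_closed :: "('f, 'r) lang \<Rightarrow> ('f, 'r, 'a) struct \<Rightarrow> 'k set \<Rightarrow> 'a set \<Rightarrow> bool" where
  "realization_closed L N K M \<longleftrightarrow> (\<forall>A \<Phi>. A \<subseteq> M \<and> |A| \<le>o |K| \<and>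
     \<Phi> \<subseteq> {\<phi> \<in> formulas (lang_par L A). fv \<phi> \<subseteq> {0}} \<and> (\<exists>c\<in>universe N. realizes N c \<Phi>) \<longrightarrow>
     (\<exists>c\<in>M. realizes N c \<Phi>))"

lemma realization_closed_exists:
  fixes K :: "'k set" and L :: "('f, 'r) lang" and N :: "('f, 'r, 'a) struct"
  assumes K: "infinite K" "|formulas L| \<le>o |K|" and X: "X \<subseteq> universe N" "|X| \<le>o |K|" "X \<noteq> {}"
  shows "\<exists>M. X \<subseteq> M \<and> M \<subseteq> universe N \<and> |M| \<le>o |Pow K| \<and> realization_closed L N K M"
proof -
  obtain u0 where u0: "u0 \<in> X" using X(3) by blast
  \<comment> \<open>A set of formulas with parameters in \<open>a ` K\<close> is given by \<open>a\<close> and a set \<open>s\<close> of pairs of a formula and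
    a list of indices; the operation \<open>F\<close> picks a realization, or the dummy \<open>u0\<close> if there is none. There are only \<open>2\<close> to the \<open>|K|\<close> such \<open>s\<close>.\<close>
  define S where "S = Pow (formulas L \<times> lists K)"
  define good where "good a s c \<longleftrightarrow> c \<in> universe N \<and> (\<forall>(\<phi>, ks)\<in>s. sat N (asg (\<lambda>_. c) (map a ks)) \<phi>)"
    for a :: "'k \<Rightarrow> 'a" and s c
  define F where "F a s = (if \<exists>c. good a s c then SOME c. good a s c else u0)" for a s
  have F_good: "good a s (F a s)" if "good a s c" for a s c
    unfolding F_def using that someI_ex[of "good a s"] by auto
  have "|formulas L \<times> lists K| \<le>o |K|"
    by (rule card_of_Sigma_ordLeq_infinite[OF K]) (use card_lists_infinite[OF K(1)] in auto)
  then obtain q where q: "inj_on q (formulas L \<times> lists K)" "q ` (formulas L \<times> lists K) \<subseteq> K"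
    by (metis card_of_ordLeq)
  have "inj_on (image q) S" unfolding S_def by (rule inj_on_image_Pow[OF q(1)])
  moreover have "image q ` S \<subseteq> Pow K" unfolding S_def using q(2) by blast
  ultimately have S: "|S| \<le>o |Pow K|" by (metis card_of_ordLeq)
  have "\<exists>M. X \<subseteq> M \<and> M \<subseteq> universe N \<and> |M| \<le>o |Pow K| \<and> (\<forall>a s. a ` K \<subseteq> M \<longrightarrow> s \<in> S \<longrightarrow> F a s \<in> M)"
  proof (rule closure_card_bound[OF K(1) S X(2,1)])
    fix s and a a' :: "'k \<Rightarrow> 'a" assume s: "s \<in> S" and a: "\<And>k. k \<in> K \<Longrightarrow> a k = a' k"
    have "map a ks = map a' ks" if "(\<phi>, ks) \<in> s" for \<phi> ks
      using s that a by (auto simp: S_def)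
    then have "good a s = good a' s" 
      unfolding good_def by (intro ext conj_cong refl ball_cong) (auto simp del: map_eq_conv)
    then show "F a s = F a' s" unfolding F_def by (simp only:)
  next
    fix s and a :: "'k \<Rightarrow> 'a"
    show "F a s \<in> universe N"
    proof (cases "\<exists>c. good a s c")
      case True
      then show ?thesis using F_good unfolding good_def by blast
    next
      case False
      then show ?thesis using u0 X(1) unfolding F_def by auto
    qed
  qed
  then obtain M where M: "X \<subseteq> M" "M \<subseteq> universe N" "|M| \<le>o |Pow K|"
    and clos: "\<And>a s. a ` K \<subseteq> M \<Longrightarrow> s \<in> S \<Longrightarrow> F a s \<in> M" by metis
  have "realization_closed L N K M" unfolding realization_closed_def
  proof (intro allI impI, elim conjE bexE)
    fix A \<Phi> c assume A: "A \<subseteq> M" "|A| \<le>o |K|" and \<Phi>: "\<Phi> \<subseteq> {\<phi> \<in> formulas (lang_par L A). fv \<phi> \<subseteq> {0}}"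
      and c: "c \<in> universe N" "realizes N c \<Phi>"
    obtain a where a: "a ` K \<subseteq> M" "A \<subseteq> a ` K"
    proof (cases "A = {}")
      case True
      then show ?thesis using that[of "\<lambda>_. u0"] u0 M(1) by auto
    next
      case False
      then obtain a where "a ` K = A" using A(2) card_of_ordLeq2 by metis
      then show ?thesis using that A(1) by auto
    qed
    have "\<exists>\<psi> ks. \<psi> \<in> formulas L \<and> ks \<in> lists K \<and>
        (\<forall>c. sat (struct_par N) (\<lambda>_. c) \<phi> \<longleftrightarrow> sat N (asg (\<lambda>_. c) (map a ks)) \<psi>)" if \<phi>: "\<phi> \<in> \<Phi>" for \<phi>
    proof -
      have "\<phi> \<in> formulas (lang_par L A)" using \<phi> \<Phi> by blast
      from parameters_to_variables[OF this] obtain \<psi> xs where \<psi>: "\<psi> \<in> formulas L" "set xs \<subseteq> A"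
        "\<And>(N :: ('f, 'r, 'a) struct) v. sat (struct_par N) v \<phi> \<longleftrightarrow> sat N (asg v xs) \<psi>" by blast
      define ks where "ks = map (\<lambda>x. SOME k. k \<in> K \<and> a k = x) xs"
      have *: "(SOME k. k \<in> K \<and> a k = x) \<in> K \<and> a (SOME k. k \<in> K \<and> a k = x) = x" if "x \<in> set xs" for x
        by (rule someI_ex) (use that \<psi>(2) a(2) in blast)
      have "ks \<in> lists K" "map a ks = xs" using * by (auto simp: ks_def map_idI)
      then show ?thesis using \<psi>(1,3) by blast
    qed
    then obtain f g where fg: "\<And>\<phi>. \<phi> \<in> \<Phi> \<Longrightarrow> f \<phi> \<in> formulas L \<and> g \<phi> \<in> lists K \<and>
        (\<forall>c. sat (struct_par N) (\<lambda>_. c) \<phi> \<longleftrightarrow> sat N (asg (\<lambda>_. c) (map a (g \<phi>))) (f \<phi>))" by metis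
    define s where "s = (\<lambda>\<phi>. (f \<phi>, g \<phi>)) ` \<Phi>"
    have sS: "s \<in> S" using fg by (auto simp: s_def S_def)
    have good_iff: "good a s c \<longleftrightarrow> c \<in> universe N \<and> realizes N c \<Phi>" for c
      using fg by (auto simp: good_def s_def realizes_def)
    have "good a s (F a s)" using F_good good_iff c by blast
    then show "\<exists>c\<in>M. realizes N c \<Phi>" using clos[OF a(1) sS] good_iff by blast
  qed
  then show ?thesis using M by blast
qed

text \<open>The interpretations of the function symbols are required to agree everywhere, as is the case for
restrictions of the universe.\<close>
definition substructure :: "('f, 'r) lang \<Rightarrow> ('f, 'r, 'a) struct \<Rightarrow> ('f, 'r, 'a) struct \<Rightarrow> bool" where
  "substructure L N' N \<longleftrightarrow> universe N' \<subseteq> universe N \<and> is_struct L N' \<and> fun_int N' = fun_int N \<and>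
     (\<forall>(r, k)\<in>rels L. \<forall>xs. length xs = k \<and> set xs \<subseteq> universe N' \<longrightarrow> (rel_int N' r xs \<longleftrightarrow> rel_int N r xs))"

lemma eval_tm_fun_int: "fun_int N' = fun_int N \<Longrightarrow> eval_tm N' v t = eval_tm N v t"
proof (induction t)
  case (App f ts)
  then have "map (eval_tm N' v) ts = map (eval_tm N v) ts" by simp
  then show ?case using App.prems by (simp del: map_eq_conv)
qed auto

lemma realization_closed_is_struct:
  fixes L :: "('f, 'r) lang" and N :: "('f, 'r, 'a) struct"
  assumes N: "is_struct L N" and M: "M \<subseteq> universe N" "M \<noteq> {}" and K: "infinite K"
    and rc: "realization_closed L N K M"
    and f: "(f, length xs) \<in> funs L" "set xs \<subseteq> M"
  shows "fun_int N f xs \<in> M"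
proof -
  define \<phi> :: "('f + 'a, 'r) fm" where "\<phi> = Eq (Var 0) (App (Inl f) (map (\<lambda>a. App (Inr a) []) xs))"
  have sat: "sat (struct_par N) (\<lambda>_. c) \<phi> \<longleftrightarrow> c = fun_int N f xs" for c
    by (simp add: \<phi>_def comp_def)
  have "fun_int N f xs \<in> universe N" using N f M(1) unfolding is_struct_def by fast
  then have "\<exists>c\<in>universe N. realizes N c {\<phi>}" by (auto simp: realizes_def sat)
  moreover have "|set xs| \<le>o |K|" using K by (simp add: finite_card_le_infinite)
  moreover have "{\<phi>} \<subseteq> {\<phi> \<in> formulas (lang_par L (set xs)). fv \<phi> \<subseteq> {0}}"
    using f(1) by (auto simp: \<phi>_def formulas_iff funs_lang_par)
  ultimately have "\<exists>c\<in>M. realizes N c {\<phi>}" using rc f(2) unfolding realization_closed_def by blast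
  then show ?thesis by (auto simp: realizes_def sat)
qed

text \<open>The Tarski-Vaught test.\<close>
lemma realization_closed_elementary:
  assumes K: "infinite K" and rc: "realization_closed L N K (universe N')" and sub: "substructure L N' N"
  shows "\<phi> \<in> formulas L \<Longrightarrow> v ` fv \<phi> \<subseteq> universe N' \<Longrightarrow> sat N' v \<phi> \<longleftrightarrow> sat N v \<phi>"
proof (induction \<phi> arbitrary: v)
  case (Eq s t)
  have "fun_int N' = fun_int N" using sub by (simp add: substructure_def)
  then show ?case by (simp add: eval_tm_fun_int[of N' N])
next
  case (Rel r ts)
  have f: "fun_int N' = fun_int N" and "is_struct L N'" using sub by (simp_all add: substructure_def)
  then have "set (map (eval_tm N v) ts) \<subseteq> universe N'"
    using eval_tm_in_universe[of L N' _ v] Rel eval_tm_fun_int[OF f] by (auto simp: formulas_iff image_subset_iff)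
  then have "rel_int N' r (map (eval_tm N v) ts) \<longleftrightarrow> rel_int N r (map (eval_tm N v) ts)"
    using sub Rel.prems(1) unfolding substructure_def by (fastforce simp: formulas_iff)
  moreover have "map (eval_tm N' v) ts = map (eval_tm N v) ts" by (simp add: eval_tm_fun_int[OF f])
  ultimately show ?case by (simp del: map_eq_conv)
next
  case (Imp \<phi> \<psi>)
  have "sat N' v \<phi> \<longleftrightarrow> sat N v \<phi>" "sat N' v \<psi> \<longleftrightarrow> sat N v \<psi>"
    using Imp.prems by (auto intro!: Imp.IH simp: formulas_iff)
  then show ?case by simp
next
  case (All x \<phi>)
  have \<phi>: "\<phi> \<in> formulas L" using All.prems(1) by (simp add: formulas_iff)
  have IH: "sat N' (v(x := a)) \<phi> \<longleftrightarrow> sat N (v(x := a)) \<phi>" if "a \<in> universe N'" for a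
    by (rule All.IH[OF \<phi>]) (use All.prems(2) that in auto)
  have sub': "universe N' \<subseteq> universe N" using sub by (simp add: substructure_def)
  define A where "A = v ` (fv \<phi> - {x})"
  have A: "A \<subseteq> universe N'" using All.prems(2) by (auto simp: A_def)
  have "finite A" by (simp add: A_def)
  then have cA: "|A| \<le>o |K|" using K by (rule finite_card_le_infinite)
  have "v ` (fv (Neg \<phi>) - {x}) \<subseteq> A" by (auto simp: A_def)
  moreover have "Neg \<phi> \<in> formulas L" using \<phi> by (simp add: formulas_iff)
  ultimately obtain \<psi> where \<psi>: "\<psi> \<in> formulas (lang_par L A)" "fv \<psi> \<subseteq> {0}"
    "\<And>N a. a \<in> universe N \<Longrightarrow> A \<subseteq> universe N \<Longrightarrow>
       (sat (struct_par N) (\<lambda>_. a) \<psi> \<longleftrightarrow> sat N (v(x := a)) (Neg \<phi>))"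
    using one_variable_formula[of "Neg \<phi>" L v x A] unfolding A_def by (simp del: sat.simps) blast
  have iff: "sat (struct_par N) (\<lambda>_. a) \<psi> \<longleftrightarrow> \<not> sat N (v(x := a)) \<phi>" if "a \<in> universe N" for a
    using \<psi>(3)[OF that] A sub' by auto
  have "\<exists>c\<in>universe N'. \<not> sat N (v(x := c)) \<phi>" if "a \<in> universe N" "\<not> sat N (v(x := a)) \<phi>" for a
  proof -
    have "realizes N a {\<psi>}" using iff that by (simp add: realizes_def)
    then have "\<exists>c\<in>universe N'. realizes N c {\<psi>}"
      using rc A cA \<psi>(1,2) that(1) unfolding realization_closed_def by blast
    then show ?thesis using iff sub' by (auto simp: realizes_def)
  qed
  then show ?case using IH sub' by auto
qed auto

lemma elementary_par:
  fixes L :: "('f, 'r) lang" and N N' :: "('f, 'r, 'a) struct"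
  assumes el: "\<And>\<phi> v. \<phi> \<in> formulas L \<Longrightarrow> v ` fv \<phi> \<subseteq> universe N' \<Longrightarrow> sat N' v \<phi> \<longleftrightarrow> sat N v \<phi>"
    and A: "A \<subseteq> universe N'" and \<phi>: "\<phi> \<in> formulas (lang_par L A)" "v ` fv \<phi> \<subseteq> universe N'"
  shows "sat (struct_par N') v \<phi> \<longleftrightarrow> sat (struct_par N) v \<phi>"
proof -
  from parameters_to_variables[OF \<phi>(1)] obtain \<psi> xs where \<psi>: "\<psi> \<in> formulas L" "set xs \<subseteq> A"
    "fv \<psi> \<subseteq> (\<lambda>i. 2 * i) ` fv \<phi> \<union> {2 * j + 1 | j. j < length xs}"
    "\<And>(N :: ('f, 'r, 'a) struct) v. sat (struct_par N) v \<phi> \<longleftrightarrow> sat N (asg v xs) \<psi>" by blast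
  have "asg v xs i \<in> universe N'" if i: "i \<in> fv \<psi>" for i
  proof -
    consider k where "k \<in> fv \<phi>" "i = 2 * k" | j where "j < length xs" "i = 2 * j + 1"
      using \<psi>(3) i by blast
    then show ?thesis
    proof cases
      case 1
      then show ?thesis using \<phi>(2) by (auto simp: asg_def)
    next
      case 2
      then show ?thesis using \<psi>(2) A nth_mem[OF 2(1)] by (auto simp: asg_def simp del: nth_mem)
    qed
  qed
  then show ?thesis using el[OF \<psi>(1), of "asg v xs"] \<psi>(4) by (simp add: image_subset_iff)
qed

lemma realization_closed_saturated:
  assumes K: "infinite K" and rc: "realization_closed L N K (universe N')" and sub: "substructure L N' N"
    and sat: "saturated L \<Omega> N" and K\<Omega>: "|K| <o \<Omega>" and \<mu>: "\<mu> \<le>o |K|"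
  shows "saturated L \<mu> N'"
  unfolding saturated_def
proof (intro allI impI ballI, elim conjE)
  fix A p assume A: "A \<subseteq> universe N'" "|A| <o \<mu>" and p: "p \<in> types1 L N' A"
  have sub': "universe N' \<subseteq> universe N" using sub by (simp add: substructure_def)
  have AK: "|A| \<le>o |K|" using A(2) \<mu> ordLess_ordLeq_trans ordLess_imp_ordLeq by blast
  then have A\<Omega>: "|A| <o \<Omega>" using K\<Omega> ordLeq_ordLess_trans by blast
  have p1: "p \<subseteq> {\<phi> \<in> formulas (lang_par L A). fv \<phi> \<subseteq> {0}}" using p by (simp add: types1_def)
  have el: "realizes N' c q \<longleftrightarrow> realizes N c q" if "c \<in> universe N'" "q \<subseteq> p" for c q
  proof -
    have "sat (struct_par N') (\<lambda>_. c) \<phi> \<longleftrightarrow> sat (struct_par N) (\<lambda>_. c) \<phi>" if "\<phi> \<in> q" for \<phi>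
      by (rule elementary_par[OF realization_closed_elementary[OF K rc sub] A(1)])
        (use that \<open>q \<subseteq> p\<close> p1 \<open>c \<in> universe N'\<close> in auto)
    then show ?thesis by (simp add: realizes_def)
  qed
  have "p \<in> types1 L N A"
  proof -
    have "\<exists>c\<in>universe N. realizes N c q" if q: "finite q" "q \<subseteq> p" for q
    proof -
      obtain c where "c \<in> universe N'" "realizes N' c q" using p q unfolding types1_def by blast
      then show ?thesis using el q(2) sub' by blast
    qed
    then show ?thesis using p unfolding types1_def by simp
  qed
  then obtain c where "c \<in> universe N" "realizes N c p"
    using sat[unfolded saturated_def, rule_format, of A p] A(1) A\<Omega> sub' by auto
  then have "\<exists>c\<in>universe N'. realizes N c p" using rc A(1) AK p1 unfolding realization_closed_def by blast
  then show "\<exists>c\<in>universe N'. realizes N' c p" using el by blast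
qed

section \<open>Independence and automorphisms\<close>

locale homogeneous_independence =
  fixes L :: "('f, 'r) lang" and \<CC> :: "('f, 'r, 'a) struct" and \<Omega> :: "'k rel"
    and ind :: "'a set \<Rightarrow> 'a set \<Rightarrow> 'a set \<Rightarrow> bool"
  assumes struct: "is_struct L \<CC>"
    and homogeneous: "strongly_homogeneous L \<Omega> \<CC>"
    and \<Omega>: "Cinfinite \<Omega>"
    and indep: "independence_relation L \<CC> \<Omega> ind"
begin

abbreviation sm :: "'a set \<Rightarrow> bool" where "sm \<equiv> small \<CC> \<Omega>"

lemma sm_subset: "sm B \<Longrightarrow> A \<subseteq> B \<Longrightarrow> sm A"
  unfolding small_def using card_of_mono1 ordLeq_ordLess_trans by blast

lemma sm_Un: "sm A \<Longrightarrow> sm B \<Longrightarrow> sm (A \<union> B)"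
  unfolding small_def using Un_Cinfinite_bound_strict[OF _ _ \<Omega>] by auto

lemma ind_inv: "sm A \<Longrightarrow> sm B \<Longrightarrow> sm C \<Longrightarrow> automorphism L \<CC> \<sigma> \<Longrightarrow> ind A B C \<Longrightarrow> ind (\<sigma> ` A) (\<sigma> ` B) (\<sigma> ` C)"
  using indep unfolding independence_relation_def by meson

lemma ind_norm: "sm A \<Longrightarrow> sm B \<Longrightarrow> sm C \<Longrightarrow> ind A C B \<Longrightarrow> ind (A \<union> C) C B"
  using indep unfolding independence_relation_def by meson

lemma ind_sym: "sm A \<Longrightarrow> sm B \<Longrightarrow> sm C \<Longrightarrow> ind A B C \<Longrightarrow> ind C B A"
  using indep unfolding independence_relation_def by meson

lemma ind_trans_iff: "sm A \<Longrightarrow> sm D \<Longrightarrow> B \<subseteq> C \<Longrightarrow> C \<subseteq> D \<Longrightarrow> ind A B D \<longleftrightarrow> ind A B C \<and> ind A C D"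
  using indep unfolding independence_relation_def by meson

lemma ind_finite: "sm A \<Longrightarrow> sm B \<Longrightarrow> sm C \<Longrightarrow>
    ind A B C \<longleftrightarrow> (\<forall>A0. finite A0 \<and> A0 \<subseteq> A \<longrightarrow> ind A0 B C)"
  using indep unfolding independence_relation_def by meson

lemma ind_mono_left: "sm A \<Longrightarrow> sm B \<Longrightarrow> sm C \<Longrightarrow> ind A B C \<Longrightarrow> A0 \<subseteq> A \<Longrightarrow> ind A0 B C"
  using ind_finite[of A B C] ind_finite[of A0 B C] sm_subset[of A A0] by (meson subset_trans)

lemma ind_mono_right: "sm A \<Longrightarrow> sm B \<Longrightarrow> sm C \<Longrightarrow> ind A B C \<Longrightarrow> C0 \<subseteq> C \<Longrightarrow> ind A B C0"
  by (meson ind_mono_left ind_sym sm_subset)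

lemma ind_norm_right: "sm A \<Longrightarrow> sm B \<Longrightarrow> sm C \<Longrightarrow> ind A B C \<Longrightarrow> ind A B (C \<union> B)"
  by (meson ind_norm ind_sym sm_Un)

lemma aut_eval_tm:
  assumes \<sigma>: "automorphism L \<CC> \<sigma>"
  shows "wf_tm L t \<Longrightarrow> v ` tm_vars t \<subseteq> universe \<CC> \<Longrightarrow> eval_tm \<CC> (\<lambda>i. \<sigma> (v i)) t = \<sigma> (eval_tm \<CC> v t)"
proof (induction t)
  case (App f ts)
  have "set (map (eval_tm \<CC> v) ts) \<subseteq> universe \<CC>"
    using App.prems eval_tm_in_universe[OF struct, of _ v] by (auto simp: image_subset_iff)
  moreover have "(f, length (map (eval_tm \<CC> v) ts)) \<in> funs L" using App.prems by simp
  ultimately have "\<sigma> (fun_int \<CC> f (map (eval_tm \<CC> v) ts)) = fun_int \<CC> f (map \<sigma> (map (eval_tm \<CC> v) ts))"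
    using \<sigma> unfolding automorphism_def by fast
  moreover have "map (eval_tm \<CC> (\<lambda>i. \<sigma> (v i))) ts = map \<sigma> (map (eval_tm \<CC> v) ts)"
    using App by (auto simp: image_subset_iff)
  ultimately show ?case by (simp del: map_map map_eq_conv)
qed auto

lemma aut_sat:
  assumes \<sigma>: "automorphism L \<CC> \<sigma>"
  shows "\<phi> \<in> formulas L \<Longrightarrow> v ` fv \<phi> \<subseteq> universe \<CC> \<Longrightarrow> sat \<CC> (\<lambda>i. \<sigma> (v i)) \<phi> \<longleftrightarrow> sat \<CC> v \<phi>"
proof (induction \<phi> arbitrary: v)
  case (Eq s t)
  have bij: "bij_betw \<sigma> (universe \<CC>) (universe \<CC>)" using \<sigma> by (simp add: automorphism_def)
  have s: "wf_tm L s" "wf_tm L t" "v ` tm_vars s \<subseteq> universe \<CC>" "v ` tm_vars t \<subseteq> universe \<CC>"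
    using Eq.prems by (auto simp: formulas_iff)
  then have "eval_tm \<CC> v s \<in> universe \<CC>" "eval_tm \<CC> v t \<in> universe \<CC>"
    using eval_tm_in_universe[OF struct] by auto
  then show ?case using s bij by (auto simp: aut_eval_tm[OF \<sigma>] bij_betw_def dest: inj_onD)
next
  case (Rel r ts)
  have t: "wf_tm L t \<and> v ` tm_vars t \<subseteq> universe \<CC>" if "t \<in> set ts" for t
    using Rel.prems that by (auto simp: formulas_iff)
  then have "set (map (eval_tm \<CC> v) ts) \<subseteq> universe \<CC>"
    using eval_tm_in_universe[OF struct, of _ v] by auto
  moreover have "(r, length (map (eval_tm \<CC> v) ts)) \<in> rels L" using Rel.prems by (simp add: formulas_iff)
  ultimately have "rel_int \<CC> r (map (eval_tm \<CC> v) ts) \<longleftrightarrow> rel_int \<CC> r (map \<sigma> (map (eval_tm \<CC> v) ts))"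
    using \<sigma> unfolding automorphism_def by fast
  moreover have "map (eval_tm \<CC> (\<lambda>i. \<sigma> (v i))) ts = map \<sigma> (map (eval_tm \<CC> v) ts)"
    using t by (simp add: aut_eval_tm[OF \<sigma>])
  ultimately show ?case by (simp del: map_map map_eq_conv)
next
  case (Imp \<phi> \<psi>)
  have "sat \<CC> (\<lambda>i. \<sigma> (v i)) \<phi> \<longleftrightarrow> sat \<CC> v \<phi>" "sat \<CC> (\<lambda>i. \<sigma> (v i)) \<psi> \<longleftrightarrow> sat \<CC> v \<psi>"
    using Imp.prems by (auto intro!: Imp.IH simp: formulas_iff)
  then show ?case by simp
next
  case (All x \<phi>)
  have im: "\<sigma> ` universe \<CC> = universe \<CC>" using \<sigma> by (simp add: automorphism_def bij_betw_def)
  have "sat \<CC> ((\<lambda>i. \<sigma> (v i))(x := \<sigma> a)) \<phi> \<longleftrightarrow> sat \<CC> (v(x := a)) \<phi>" if "a \<in> universe \<CC>" for a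
  proof -
    have "(\<lambda>i. \<sigma> (v i))(x := \<sigma> a) = (\<lambda>i. \<sigma> ((v(x := a)) i))" by auto
    moreover have "sat \<CC> (\<lambda>i. \<sigma> ((v(x := a)) i)) \<phi> \<longleftrightarrow> sat \<CC> (v(x := a)) \<phi>"
      by (rule All.IH) (use All.prems that in \<open>auto simp: formulas_iff\<close>)
    ultimately show ?thesis by simp
  qed
  then have "(\<forall>a\<in>\<sigma> ` universe \<CC>. sat \<CC> ((\<lambda>i. \<sigma> (v i))(x := a)) \<phi>) \<longleftrightarrow>
      (\<forall>a\<in>universe \<CC>. sat \<CC> (v(x := a)) \<phi>)" by blast
  then show ?case unfolding im by simp
qed auto

text \<open>The relation \<open>G\<close> is the graph of a partial elementary map. Graphs make the inverse map available as
\<open>G\<inverse>\<close>; that \<open>G\<close> is single valued and injective is a consequence (\<open>elem_graph_inj\<close>).\<close>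
definition elem_graph :: "('a \<times> 'a) set \<Rightarrow> bool" where
  "elem_graph G \<longleftrightarrow> (\<forall>\<phi>\<in>formulas L. \<forall>v w. (\<forall>i\<in>fv \<phi>. (v i, w i) \<in> G) \<longrightarrow> (sat \<CC> v \<phi> \<longleftrightarrow> sat \<CC> w \<phi>))"

lemma elem_graphD:
  "elem_graph G \<Longrightarrow> \<phi> \<in> formulas L \<Longrightarrow> (\<And>i. i \<in> fv \<phi> \<Longrightarrow> (v i, w i) \<in> G) \<Longrightarrow> sat \<CC> v \<phi> \<longleftrightarrow> sat \<CC> w \<phi>"
  unfolding elem_graph_def by blast

lemma elem_graph_converse: "elem_graph G \<Longrightarrow> elem_graph (G\<inverse>)"
  unfolding elem_graph_def by (metis converse_iff)

lemma elem_graph_inj: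
  assumes "elem_graph G" "(a, a') \<in> G" "(b, b') \<in> G"
  shows "a = b \<longleftrightarrow> a' = b'"
proof -
  define v where "v i = (if i = (0::nat) then a else b)" for i
  define w where "w i = (if i = (0::nat) then a' else b')" for i
  have "\<forall>i\<in>fv (Eq (Var 0) (Var 1) :: ('f, 'r) fm). (v i, w i) \<in> G" using assms by (auto simp: v_def w_def)
  moreover have "(Eq (Var 0) (Var 1) :: ('f, 'r) fm) \<in> formulas L" by (simp add: formulas_iff)
  ultimately have "sat \<CC> v (Eq (Var 0) (Var 1)) \<longleftrightarrow> sat \<CC> w (Eq (Var 0) (Var 1))"
    using assms(1) unfolding elem_graph_def by blast
  then show ?thesis by (simp add: v_def w_def)
qed

lemma elem_graph_automorphism:
  assumes G: "elem_graph G" "G \<subseteq> universe \<CC> \<times> universe \<CC>" "|Domain G| <o \<Omega>"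
  shows "\<exists>\<sigma>. automorphism L \<CC> \<sigma> \<and> (\<forall>(a, a')\<in>G. \<sigma> a = a')"
proof -
  define f where "f a = (SOME a'. (a, a') \<in> G)" for a
  have f: "(a, f a) \<in> G" if "a \<in> Domain G" for a
    unfolding f_def by (rule someI_ex) (use that in auto)
  have "sat \<CC> v \<phi> \<longleftrightarrow> sat \<CC> (f \<circ> v) \<phi>" if "\<phi> \<in> formulas L" "v ` fv \<phi> \<subseteq> Domain G" for \<phi> v
  proof -
    have "\<forall>i\<in>fv \<phi>. (v i, (f \<circ> v) i) \<in> G" using that f by auto
    then show ?thesis using G(1) that(1) unfolding elem_graph_def by blast
  qed
  moreover have "Domain G \<subseteq> universe \<CC>" "f ` Domain G \<subseteq> universe \<CC>" using f G(2) by blast+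
  ultimately have "elementary_map L \<CC> (Domain G) f" unfolding elementary_map_def by blast
  then obtain \<sigma> where \<sigma>: "automorphism L \<CC> \<sigma>" "\<forall>a\<in>Domain G. \<sigma> a = f a"
    using homogeneous G(3) unfolding strongly_homogeneous_def by blast
  have "\<sigma> a = a'" if "(a, a') \<in> G" for a a'
  proof -
    have "a \<in> Domain G" using that by blast
    then show ?thesis using \<sigma>(2) f[of a] elem_graph_inj[OF G(1) that, of a "f a"] by simp
  qed
  then show ?thesis using \<sigma>(1) by blast
qed

text \<open>A partial elementary map extends to \<open>d\<close> with value \<open>d'\<close> as soon as \<open>d'\<close> realizes the image of the type of
\<open>d\<close>, computed through an automorphism that extends the map.\<close>
lemma elem_graph_insert:
  assumes \<sigma>: "automorphism L \<CC> \<sigma>" "\<forall>(a, a')\<in>G. \<sigma> a = a'"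
    and G: "G \<subseteq> universe \<CC> \<times> universe \<CC>" and d: "d \<in> universe \<CC>" "d' \<in> universe \<CC>"
    and real: "realizes \<CC> d' (tp L \<CC> (Range G) (\<sigma> d))"
  shows "elem_graph (insert (d, d') G)"
  unfolding elem_graph_def
proof (intro ballI allI impI)
  fix \<phi> v w assume \<phi>: "\<phi> \<in> formulas L" and vw: "\<forall>i\<in>fv \<phi>. (v i, w i) \<in> insert (d, d') G"
  define t :: "nat \<Rightarrow> ('f + 'a) tm" where "t i = (if (v i, w i) \<in> G then App (Inr (w i)) [] else Var 0)" for i
  have \<sigma>U: "\<sigma> d \<in> universe \<CC>" using \<sigma>(1) d(1) by (auto simp: automorphism_def bij_betw_def)
  have t: "wf_tm (lang_par L (Range G)) (t i) \<and> tm_vars (t i) \<subseteq> {..<1}" for i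
    by (auto simp: t_def funs_lang_par)
  obtain \<psi> where \<psi>: "\<psi> \<in> formulas (lang_par L (Range G))" "fv \<psi> \<subseteq> {..<1}"
      "\<And>N v. (\<forall>i\<in>fv \<phi>. eval_tm (struct_par N) v (t i) \<in> universe N) \<Longrightarrow>
       (sat (struct_par N) v \<psi> \<longleftrightarrow> sat N (\<lambda>i. eval_tm (struct_par N) v (t i)) \<phi>)"
    using subst_formula[of \<phi> L "Range G" t 1, OF \<phi> t] by blast
  have U: "\<forall>i\<in>fv \<phi>. eval_tm (struct_par \<CC>) (\<lambda>_. a) (t i) \<in> universe \<CC>" if "a \<in> universe \<CC>" for a
    using that vw G d by (auto simp: t_def)
  have "sat \<CC> (\<lambda>i. \<sigma> (v i)) \<phi> \<longleftrightarrow> sat \<CC> (\<lambda>i. eval_tm (struct_par \<CC>) (\<lambda>_. \<sigma> d) (t i)) \<phi>"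
    by (rule sat_cong) (use vw \<sigma>(2) in \<open>auto simp: t_def\<close>)
  also have "\<dots> \<longleftrightarrow> sat (struct_par \<CC>) (\<lambda>_. \<sigma> d) \<psi>" using \<psi>(3)[OF U[OF \<sigma>U]] by simp
  also have "\<dots> \<longleftrightarrow> sat (struct_par \<CC>) (\<lambda>_. d') \<psi>"
    using realizes_tp_iff[OF real \<psi>(1)] \<psi>(2) by (simp add: lessThan_Suc)
  also have "\<dots> \<longleftrightarrow> sat \<CC> (\<lambda>i. eval_tm (struct_par \<CC>) (\<lambda>_. d') (t i)) \<phi>" using \<psi>(3)[OF U[OF d(2)]] by simp
  also have "\<dots> \<longleftrightarrow> sat \<CC> w \<phi>"
    by (rule sat_cong) (use vw in \<open>auto simp: t_def\<close>)
  finally have "sat \<CC> (\<lambda>i. \<sigma> (v i)) \<phi> \<longleftrightarrow> sat \<CC> w \<phi>" .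
  moreover have "v ` fv \<phi> \<subseteq> universe \<CC>" using vw G d by auto
  ultimately show "sat \<CC> v \<phi> \<longleftrightarrow> sat \<CC> w \<phi>" using aut_sat[OF \<sigma>(1) \<phi>] by blast
qed

end

section \<open>Back-and-forth in a lovely pair\<close>

lemma pair_struct_sel [simp]:
  "universe (pair_struct N Q) = universe N" "fun_int (pair_struct N Q) = fun_int N"
  "rel_int (pair_struct N Q) (Some r) xs = rel_int N r xs" "rel_int (pair_struct N Q) None xs \<longleftrightarrow> hd xs \<in> Q"
  by (auto simp: pair_struct_def)

lemma rels_pair_lang:
  "(Some r, k) \<in> rels (pair_lang L) \<longleftrightarrow> (r, k) \<in> rels L" "(None, k) \<in> rels (pair_lang L) \<longleftrightarrow> k = 1"
  by (auto simp: pair_lang_def)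

lemma funs_pair_lang [simp]: "funs (pair_lang L) = funs L"
  by (simp add: pair_lang_def)

lemma wf_tm_pair_lang: "wf_tm (pair_lang L) t \<longleftrightarrow> wf_tm L t"
  by (induction t) (auto simp: pair_lang_def)

text \<open>A lovely pair \<open>(M, P)\<close>, where \<open>P\<close> stands for the interpretation \<open>P(M)\<close>. The cardinal \<open>\<kappa>\<close> is
infinite, at most \<open>\<Omega>\<close>, and bounds the local character of finite sets.\<close>
locale lovely = homogeneous_independence L \<CC> \<Omega> ind
  for L :: "('f, 'r) lang" and \<CC> :: "('f, 'r, 'a) struct" and \<Omega> :: "'k rel" and ind +
  fixes \<kappa> :: "'k rel" and M P :: "'a set"
  assumes \<kappa>: "Cinfinite \<kappa>" "\<kappa> \<le>o \<Omega>"
    and local_character: "finite_local_bound \<CC> \<Omega> ind \<kappa>"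
    and lovely: "lovely_pair L \<CC> \<Omega> ind \<kappa> M P"
begin

lemma M_U: "M \<subseteq> universe \<CC>" and sm_M: "sm M" and P_M: "P \<subseteq> M"
  using lovely by (simp_all add: lovely_pair_def small_def)

lemma sm_in_M: "A \<subseteq> M \<Longrightarrow> sm A"
  using sm_subset[OF sm_M] .

lemma sm_P: "sm P"
  using sm_in_M P_M by blast

lemma density:
  "A \<subseteq> M \<Longrightarrow> |A| <o \<kappa> \<Longrightarrow> c \<in> universe \<CC> \<Longrightarrow> ind {c} (A \<inter> P) A \<Longrightarrow> \<exists>d\<in>P. realizes \<CC> d (tp L \<CC> A c)"
  using lovely tp_in_types1[of c \<CC> L A] realizes_tp[of \<CC> c L A]
  unfolding lovely_pair_def type_indep_def by (metis inf_commute)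

lemma extension:
  "A \<subseteq> M \<Longrightarrow> |A| <o \<kappa> \<Longrightarrow> c \<in> universe \<CC> \<Longrightarrow> \<exists>d\<in>M. realizes \<CC> d (tp L \<CC> A c) \<and> ind {d} A P"
  using lovely tp_in_types1[of c \<CC> L A] unfolding lovely_pair_def by blast

text \<open>The set \<open>A\<close> is \<open>P\<close>-independent in the pair \<open>(M, P)\<close>; only used for \<open>A \<subseteq> M\<close>.\<close>
abbreviation pind :: "'a set \<Rightarrow> bool" where
  "pind A \<equiv> ind A (A \<inter> P) P"

lemma ind_base_mono: "A \<subseteq> M \<Longrightarrow> ind A B P \<Longrightarrow> B \<subseteq> C \<Longrightarrow> C \<subseteq> P \<Longrightarrow> ind A C P"
  using ind_trans_iff[of A P B C] sm_in_M sm_P by blast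

lemma pind_Un:
  assumes "A \<subseteq> M" "pind A" "B \<subseteq> P"
  shows "pind (A \<union> B)"
proof -
  have "ind A (A \<inter> P \<union> B) P" by (rule ind_base_mono[OF assms(1,2)]) (use assms in auto)
  moreover have "sm A" "sm (A \<inter> P \<union> B)" by (rule sm_in_M, use assms P_M in blast)+
  ultimately have "ind (A \<union> (A \<inter> P \<union> B)) (A \<inter> P \<union> B) P" using ind_norm[OF _ sm_P] by blast
  moreover have "A \<union> (A \<inter> P \<union> B) = A \<union> B" "(A \<union> B) \<inter> P = A \<inter> P \<union> B" using assms by auto
  ultimately show ?thesis by simp
qed

text \<open>The back-and-forth system. Finiteness of the part outside \<open>P\<close> allows local character to be applied to
finite sets only: the part of the domain inside \<open>P\<close> may be absorbed into the base.\<close>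
definition back_forth :: "('a \<times> 'a) set \<Rightarrow> bool" where
  "back_forth G \<longleftrightarrow> elem_graph G \<and> G \<subseteq> M \<times> M \<and> (\<forall>(a, a')\<in>G. a \<in> P \<longleftrightarrow> a' \<in> P) \<and> |G| <o \<kappa> \<and>
     finite {p \<in> G. fst p \<notin> P} \<and> pind (Domain G) \<and> pind (Range G)"

lemma back_forth_converse:
  assumes "back_forth G"
  shows "back_forth (G\<inverse>)"
proof -
  have "G\<inverse> = prod.swap ` G" by force
  then have "|G\<inverse>| \<le>o |G|" by (metis card_of_image)
  then have "|G\<inverse>| <o \<kappa>" using assms ordLeq_ordLess_trans unfolding back_forth_def by blast
  moreover have "{p \<in> G\<inverse>. fst p \<notin> P} = prod.swap ` {p \<in> G. fst p \<notin> P}"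
    using assms by (force simp: back_forth_def)
  then have "finite {p \<in> G\<inverse>. fst p \<notin> P}" using assms by (simp add: back_forth_def)
  ultimately show ?thesis using assms elem_graph_converse unfolding back_forth_def by auto
qed

lemma back_forth_card:
  assumes "back_forth G"
  shows "|Domain G| <o \<kappa>" "|Range G| <o \<kappa>" "|Domain G| <o \<Omega>"
proof -
  have "Domain G = fst ` G" "Range G = snd ` G" by force+
  then have "|Domain G| \<le>o |G|" "|Range G| \<le>o |G|" by (metis card_of_image)+
  then show *: "|Domain G| <o \<kappa>" "|Range G| <o \<kappa>"
    using assms ordLeq_ordLess_trans unfolding back_forth_def by blast+
  show "|Domain G| <o \<Omega>" using *(1) \<kappa>(2) ordLess_ordLeq_trans by blast
qed

lemma back_forth_automorphism:
  assumes "back_forth G"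
  obtains \<sigma> where "automorphism L \<CC> \<sigma>" "\<forall>(a, a')\<in>G. \<sigma> a = a'"
    "\<sigma> ` Domain G = Range G" "\<sigma> ` (Domain G \<inter> P) = Range G \<inter> P"
proof -
  have "G \<subseteq> universe \<CC> \<times> universe \<CC>" using assms M_U unfolding back_forth_def by blast
  then obtain \<sigma> where \<sigma>: "automorphism L \<CC> \<sigma>" "\<forall>(a, a')\<in>G. \<sigma> a = a'"
    using elem_graph_automorphism[of G] assms back_forth_card(3) unfolding back_forth_def by blast
  have P: "a \<in> P \<longleftrightarrow> a' \<in> P" if "(a, a') \<in> G" for a a' using assms that unfolding back_forth_def by blast
  have im: "\<sigma> a = a'" if "(a, a') \<in> G" for a a' using \<sigma>(2) that by auto
  have "\<sigma> ` Domain G = Range G" using im by force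
  moreover have "\<sigma> ` (Domain G \<inter> P) = Range G \<inter> P" using im P by force
  ultimately show ?thesis using that[OF \<sigma>] by blast
qed

text \<open>Elementary extensions of a map in the system by pairs from \<open>P\<close> stay in the system, as \<open>P\<close>-independence
is preserved under adding elements of \<open>P\<close>.\<close>
lemma back_forth_superset:
  assumes G: "back_forth G" and H: "G \<subseteq> H" "elem_graph H" "H \<subseteq> M \<times> M" "\<And>a a'. (a, a') \<in> H \<Longrightarrow> a \<in> P \<longleftrightarrow> a' \<in> P"
    "|H| <o \<kappa>" "\<And>a a'. (a, a') \<in> H \<Longrightarrow> a \<notin> P \<Longrightarrow> (a, a') \<in> G"
  shows "back_forth H"
proof -
  have "{p \<in> H. fst p \<notin> P} = {p \<in> G. fst p \<notin> P}" using H by auto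
  then have "finite {p \<in> H. fst p \<notin> P}" using G by (simp add: back_forth_def)
  moreover have "Domain H = Domain G \<union> (Domain H \<inter> P)" using H(1,6) by blast
  then have "pind (Domain H)" using pind_Un[of "Domain G" "Domain H \<inter> P"] G unfolding back_forth_def by auto
  moreover have "Range H = Range G \<union> (Range H \<inter> P)" using H(1,4,6) by blast
  then have "pind (Range H)" using pind_Un[of "Range G" "Range H \<inter> P"] G unfolding back_forth_def by auto
  ultimately show ?thesis using H unfolding back_forth_def by blast
qed

lemma card_insert_lt: "|A| <o \<kappa> \<Longrightarrow> |insert x A| <o \<kappa>"
proof -
  assume A: "|A| <o \<kappa>"
  have "|{x}| <o natLeq" using finite_iff_ordLess_natLeq by blast
  then have "|{x}| <o \<kappa>" using natLeq_ordLeq_cinfinite[OF \<kappa>(1)] ordLess_ordLeq_trans by blast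
  then show ?thesis using Un_Cinfinite_bound_strict[OF _ A \<kappa>(1), of "{x}"] by simp
qed

text \<open>As \<open>d\<close> lies in \<open>P\<close>, it is independent from the domain over its part in \<open>P\<close>; the image of its type over the
range is then realized in \<open>P\<close> by density.\<close>
lemma back_forth_insert_P:
  assumes G: "back_forth G" and d: "d \<in> P"
  shows "\<exists>d'\<in>P. back_forth (insert (d, d') G)"
proof -
  obtain \<sigma> where \<sigma>: "automorphism L \<CC> \<sigma>" "\<forall>(a, a')\<in>G. \<sigma> a = a'"
    "\<sigma> ` Domain G = Range G" "\<sigma> ` (Domain G \<inter> P) = Range G \<inter> P"
    by (rule back_forth_automorphism[OF G])
  have GM: "G \<subseteq> M \<times> M" using G by (simp add: back_forth_def)
  then have DM: "Domain G \<subseteq> M" "Range G \<subseteq> M" by blast+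
  have dU: "d \<in> universe \<CC>" and sd: "sm {d}" using d P_M M_U sm_in_M[of "{d}"] by blast+
  have sD: "sm (Domain G)" "sm (Domain G \<inter> P)" using DM by (auto intro!: sm_in_M)
  have "ind (Domain G) (Domain G \<inter> P) P" using G by (simp add: back_forth_def)
  then have "ind (Domain G) (Domain G \<inter> P) {d}" using ind_mono_right[OF sD sm_P] d by blast
  then have "ind {d} (Domain G \<inter> P) (Domain G)" using ind_sym[OF sD sd] by blast
  then have "ind {\<sigma> d} (Range G \<inter> P) (Range G)" using ind_inv[OF sd sD(2,1) \<sigma>(1)] \<sigma>(3,4) by simp
  moreover have "\<sigma> d \<in> universe \<CC>" using \<sigma>(1) dU by (auto simp: automorphism_def bij_betw_def)
  ultimately obtain d' where d': "d' \<in> P" "realizes \<CC> d' (tp L \<CC> (Range G) (\<sigma> d))"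
    using density[OF DM(2) back_forth_card(2)[OF G]] by blast
  have "elem_graph (insert (d, d') G)"
    by (rule elem_graph_insert[OF \<sigma>(1,2) _ dU _ d'(2)]) (use GM M_U d'(1) P_M in auto)
  then have "back_forth (insert (d, d') G)"
    by (intro back_forth_superset[OF G]) (use G d d'(1) P_M card_insert_lt in \<open>auto simp: back_forth_def\<close>)
  then show ?thesis using d'(1) by blast
qed

text \<open>Iterating \<open>back_forth_insert_P\<close> transfinitely, by Zorn's lemma.\<close>
lemma back_forth_add_subset_P:
  assumes G: "back_forth G" and B: "B \<subseteq> P" "|B| <o \<kappa>"
  shows "\<exists>H. G \<subseteq> H \<and> back_forth H \<and> Domain H = Domain G \<union> B"
proof -
  define X where "X = {H. G \<subseteq> H \<and> elem_graph H \<and> H \<subseteq> M \<times> M \<and> (\<forall>a a'. (a, a') \<in> H \<longrightarrow> (a \<in> P \<longleftrightarrow> a' \<in> P)) \<and>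
    (\<forall>a a'. (a, a') \<in> H \<longrightarrow> a \<notin> P \<longrightarrow> (a, a') \<in> G) \<and> Domain H \<subseteq> Domain G \<union> B}"
  have X_bf: "back_forth H" if "H \<in> X" for H
  proof -
    have H: "elem_graph H" "Domain H \<subseteq> Domain G \<union> B" using that by (auto simp: X_def)
    have "inj_on fst H" by (rule inj_onI) (use elem_graph_inj[OF H(1)] in force)
    moreover have "fst ` H \<subseteq> Domain G \<union> B" using H(2) by (force simp: Domain_fst)
    ultimately have "|H| \<le>o |Domain G \<union> B|" by (metis card_of_ordLeq)
    moreover have "|Domain G \<union> B| <o \<kappa>" by (rule Un_Cinfinite_bound_strict[OF back_forth_card(1)[OF G] B(2) \<kappa>(1)])
    ultimately have "|H| <o \<kappa>" using ordLeq_ordLess_trans by blast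
    then show ?thesis by (intro back_forth_superset[OF G]) (use that in \<open>auto simp: X_def\<close>)
  qed
  have "\<exists>H\<in>X. \<forall>H'\<in>X. H \<subseteq> H' \<longrightarrow> H' = H"
  proof (rule subset_Zorn_nonempty)
    have "G \<in> X" using G unfolding X_def back_forth_def by auto
    then show "X \<noteq> {}" by blast
  next
    fix C assume C: "C \<noteq> {}" "subset.chain X C"
    have CX: "C \<subseteq> X" using C(2) by (simp add: subset_chain_def)
    have "elem_graph (\<Union>C)" unfolding elem_graph_def
    proof (intro ballI allI impI)
      fix \<phi> v w assume \<phi>: "\<phi> \<in> formulas L" "\<forall>i\<in>fv \<phi>. (v i, w i) \<in> \<Union>C"
      then have "finite ((\<lambda>i. (v i, w i)) ` fv \<phi>)" "(\<lambda>i. (v i, w i)) ` fv \<phi> \<subseteq> \<Union>C" by auto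
      then obtain H where "H \<in> C" "(\<lambda>i. (v i, w i)) ` fv \<phi> \<subseteq> H"
        using finite_subset_Union_chain[OF _ _ C] by blast
      moreover then have "elem_graph H" using CX by (auto simp: X_def)
      ultimately show "sat \<CC> v \<phi> \<longleftrightarrow> sat \<CC> w \<phi>" using \<phi>(1) unfolding elem_graph_def by blast
    qed
    moreover have "G \<subseteq> \<Union>C" "\<Union>C \<subseteq> M \<times> M" using CX C(1) unfolding X_def by blast+
    moreover have "(a \<in> P \<longleftrightarrow> a' \<in> P) \<and> (a \<notin> P \<longrightarrow> (a, a') \<in> G) \<and> a \<in> Domain G \<union> B"
      if aa: "(a, a') \<in> \<Union>C" for a a'
    proof -
      obtain H where H: "H \<in> C" "(a, a') \<in> H" using aa by blast
      then have "H \<in> X" using CX by blast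
      then show ?thesis using H(2) unfolding X_def by blast
    qed
    ultimately show "\<Union>C \<in> X" unfolding X_def by blast
  qed
  then obtain H where H: "H \<in> X" and max: "\<And>H'. H' \<in> X \<Longrightarrow> H \<subseteq> H' \<Longrightarrow> H' = H" by blast
  have "d \<in> Domain H" if d: "d \<in> B" for d
  proof -
    obtain d' where d': "d' \<in> P" "back_forth (insert (d, d') H)" using back_forth_insert_P[OF X_bf[OF H]] d B(1) by blast
    have "d \<in> P" using d B(1) by blast
    then have "insert (d, d') H \<in> X" using H d' d unfolding X_def back_forth_def by auto
    then show ?thesis using max by blast
  qed
  moreover have "G \<subseteq> H" "Domain H \<subseteq> Domain G \<union> B" using H by (auto simp: X_def)
  ultimately have "Domain H = Domain G \<union> B" by blast
  then show ?thesis using X_bf[OF H] \<open>G \<subseteq> H\<close> by blast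
qed

text \<open>If \<open>d\<close> were not in \<open>P\<close>, then \<open>A d\<close> would meet \<open>P\<close> in \<open>A \<inter> P\<close> only. Now \<open>d\<close> is independent from \<open>A d\<close> over
\<open>A \<inter> P\<close> by transitivity, so by density its type over \<open>A d\<close> is realized in \<open>P\<close>; but that type says
\<open>x = d\<close>.\<close>
lemma self_independent_in_P:
  assumes A: "A \<subseteq> M" "|A| <o \<kappa>" and d: "d \<in> M" and 1: "ind {d} (A \<inter> P) A" and 2: "ind {d} A {d}"
  shows "d \<in> P"
proof (rule ccontr)
  assume n: "d \<notin> P"
  have s: "sm {d}" "sm A" "sm (insert d A)" using A d sm_in_M by auto
  have "ind {d} A (insert d A)" using ind_norm_right[OF s(1,2,1) 2] by simp
  then have "ind {d} (A \<inter> P) (insert d A)" using ind_trans_iff[OF s(1,3), of "A \<inter> P" A] 1 by blast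
  moreover have "insert d A \<inter> P = A \<inter> P" using n by auto
  ultimately have "\<exists>c\<in>P. realizes \<CC> c (tp L \<CC> (insert d A) d)"
    by (intro density) (use A d M_U card_insert_lt in auto)
  then show False using realizes_tp_in[of d "insert d A"] n by blast
qed

text \<open>The forth step; the back step follows by \<open>back_forth_converse\<close>.\<close>
lemma back_forth_extend:
  assumes G: "back_forth G" and d: "d \<in> M"
  shows "\<exists>H. G \<subseteq> H \<and> back_forth H \<and> d \<in> Domain H"
proof (cases "d \<in> P \<or> d \<in> Domain G")
  case True
  then show ?thesis
  proof
    assume "d \<in> P"
    then obtain d' where "back_forth (insert (d, d') G)" using back_forth_insert_P[OF G] by blast
    then show ?thesis by (intro exI[of _ "insert (d, d') G"]) auto
  qed (use G in blast)
next
  case False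
  define A0 where "A0 = Domain G - P"
  have "A0 = fst ` {p \<in> G. fst p \<notin> P}" by (force simp: A0_def)
  then have "finite A0" using G by (simp add: back_forth_def)
  have GM: "G \<subseteq> M \<times> M" using G by (simp add: back_forth_def)
  have A0M: "insert d A0 \<subseteq> M" using GM d by (auto simp: A0_def)
  then obtain B where B: "B \<subseteq> P" "|B| <o \<kappa>" "ind (insert d A0) B P"
    using local_character \<open>finite A0\<close> sm_P M_U unfolding finite_local_bound_def
    by (metis finite_insert subset_trans)
  obtain G1 where G1: "G \<subseteq> G1" "back_forth G1" "Domain G1 = Domain G \<union> B"
    using back_forth_add_subset_P[OF G B(1,2)] by blast
  \<comment> \<open>After adding \<open>B\<close>, the domain is \<open>A = A0 \<union> Q\<close> with \<open>Q\<close> inside \<open>P\<close> and \<open>B \<subseteq> Q\<close>.\<close>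
  define A A' Q where "A = Domain G1" and "A' = Range G1" and "Q = A \<inter> P"
  have G1M: "G1 \<subseteq> M \<times> M" using G1(2) by (simp add: back_forth_def)
  then have AM: "A \<subseteq> M" "A' \<subseteq> M" by (auto simp: A_def A'_def)
  have QP: "Q \<subseteq> P" "Q \<subseteq> A" by (auto simp: Q_def)
  have dA: "d \<notin> A" using False B(1) G1(3) by (auto simp: A_def)
  have s: "sm {d}" "sm A" "sm A'" "sm (insert d A)" "sm Q" "sm (insert d A0)" "sm (A' \<inter> P)"
    using AM d QP A0M by (auto intro!: sm_in_M)
  have "ind (insert d A0) Q P"
    by (rule ind_base_mono[OF A0M B(3)]) (use B(1) G1(3) in \<open>auto simp: Q_def A_def\<close>)
  then have "ind (insert d A0 \<union> Q) Q P" using ind_norm[OF s(6) sm_P s(5)] by blast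
  moreover have "insert d A0 \<union> Q = insert d A" using G1(3) B(1) by (auto simp: Q_def A_def A0_def)
  ultimately have indA: "ind (insert d A) Q P" by simp
  then have "ind P Q (insert d A)" using ind_sym[OF s(4,5) sm_P] by blast
  then have "ind P A (insert d A)" using ind_trans_iff[OF sm_P s(4) QP(2)] by blast
  then have "ind P A {d}" using ind_mono_right[OF sm_P s(2,4)] by blast
  then have dAP: "ind {d} A P" using ind_sym[OF sm_P s(2,1)] by blast
  obtain \<sigma> where \<sigma>: "automorphism L \<CC> \<sigma>" "\<forall>(a, a')\<in>G1. \<sigma> a = a'"
    "\<sigma> ` Domain G1 = Range G1" "\<sigma> ` (Domain G1 \<inter> P) = Range G1 \<inter> P"
    by (rule back_forth_automorphism[OF G1(2)])
  have dU: "d \<in> universe \<CC>" using d M_U by blast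
  then have "\<sigma> d \<in> universe \<CC>" using \<sigma>(1) by (auto simp: automorphism_def bij_betw_def)
  then obtain d' where d': "d' \<in> M" "realizes \<CC> d' (tp L \<CC> A' (\<sigma> d))" "ind {d'} A' P"
    using extension[OF AM(2)] back_forth_card(2)[OF G1(2)] unfolding A'_def by blast
  define H where "H = insert (d, d') G1"
  have eH: "elem_graph H" unfolding H_def
    by (rule elem_graph_insert[OF \<sigma>(1,2) _ dU _ d'(2)[unfolded A'_def]]) (use G1M M_U d'(1) in auto)
  have HM: "H \<subseteq> M \<times> M" using G1M d d'(1) by (simp add: H_def)
  have s': "sm {d'}" "sm (insert d' A')" using d'(1) AM by (auto intro!: sm_in_M)
  have pA': "ind P (A' \<inter> P) A'"
    using ind_sym[OF s(3,7) sm_P] G1(2) unfolding back_forth_def A'_def by blast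
  \<comment> \<open>Otherwise \<open>d'\<close> would be independent from itself over \<open>A'\<close>. Pulling this back along an automorphism
    extending the inverse of \<open>H\<close> contradicts \<open>d \<notin> P\<close>.\<close>
  have dP': "d' \<notin> P"
  proof
    assume d'P: "d' \<in> P"
    have "H\<inverse> \<subseteq> universe \<CC> \<times> universe \<CC>" using HM M_U by blast
    moreover have "|Domain (H\<inverse>)| <o \<Omega>" 
      using s'(2) by (simp add: H_def A'_def[symmetric] small_def)
    ultimately obtain \<tau> where \<tau>: "automorphism L \<CC> \<tau>" "\<forall>(a', a)\<in>H\<inverse>. \<tau> a' = a"
      using elem_graph_automorphism[OF elem_graph_converse[OF eH]] by blast
    have \<tau>': "\<tau> a' = a" if "(a, a') \<in> H" for a a' using \<tau>(2) that by (meson case_prodD converse_iff)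
    have P: "a \<in> P \<longleftrightarrow> a' \<in> P" if "(a, a') \<in> G1" for a a' using G1(2) that unfolding back_forth_def by blast
    have im: "\<tau> d' = d" "\<tau> ` A' = A" "\<tau> ` (A' \<inter> P) = A \<inter> P"
      using \<tau>' P unfolding H_def A_def A'_def by force+
    have "ind {d'} (A' \<inter> P) A'" using ind_mono_left[OF sm_P s(7,3) pA'] d'P by blast
    then have 1: "ind {d} (A \<inter> P) A" using ind_inv[OF s'(1) s(7,3) \<tau>(1)] im by simp
    have "ind {d'} A' {d'}" using ind_mono_right[OF s'(1) s(3) sm_P d'(3)] d'P by blast
    then have 2: "ind {d} A {d}" using ind_inv[OF s'(1) s(3) s'(1) \<tau>(1)] im by simp
    have "d \<in> P" by (rule self_independent_in_P[OF AM(1) _ d 1 2]) (simp add: A_def back_forth_card(1)[OF G1(2)])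
    then show False using False by blast
  qed
  have "ind P A' {d'}" using ind_sym[OF s'(1) s(3) sm_P d'(3)] .
  then have "ind P A' (insert d' A')" using ind_norm_right[OF sm_P s(3) s'(1)] by simp
  then have "ind P (A' \<inter> P) (insert d' A')"
    using ind_trans_iff[OF sm_P s'(2), of "A' \<inter> P" A'] pA' by blast
  then have "ind (insert d' A') (A' \<inter> P) P" using ind_sym[OF sm_P s(7) s'(2)] by blast
  moreover have "insert d' A' \<inter> P = A' \<inter> P" using dP' by auto
  ultimately have "pind (Range H)" by (simp add: H_def A'_def)
  moreover have "insert d A \<inter> P = Q" using False by (auto simp: Q_def)
  then have "pind (Domain H)" using indA by (simp add: H_def A_def)
  moreover have "{p \<in> H. fst p \<notin> P} \<subseteq> insert (d, d') {p \<in> G1. fst p \<notin> P}" by (auto simp: H_def)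
  then have "finite {p \<in> H. fst p \<notin> P}" using G1(2) finite_subset unfolding back_forth_def by blast
  moreover have "|G1| <o \<kappa>" using G1(2) by (simp add: back_forth_def)
  then have "|H| <o \<kappa>" unfolding H_def by (rule card_insert_lt)
  moreover have "\<forall>(a, a')\<in>H. a \<in> P \<longleftrightarrow> a' \<in> P" using G1(2) False dP' unfolding H_def back_forth_def by simp
  ultimately have "back_forth H" using eH HM unfolding back_forth_def by simp
  then show ?thesis using G1(1) by (intro exI[of _ H]) (auto simp: H_def)
qed

lemma eval_tm_sub_pair: "eval_tm (sub_pair \<CC> M P) v = eval_tm \<CC> v"
  by (rule ext, rule eval_tm_fun_int) (simp add: pair_struct_def)

text \<open>Maps in the system preserve all formulas of the pair language.\<close>
lemma back_forth_sat:
  "\<phi> \<in> formulas (pair_lang L) \<Longrightarrow> back_forth G \<Longrightarrow> (\<And>i. i \<in> fv \<phi> \<Longrightarrow> (v i, w i) \<in> G) \<Longrightarrow>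
    sat (sub_pair \<CC> M P) v \<phi> \<longleftrightarrow> sat (sub_pair \<CC> M P) w \<phi>"
proof (induction \<phi> arbitrary: G v w)
  case (Eq s t)
  have "Eq s t \<in> formulas L" using Eq.prems(1) by (simp add: formulas_iff wf_tm_pair_lang)
  moreover have "elem_graph G" using Eq.prems(2) by (simp add: back_forth_def)
  ultimately have "sat \<CC> v (Eq s t) \<longleftrightarrow> sat \<CC> w (Eq s t)"
    using Eq.prems(3) by (intro elem_graphD) auto
  then show ?case by (simp add: eval_tm_sub_pair)
next
  case (Rel r ts)
  show ?case
  proof (cases r)
    case (Some r')
    have "Rel r' ts \<in> formulas L"
      using Rel.prems(1) Some by (simp add: formulas_iff wf_tm_pair_lang) (simp add: pair_lang_def)
    moreover have "elem_graph G" using Rel.prems(2) by (simp add: back_forth_def)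
    ultimately have "sat \<CC> v (Rel r' ts) \<longleftrightarrow> sat \<CC> w (Rel r' ts)"
      using Rel.prems(3) by (intro elem_graphD) auto
    then show ?thesis using Some by (simp add: eval_tm_sub_pair)
  next
    case None
    then have "length ts = 1" using Rel.prems(1) by (auto simp: formulas_iff pair_lang_def)
    then obtain t where ts: "ts = [t]" by (auto simp: length_Suc_conv)
    have t: "wf_tm L t" using Rel.prems(1) ts by (simp add: formulas_iff wf_tm_pair_lang)
    have vw: "(v i, w i) \<in> G" if "i \<in> tm_vars t" for i using Rel.prems(3) that ts by simp
    then have "v ` tm_vars t \<subseteq> M" using Rel.prems(2) unfolding back_forth_def by blast
    moreover have "is_struct L (\<CC>\<lparr>universe := M\<rparr>)"
      using lovely by (simp add: lovely_pair_def elementary_sub_def)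
    ultimately have "eval_tm (\<CC>\<lparr>universe := M\<rparr>) v t \<in> M"
      using eval_tm_in_universe[of L "\<CC>\<lparr>universe := M\<rparr>" t v] t by simp
    moreover have "eval_tm (\<CC>\<lparr>universe := M\<rparr>) v t = eval_tm \<CC> v t" by (rule eval_tm_fun_int) simp
    ultimately obtain H d' where H: "G \<subseteq> H" "back_forth H" "(eval_tm \<CC> v t, d') \<in> H"
      using back_forth_extend[OF Rel.prems(2)] by (metis DomainE)
    \<comment> \<open>The value of the term \<open>t\<close> need not be in the domain of \<open>G\<close>, so the map is first extended to it.\<close>
    obtain z where z: "z \<notin> tm_vars t" using ex_new_if_finite[OF infinite_UNIV_nat] finite_tm_vars by blast
    define v' where "v' = v(z := eval_tm \<CC> v t)"
    define w' where "w' = w(z := d')"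
    have "\<forall>i\<in>fv (Eq (Var z) t :: ('f, 'r) fm). (v' i, w' i) \<in> H"
      using vw H z by (auto simp: v'_def w'_def)
    moreover have "(Eq (Var z) t :: ('f, 'r) fm) \<in> formulas L" using t by (simp add: formulas_iff)
    ultimately have "sat \<CC> v' (Eq (Var z) t) \<longleftrightarrow> sat \<CC> w' (Eq (Var z) t)"
      using H(2) unfolding back_forth_def elem_graph_def by blast
    moreover have "eval_tm \<CC> v' t = eval_tm \<CC> v t" "eval_tm \<CC> w' t = eval_tm \<CC> w t"
      by (rule eval_tm_cong, use z in \<open>auto simp: v'_def w'_def\<close>)+
    ultimately have "d' = eval_tm \<CC> w t" by (simp add: v'_def w'_def)
    then have "eval_tm \<CC> v t \<in> P \<longleftrightarrow> eval_tm \<CC> w t \<in> P" using H(2,3) unfolding back_forth_def by blast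
    then show ?thesis using None ts by (simp add: eval_tm_sub_pair)
  qed
next
  case (Imp \<phi> \<psi>)
  have "sat (sub_pair \<CC> M P) v \<phi> \<longleftrightarrow> sat (sub_pair \<CC> M P) w \<phi>"
    by (rule Imp.IH(1)[of G]) (use Imp.prems in \<open>auto simp: formulas_iff\<close>)
  moreover have "sat (sub_pair \<CC> M P) v \<psi> \<longleftrightarrow> sat (sub_pair \<CC> M P) w \<psi>"
    by (rule Imp.IH(2)[of G]) (use Imp.prems in \<open>auto simp: formulas_iff\<close>)
  ultimately show ?case by simp
next
  case (All x \<phi>)
  have \<phi>: "\<phi> \<in> formulas (pair_lang L)" using All.prems(1) by (simp add: formulas_iff)
  have one: "sat (sub_pair \<CC> M P) w' (All x \<phi>)"
    if G: "back_forth G'" and vw: "\<And>i. i \<in> fv (All x \<phi>) \<Longrightarrow> (w' i, v' i) \<in> G'" and v: "sat (sub_pair \<CC> M P) v' (All x \<phi>)"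
    for G' v' w'
  proof -
    have "sat (sub_pair \<CC> M P) (w'(x := a)) \<phi>" if a: "a \<in> M" for a
    proof -
      obtain H a' where H: "G' \<subseteq> H" "back_forth H" "(a, a') \<in> H" using back_forth_extend[OF G a] by blast
      have "sat (sub_pair \<CC> M P) (w'(x := a)) \<phi> \<longleftrightarrow> sat (sub_pair \<CC> M P) (v'(x := a')) \<phi>"
        by (rule All.IH[OF \<phi> H(2)]) (use vw H in auto)
      moreover have "a' \<in> M" using H(2,3) unfolding back_forth_def by blast
      ultimately show ?thesis using v by simp
    qed
    then show ?thesis by simp
  qed
  show ?case
    using one[of G v w] one[of "G\<inverse>" w v] All.prems(2,3) back_forth_converse[OF All.prems(2)] by (meson converse_iff)
qed simp

end

section \<open>Lovely elementary substructures of the monster pair\<close>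

text \<open>An injection of the well-formed formulas of the pair language into those of \<open>L\<close>. Quantified variables are shifted,
so that quantification over the variable 0 is free to mark the atoms \<open>P(t)\<close>.\<close>
primrec code_pair_fm :: "('f, 'r option) fm \<Rightarrow> ('f, 'r) fm" where
  "code_pair_fm Bot = Bot"
| "code_pair_fm (Eq s t) = Eq s t"
| "code_pair_fm (Rel r ts) = (case r of Some r' \<Rightarrow> Rel r' ts | None \<Rightarrow> All 0 (Eq (hd ts) (hd ts)))"
| "code_pair_fm (Imp \<phi> \<psi>) = Imp (code_pair_fm \<phi>) (code_pair_fm \<psi>)"
| "code_pair_fm (All x \<phi>) = All (Suc x) (code_pair_fm \<phi>)"

lemma wf_code_pair_fm: "wf_fm (pair_lang L) \<phi> \<Longrightarrow> wf_fm L (code_pair_fm \<phi>)"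
proof (induction \<phi>)
  case (Rel r ts)
  then show ?case by (cases r; cases ts) (auto simp: rels_pair_lang wf_tm_pair_lang)
qed (auto simp: wf_tm_pair_lang)

lemma code_pair_fm_inj:
  "wf_fm (pair_lang L) \<phi> \<Longrightarrow> wf_fm (pair_lang L) \<psi> \<Longrightarrow> code_pair_fm \<phi> = code_pair_fm \<psi> \<Longrightarrow> \<phi> = \<psi>"
proof (induction \<phi> arbitrary: \<psi>)
  case Bot
  then show ?case by (cases \<psi>) (auto split: option.splits)
next
  case (Eq s t)
  then show ?case by (cases \<psi>) (auto split: option.splits)
next
  case (Rel r ts)
  then show ?case
    by (cases \<psi>) (auto split: option.splits simp: rels_pair_lang length_Suc_conv)
next
  case (Imp \<phi>1 \<phi>2)
  then show ?case by (cases \<psi>) (auto split: option.splits)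
next
  case (All x \<phi>)
  then show ?case by (cases \<psi>) (auto split: option.splits)
qed

lemma card_formulas_pair_lang: "|formulas (pair_lang L)| \<le>o |formulas L|"
proof -
  have "inj_on code_pair_fm (formulas (pair_lang L))"
    by (rule inj_onI) (auto simp: formulas_iff intro: code_pair_fm_inj)
  moreover have "code_pair_fm ` formulas (pair_lang L) \<subseteq> formulas L"
    using wf_code_pair_fm by (auto simp: formulas_iff)
  ultimately show ?thesis by (metis card_of_ordLeq)
qed

lemma infinite_formulas: "infinite (formulas L)"
proof -
  have "inj (\<lambda>i. Eq (Var i) (Var i))" by (auto simp: inj_def)
  then have "infinite (range (\<lambda>i. Eq (Var i) (Var i) :: ('a, 'b) fm))" using finite_imageD infinite_UNIV_nat by blast
  moreover have "range (\<lambda>i. Eq (Var i) (Var i)) \<subseteq> formulas L" by (auto simp: formulas_iff)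
  ultimately show ?thesis using infinite_super by blast
qed

lemma pair_formula:
  assumes "\<phi> \<in> formulas L"
  shows "\<exists>\<psi>\<in>formulas (pair_lang L). fv \<psi> \<subseteq> fv \<phi> \<and> (\<forall>(N :: ('f, 'r, 'a) struct) Q v. sat (pair_struct N Q) v \<psi> \<longleftrightarrow> sat N v \<phi>)"
proof -
  define \<psi> where "\<psi> = tr (\<lambda>i. i) Inl Some \<phi>"
  have inj: "inj (\<lambda>i::nat. i)" by (simp add: inj_def)
  have "sat (pair_struct N Q) v \<psi> \<longleftrightarrow> sat N v \<phi>" for N :: "('f, 'r, 'a) struct" and Q v
    unfolding \<psi>_def using sat_tr[OF inj, of L Inl Some "pair_struct N Q" N v \<phi>] assms
    by (simp add: tr_compat_def formulas_iff)
  moreover have "\<psi> \<in> formulas (pair_lang L)" unfolding \<psi>_def formulas_iff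
    by (rule wf_tr[of L]) (use assms in \<open>auto simp: formulas_iff rels_pair_lang\<close>)
  moreover have "fv \<psi> \<subseteq> fv \<phi>" unfolding \<psi>_def
    using fv_tr[OF inj, of L \<phi> Inl Some] assms by (auto simp: formulas_iff)
  ultimately show ?thesis by blast
qed

text \<open>The cardinal \<open>\<mu> + |formulas L|\<close> plays the role of \<open>K\<close>; it is added to \<open>\<mu>\<close>, which may be finite, to get an
infinite cardinal that also bounds the number of formulas of the pair language.\<close>
lemma lovely_elementary_substructure:
  fixes L :: "('f, 'r) lang" and \<CC> :: "('f, 'r, 'a) struct" and \<Omega> \<kappa> :: "'k rel"
  assumes fo: "loveliness_first_order L \<CC> \<Omega> ind \<kappa>" and C: "is_struct L \<CC>"
    and N: "is_struct (pair_lang L) (pair_struct \<CC> P)" "saturated (pair_lang L) \<Omega> (pair_struct \<CC> P)"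
      "models (pair_struct \<CC> P) (lovely_theory L \<CC> \<Omega> ind \<kappa>)"
    and X: "finite X" "X \<subseteq> universe \<CC>"
  shows "\<exists>M. X \<subseteq> M \<and> lovely_pair L \<CC> \<Omega> ind \<kappa> M (P \<inter> M) \<and>
    (\<forall>\<phi>\<in>formulas (pair_lang L). \<forall>v. v ` fv \<phi> \<subseteq> M \<longrightarrow>
       (sat (sub_pair \<CC> M (P \<inter> M)) v \<phi> \<longleftrightarrow> sat (pair_struct \<CC> P) v \<phi>))"
proof -
  obtain \<mu> :: "'k rel" where \<mu>: "Card_order \<mu>" "ctwo ^c (\<mu> +c |formulas L| ) <o \<Omega>"
    and lov: "\<And>M P. elementary_sub L \<CC> M \<Longrightarrow> small \<CC> \<Omega> M \<Longrightarrow> P \<subseteq> M \<Longrightarrow>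
       models (sub_pair \<CC> M P) (lovely_theory L \<CC> \<Omega> ind \<kappa>) \<Longrightarrow>
       saturated (pair_lang L) \<mu> (sub_pair \<CC> M P) \<Longrightarrow> lovely_pair L \<CC> \<Omega> ind \<kappa> M P"
    using fo unfolding loveliness_first_order_def by blast
  define r where "r = \<mu> +c |formulas L|"
  define K where "K = Field r"
  have r: "Card_order r" unfolding r_def by (rule Card_order_csum)
  have rK: "r =o |K|" unfolding K_def using card_of_Field_ordIso[OF r] ordIso_symmetric by blast
  have \<mu>K: "\<mu> \<le>o |K|" unfolding r_def using ordLeq_csum1[OF \<mu>(1)] rK ordLeq_ordIso_trans
    unfolding r_def by blast
  have LK: "|formulas L| \<le>o |K|" using ordLeq_csum2[OF card_of_Card_order] rK ordLeq_ordIso_trans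
    unfolding r_def by blast
  then have K: "infinite K" using infinite_formulas card_of_ordLeq_infinite by blast
  have L2K: "|formulas (pair_lang L)| \<le>o |K|" using card_formulas_pair_lang LK ordLeq_transitive by blast
  have "|Pow (Field r)| =o ctwo ^c r"
    unfolding ctwo_def cexp_def Field_card_of by (rule card_of_Pow_Func)
  then have PowK: "|Pow K| <o \<Omega>" using \<mu>(2) ordIso_ordLess_trans unfolding K_def r_def by blast
  then have K\<Omega>: "|K| <o \<Omega>" using card_of_Pow ordLess_transitive by blast
  obtain u0 where u0: "u0 \<in> universe \<CC>" using C unfolding is_struct_def by blast
  have "\<exists>M. insert u0 X \<subseteq> M \<and> M \<subseteq> universe (pair_struct \<CC> P) \<and> |M| \<le>o |Pow K| \<and>
      realization_closed (pair_lang L) (pair_struct \<CC> P) K M"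
    by (rule realization_closed_exists[OF K L2K])
      (use X u0 K in \<open>auto intro: finite_card_le_infinite\<close>)
  then obtain M where M: "X \<subseteq> M" "u0 \<in> M" "M \<subseteq> universe \<CC>" "|M| \<le>o |Pow K|"
    and rc: "realization_closed (pair_lang L) (pair_struct \<CC> P) K M" by auto
  define N' where "N' = sub_pair \<CC> M (P \<inter> M)"
  have UN': "universe N' = M" by (simp add: N'_def)
  have fM: "fun_int \<CC> f xs \<in> M" if "(f, length xs) \<in> funs L" "set xs \<subseteq> M" for f xs
    using realization_closed_is_struct[OF N(1) _ _ K rc, of f xs] M that by auto
  have struct_M: "is_struct L (\<CC>\<lparr>universe := M\<rparr>)" unfolding is_struct_def using fM M(2) by auto
  have "rel_int N' r xs \<longleftrightarrow> rel_int (pair_struct \<CC> P) r xs"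
    if "(r, length xs) \<in> rels (pair_lang L)" "set xs \<subseteq> M" for r xs
    using that by (cases r; cases xs) (auto simp: N'_def rels_pair_lang)
  moreover have "is_struct (pair_lang L) N'"
    using struct_M by (simp add: is_struct_def N'_def)
  ultimately have sub: "substructure (pair_lang L) N' (pair_struct \<CC> P)"
    using M(3) unfolding substructure_def by (auto simp: N'_def)
  have rc': "realization_closed (pair_lang L) (pair_struct \<CC> P) K (universe N')" using rc UN' by simp
  have el: "sat N' v \<phi> \<longleftrightarrow> sat (pair_struct \<CC> P) v \<phi>"
    if "\<phi> \<in> formulas (pair_lang L)" "v ` fv \<phi> \<subseteq> M" for v \<phi>
    using realization_closed_elementary[OF K rc' sub that(1)] that(2) UN' by simp
  have "saturated (pair_lang L) \<mu> N'"
    by (rule realization_closed_saturated[OF K rc' sub N(2) K\<Omega> \<mu>K])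
  moreover have "models N' (lovely_theory L \<CC> \<Omega> ind \<kappa>)" unfolding models_def
  proof (intro ballI allI impI)
    fix \<phi> and v :: "nat \<Rightarrow> 'a" assume \<phi>: "\<phi> \<in> lovely_theory L \<CC> \<Omega> ind \<kappa>" and v: "range v \<subseteq> universe N'"
    then have "range v \<subseteq> universe (pair_struct \<CC> P)" using M(3) UN' by auto
    then have "sat (pair_struct \<CC> P) v \<phi>" using N(3) \<phi> unfolding models_def by blast
    moreover have "\<phi> \<in> formulas (pair_lang L)" "v ` fv \<phi> \<subseteq> M"
      using \<phi> v UN' by (auto simp: lovely_theory_def sentences_def)
    ultimately show "sat N' v \<phi>" using el by blast
  qed
  moreover have "elementary_sub L \<CC> M"
    unfolding elementary_sub_def
  proof (intro conjI ballI allI impI struct_M M(3))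
    fix \<phi> and v :: "nat \<Rightarrow> 'a" assume \<phi>: "\<phi> \<in> formulas L" and v: "range v \<subseteq> M"
    obtain \<psi> where \<psi>: "\<psi> \<in> formulas (pair_lang L)"
      "\<forall>(N :: ('f, 'r, 'a) struct) Q v. sat (pair_struct N Q) v \<psi> \<longleftrightarrow> sat N v \<phi>"
      using pair_formula[OF \<phi>] by blast
    have "v ` fv \<psi> \<subseteq> M" using v by auto
    then show "sat (\<CC>\<lparr>universe := M\<rparr>) v \<phi> \<longleftrightarrow> sat \<CC> v \<phi>"
      using el[OF \<psi>(1)] \<psi>(2) unfolding N'_def by simp
  qed
  moreover have "small \<CC> \<Omega> M" using M(3,4) PowK ordLeq_ordLess_trans unfolding small_def by blast
  ultimately have "lovely_pair L \<CC> \<Omega> ind \<kappa> M (P \<inter> M)" using lov[of M "P \<inter> M"] unfolding N'_def by blast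
  then show ?thesis using M(1) el unfolding N'_def by blast
qed

section \<open>Traces of definable sets on P\<close>

text \<open>The monster pair with a \<open>P\<close>-independent finite tuple \<open>b\<close>. Unlike in the locale \<open>lovely\<close>, here \<open>P\<close> is
the predicate on the whole monster, which is not small in general.\<close>
locale pair_setting = homogeneous_independence L \<CC> \<Omega> ind
  for L :: "('f, 'r) lang" and \<CC> :: "('f, 'r, 'a) struct" and \<Omega> :: "'k rel" and ind +
  fixes \<kappa> :: "'k rel" and P :: "'a set" and b :: "'a list"
  assumes \<kappa>: "Cinfinite \<kappa>" "\<kappa> \<le>o \<Omega>" and \<Omega>_uncountable: "natLeq <o \<Omega>"
    and local_character: "finite_local_bound \<CC> \<Omega> ind \<kappa>"
    and first_order: "loveliness_first_order L \<CC> \<Omega> ind \<kappa>"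
    and P_U: "P \<subseteq> universe \<CC>"
    and struct2: "is_struct (pair_lang L) (pair_struct \<CC> P)"
    and saturated2: "saturated (pair_lang L) \<Omega> (pair_struct \<CC> P)"
    and models2: "models (pair_struct \<CC> P) (lovely_theory L \<CC> \<Omega> ind \<kappa>)"
    and b_U: "set b \<subseteq> universe \<CC>"
    and b_indep: "P_independent \<CC> \<Omega> ind P (set b)"
begin

lemma P_tuples_type_transfer:
  assumes c: "length c = m" "set c \<subseteq> P" and c': "length c' = m" "set c' \<subseteq> P"
    and type: "\<And>\<psi>. \<psi> \<in> formulas (lang_par L (set b)) \<Longrightarrow> fv \<psi> \<subseteq> {..<m} \<Longrightarrow>
       sat (struct_par \<CC>) (\<lambda>i. c ! i) \<psi> \<longleftrightarrow> sat (struct_par \<CC>) (\<lambda>i. c' ! i) \<psi>"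
    and \<phi>: "\<phi> \<in> formulas (lang_par (pair_lang L) (set b))" "fv \<phi> \<subseteq> {..<m}"
  shows "sat (struct_par (pair_struct \<CC> P)) (\<lambda>i. c ! i) \<phi> \<longleftrightarrow>
      sat (struct_par (pair_struct \<CC> P)) (\<lambda>i. c' ! i) \<phi>"
proof -
  have "finite (set b \<union> set c \<union> set c')" "set b \<union> set c \<union> set c' \<subseteq> universe \<CC>" using b_U P_U c c' by auto
  then obtain M where M: "set b \<union> set c \<union> set c' \<subseteq> M" and lov: "lovely_pair L \<CC> \<Omega> ind \<kappa> M (P \<inter> M)"
    and el: "\<And>\<phi> v. \<phi> \<in> formulas (pair_lang L) \<Longrightarrow> v ` fv \<phi> \<subseteq> M \<Longrightarrow>
       (sat (sub_pair \<CC> M (P \<inter> M)) v \<phi> \<longleftrightarrow> sat (pair_struct \<CC> P) v \<phi>)"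
    using lovely_elementary_substructure[OF first_order struct struct2 saturated2 models2] by metis
  interpret lovely L \<CC> \<Omega> ind \<kappa> M "P \<inter> M"
    by unfold_locales (use \<kappa> local_character lov in auto)
  define G where "G = (\<lambda>x. (x, x)) ` set b \<union> (\<lambda>i. (c ! i, c' ! i)) ` {..<m}"
  have cM: "c ! i \<in> P \<inter> M \<and> c' ! i \<in> P \<inter> M" if "i < m" for i
    
  proof -
    have "c ! i \<in> set c" "c' ! i \<in> set c'" using that c(1) c'(1) by auto
    then show ?thesis using c(2) c'(2) M by blast
  qed
  have dom: "Domain G = set b \<union> set c" "Range G = set b \<union> set c'"
    using c(1) c'(1) by (auto simp: G_def set_conv_nth)
  have fin: "finite G" by (simp add: G_def)
  have "elem_graph G" unfolding elem_graph_def
  proof (intro ballI allI impI)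
    fix \<theta> v w assume \<theta>: "\<theta> \<in> formulas L" and vw: "\<forall>i\<in>fv \<theta>. (v i, w i) \<in> G"
    define k where "k i = (SOME j. j < m \<and> v i = c ! j \<and> w i = c' ! j)" for i
    define t :: "nat \<Rightarrow> ('f + 'a) tm" where
      "t i = (if v i = w i \<and> v i \<in> set b then App (Inr (v i)) [] else Var (k i))" for i
    have k: "k i < m \<and> v i = c ! k i \<and> w i = c' ! k i" if "i \<in> fv \<theta>" "\<not> (v i = w i \<and> v i \<in> set b)" for i
    proof -
      have "(v i, w i) \<in> (\<lambda>i. (c ! i, c' ! i)) ` {..<m}" using vw that unfolding G_def by auto
      then have "\<exists>j. j < m \<and> v i = c ! j \<and> w i = c' ! j" by auto
      then show ?thesis unfolding k_def by (rule someI_ex)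
    qed
    have t: "wf_tm (lang_par L (set b)) (t i) \<and> tm_vars (t i) \<subseteq> {..<m}" if "i \<in> fv \<theta>" for i
      using k[OF that] by (auto simp: t_def funs_lang_par)
    obtain \<psi> where \<psi>: "\<psi> \<in> formulas (lang_par L (set b))" "fv \<psi> \<subseteq> {..<m}"
      "\<And>N v. (\<forall>i\<in>fv \<theta>. eval_tm (struct_par N) v (t i) \<in> universe N) \<Longrightarrow>
       (sat (struct_par N) v \<psi> \<longleftrightarrow> sat N (\<lambda>i. eval_tm (struct_par N) v (t i)) \<theta>)"
      using subst_formula[of \<theta> L "set b" t m, OF \<theta> t] by blast
    have ev: "eval_tm (struct_par \<CC>) (\<lambda>i. c ! i) (t i) = v i" "eval_tm (struct_par \<CC>) (\<lambda>i. c' ! i) (t i) = w i"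
      if "i \<in> fv \<theta>" for i using k[OF that] by (auto simp: t_def)
    have vwU: "v i \<in> universe \<CC> \<and> w i \<in> universe \<CC>" if "i \<in> fv \<theta>" for i
      using vw that dom M M_U by blast
    have "sat \<CC> v \<theta> \<longleftrightarrow> sat \<CC> (\<lambda>i. eval_tm (struct_par \<CC>) (\<lambda>i. c ! i) (t i)) \<theta>"
      by (rule sat_cong) (simp add: ev)
    also have "\<dots> \<longleftrightarrow> sat (struct_par \<CC>) (\<lambda>i. c ! i) \<psi>" using \<psi>(3)[of \<CC> "\<lambda>i. c ! i"] ev(1) vwU by simp
    also have "\<dots> \<longleftrightarrow> sat (struct_par \<CC>) (\<lambda>i. c' ! i) \<psi>" by (rule type[OF \<psi>(1,2)])
    also have "\<dots> \<longleftrightarrow> sat \<CC> (\<lambda>i. eval_tm (struct_par \<CC>) (\<lambda>i. c' ! i) (t i)) \<theta>"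
      using \<psi>(3)[of \<CC> "\<lambda>i. c' ! i"] ev(2) vwU by simp
    also have "\<dots> \<longleftrightarrow> sat \<CC> w \<theta>" by (rule sat_cong) (simp add: ev)
    finally show "sat \<CC> v \<theta> \<longleftrightarrow> sat \<CC> w \<theta>" .
  qed
  moreover have "G \<subseteq> M \<times> M" using M cM by (auto simp: G_def)
  moreover have "\<forall>(a, a')\<in>G. a \<in> P \<inter> M \<longleftrightarrow> a' \<in> P \<inter> M" using cM by (auto simp: G_def)
  moreover have "|G| <o \<kappa>"
    using fin finite_iff_ordLess_natLeq natLeq_ordLeq_cinfinite[OF \<kappa>(1)] ordLess_ordLeq_trans by blast
  moreover have pb: "pind (set b)"
  proof -
    have s: "small \<CC> \<Omega> (set b)" "small \<CC> \<Omega> (set b \<inter> P)" using M by (auto intro!: sm_in_M)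
    then obtain B where "set b \<inter> P \<subseteq> B" "B \<subseteq> set b \<inter> P" "ind (set b) B (P \<inter> M)"
      using b_indep sm_P unfolding P_independent_def indep_large_def by (metis Int_lower1 order_refl)
    moreover have "set b \<inter> (P \<inter> M) = set b \<inter> P" using M by auto
    ultimately show ?thesis by (metis subset_antisym)
  qed
  have bM: "set b \<subseteq> M" "set c \<subseteq> P \<inter> M" "set c' \<subseteq> P \<inter> M" using M c c' by auto
  have "pind (Domain G)" "pind (Range G)" unfolding dom by (rule pind_Un[OF bM(1) pb bM(2)], rule pind_Un[OF bM(1) pb bM(3)])
  ultimately have back_forth: "back_forth G" using fin unfolding back_forth_def by simp
  from parameters_to_variables[OF \<phi>(1)] obtain \<psi> xs where \<psi>: "\<psi> \<in> formulas (pair_lang L)" "set xs \<subseteq> set b"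
      "fv \<psi> \<subseteq> (\<lambda>i. 2 * i) ` fv \<phi> \<union> {2 * j + 1 | j. j < length xs}"
      "\<And>(N :: ('f, 'r option, 'a) struct) v. sat (struct_par N) v \<phi> \<longleftrightarrow> sat N (asg v xs) \<psi>" by blast
  have G: "(asg (\<lambda>i. c ! i) xs i, asg (\<lambda>i. c' ! i) xs i) \<in> G" if i: "i \<in> fv \<psi>" for i
  proof -
    consider k where "k < m" "i = 2 * k" | j where "j < length xs" "i = 2 * j + 1"
      using \<psi>(3) i \<phi>(2) by blast
    then show ?thesis
    proof cases
      case 1
      then show ?thesis by (auto simp: asg_def G_def)
    next
      case 2
      then have "xs ! j \<in> set b" using \<psi>(2) nth_mem by blast
      then show ?thesis using 2 by (auto simp: asg_def G_def)
    qed
  qed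
  have GM: "G \<subseteq> M \<times> M" using back_forth by (simp add: back_forth_def)
  have "sat (struct_par (pair_struct \<CC> P)) (\<lambda>i. c ! i) \<phi> \<longleftrightarrow> sat (pair_struct \<CC> P) (asg (\<lambda>i. c ! i) xs) \<psi>"
    by (rule \<psi>(4))
  also have "\<dots> \<longleftrightarrow> sat (sub_pair \<CC> M (P \<inter> M)) (asg (\<lambda>i. c ! i) xs) \<psi>"
    by (rule el[OF \<psi>(1), symmetric]) (use G GM in blast)
  also have "\<dots> \<longleftrightarrow> sat (sub_pair \<CC> M (P \<inter> M)) (asg (\<lambda>i. c' ! i) xs) \<psi>"
    by (rule back_forth_sat[OF \<psi>(1) back_forth G])
  also have "\<dots> \<longleftrightarrow> sat (pair_struct \<CC> P) (asg (\<lambda>i. c' ! i) xs) \<psi>"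
    by (rule el[OF \<psi>(1)]) (use G GM in blast)
  also have "\<dots> \<longleftrightarrow> sat (struct_par (pair_struct \<CC> P)) (\<lambda>i. c' ! i) \<phi>"
    by (rule \<psi>(4)[symmetric])
  finally show ?thesis .
qed

text \<open>Compactness applied to \<open>P_tuples_type_transfer\<close>: for tuples of \<open>P\<close>, agreement on finitely many
\<open>L\<close>-formulas over \<open>b\<close> decides a formula \<open>\<phi>\<close> of the pair language over \<open>b\<close>.\<close>
lemma finitely_many_formulas_decide:
  assumes \<phi>: "\<phi> \<in> formulas (lang_par (pair_lang L) (set b))" "fv \<phi> \<subseteq> {..<m}"
  shows "\<exists>\<Psi>. finite \<Psi> \<and> \<Psi> \<subseteq> {\<psi> \<in> formulas (lang_par L (set b)). fv \<psi> \<subseteq> {..<m}} \<and>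
    (\<forall>c c'. length c = m \<and> set c \<subseteq> P \<and> length c' = m \<and> set c' \<subseteq> P \<and>
       (\<forall>\<psi>\<in>\<Psi>. sat (struct_par \<CC>) (\<lambda>i. c ! i) \<psi> \<longleftrightarrow> sat (struct_par \<CC>) (\<lambda>i. c' ! i) \<psi>) \<and>
       sat (struct_par (pair_struct \<CC> P)) (\<lambda>i. c ! i) \<phi> \<longrightarrow>
       sat (struct_par (pair_struct \<CC> P)) (\<lambda>i. c' ! i) \<phi>)" (is ?goal)
proof (rule ccontr)
  assume no: "\<not> ?thesis"
  define All\<Psi> where "All\<Psi> = {\<psi> \<in> formulas (lang_par L (set b)). fv \<psi> \<subseteq> {..<m}}"
  let ?N = "pair_struct \<CC> P"
  define D where "D \<Psi> \<longleftrightarrow> (\<forall>c c'. length c = m \<and> set c \<subseteq> P \<and> length c' = m \<and> set c' \<subseteq> P \<and>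
       (\<forall>\<psi>\<in>\<Psi>. sat (struct_par \<CC>) (\<lambda>i. c ! i) \<psi> \<longleftrightarrow> sat (struct_par \<CC>) (\<lambda>i. c' ! i) \<psi>) \<and>
       sat (struct_par ?N) (\<lambda>i. c ! i) \<phi> \<longrightarrow> sat (struct_par ?N) (\<lambda>i. c' ! i) \<phi>)" for \<Psi>
  have no': "\<not> D \<Psi>" if "finite \<Psi>" "\<Psi> \<subseteq> All\<Psi>" for \<Psi>
  proof
    assume "D \<Psi>"
    then have ?goal
      by (intro exI[of _ \<Psi>] conjI that(1) that(2)[unfolded All\<Psi>_def]) (simp only: D_def)
    then show False using no by (rule notE[rotated])
  qed
  \<comment> \<open>The variables are split by residues modulo 3: residue 0 carries \<open>c\<close>, residue 1 carries \<open>c'\<close>, and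
    residue 2 carries the parameters \<open>b\<close>.\<close>
  define \<rho>1 \<rho>2 where "\<rho>1 = (\<lambda>i::nat. 3 * i)" and "\<rho>2 = (\<lambda>i::nat. 3 * i + 1)"
  define ix where "ix a = (SOME j. j < length b \<and> b ! j = a)" for a
  have ix: "ix a < length b \<and> b ! ix a = a" if "a \<in> set b" for a
    unfolding ix_def by (rule someI_ex) (use that in \<open>auto simp: in_set_conv_nth\<close>)
  define e where "e a = 3 * ix a + 2" for a
  have inj: "inj \<rho>1" "inj \<rho>2" by (auto simp: \<rho>1_def \<rho>2_def inj_def)
  have arith: "3 * i \<noteq> 3 * j + 2" "3 * i + 1 \<noteq> 3 * j + 2" "3 * i \<noteq> 3 * j + 1" for i j :: nat by arith+
  have dis: "range \<rho>1 \<inter> range e = {}" "range \<rho>2 \<inter> range e = {}"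
    using arith(1,2) unfolding \<rho>1_def \<rho>2_def e_def by blast+
  obtain u0 where u0: "u0 \<in> universe \<CC>" using struct unfolding is_struct_def by blast
  define v0 where "v0 i = (if i mod 3 = 2 \<and> i div 3 < length b then b ! (i div 3) else u0)" for i :: nat
  have v0U: "range v0 \<subseteq> universe ?N" using u0 b_U nth_mem[of _ b] by (auto simp: v0_def)
  have v0e: "v0 (e a) = a" if "a \<in> set b" for a 
  proof -
    have "e a mod 3 = 2" "e a div 3 = ix a" unfolding e_def by presburger+
    then show ?thesis using ix[OF that] by (simp add: v0_def)
  qed
  define V where "V = \<rho>1 ` {..<m} \<union> \<rho>2 ` {..<m}"
  have eV: "e a \<notin> V" for a using arith(1,2)[of _ "ix a"] unfolding V_def \<rho>1_def \<rho>2_def e_def by (auto simp: image_iff) metis+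
  define gP where "gP \<rho> = tr \<rho> (map_sum id e) (\<lambda>r. r) \<phi>" for \<rho>
  define g where "g \<rho> \<psi> = tr \<rho> (map_sum id e) Some \<psi>" for \<rho> and \<psi> :: "('f + 'a, 'r) fm"
  define iff where "iff \<psi> = Conj (Imp (g \<rho>1 \<psi>) (g \<rho>2 \<psi>)) (Imp (g \<rho>2 \<psi>) (g \<rho>1 \<psi>))" for \<psi>
  define base where "base = {gP \<rho>1, Neg (gP \<rho>2)} \<union> (\<lambda>i. Rel None [Var i]) ` V"
  \<comment> \<open>\<open>\<Phi>\<close> says that \<open>c\<close> and \<open>c'\<close> are tuples of \<open>P\<close> with the same \<open>L\<close>-type over \<open>b\<close>, but \<open>\<phi>\<close> tells them apart.\<close>
  define \<Phi> where "\<Phi> = base \<union> iff ` All\<Psi>"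
  have we: "w (e a) = a" if "\<forall>i. i \<notin> V \<longrightarrow> w i = v0 i" "a \<in> set b" for w a
    using that eV v0e by simp
  have sat_gP: "sat ?N w (gP \<rho>) \<longleftrightarrow> sat (struct_par ?N) (\<lambda>i. w (\<rho> i)) \<phi>"
    if "inj \<rho>" "range \<rho> \<inter> range e = {}" "\<forall>i. i \<notin> V \<longrightarrow> w i = v0 i" for \<rho> w
    unfolding gP_def by (rule sat_unpar[OF that(1,2) \<phi>(1)]) (rule we[OF that(3)])
  have sat_g: "sat ?N w (g \<rho> \<psi>) \<longleftrightarrow> sat (struct_par \<CC>) (\<lambda>i. w (\<rho> i)) \<psi>"
    if "inj \<rho>" "range \<rho> \<inter> range e = {}" "\<forall>i. i \<notin> V \<longrightarrow> w i = v0 i" "\<psi> \<in> All\<Psi>" for \<rho> w \<psi>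
  proof -
    have "tr_compat (lang_par L (set b)) \<rho> (map_sum id e) Some ?N (struct_par \<CC>) w"
      using that(2) we[OF that(3)] unfolding tr_compat_def by (auto simp: funs_lang_par)
    then show ?thesis unfolding g_def
      by (rule sat_tr[OF that(1)]) (use that(4) in \<open>simp add: All\<Psi>_def formulas_iff\<close>)
  qed
  have \<Phi>L: "\<Phi> \<subseteq> formulas (pair_lang L)"
  proof -
    have "g \<rho> \<psi> \<in> formulas (pair_lang L)" if "\<psi> \<in> All\<Psi>" for \<rho> \<psi>
      unfolding g_def formulas_iff
      by (rule wf_tr[of "lang_par L (set b)"])
        (use that in \<open>auto simp: All\<Psi>_def formulas_iff funs_lang_par rels_pair_lang\<close>)
    moreover have "gP \<rho> \<in> formulas (pair_lang L)" for \<rho> unfolding gP_def by (rule wf_unpar[OF \<phi>(1)])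
    ultimately show ?thesis by (auto simp: \<Phi>_def base_def iff_def formulas_iff rels_pair_lang)
  qed
  have "finite V" by (simp add: V_def)
  have "\<exists>w. range w \<subseteq> universe ?N \<and> (\<forall>i. i \<notin> V \<longrightarrow> w i = v0 i) \<and> (\<forall>\<theta>\<in>\<Phi>. sat ?N w \<theta>)"
  proof (rule saturated_realizes_finite[OF saturated2 \<Omega>_uncountable \<Phi>L \<open>finite V\<close> v0U])
    fix F assume F: "finite F" "F \<subseteq> \<Phi>"
    then have "finite (F - base)" "F - base \<subseteq> iff ` All\<Psi>" by (auto simp: \<Phi>_def)
    then obtain \<Psi> where \<Psi>: "finite \<Psi>" "\<Psi> \<subseteq> All\<Psi>" "F - base = iff ` \<Psi>" by (metis finite_subset_image)
    have "\<not> D \<Psi>" by (rule no'[OF \<Psi>(1,2)])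
    then obtain c c' where c: "length c = m" "set c \<subseteq> P" "length c' = m" "set c' \<subseteq> P"
      "\<forall>\<psi>\<in>\<Psi>. sat (struct_par \<CC>) (\<lambda>i. c ! i) \<psi> \<longleftrightarrow> sat (struct_par \<CC>) (\<lambda>i. c' ! i) \<psi>"
      "sat (struct_par ?N) (\<lambda>i. c ! i) \<phi>" "\<not> sat (struct_par ?N) (\<lambda>i. c' ! i) \<phi>"
      unfolding D_def by auto
    define w where "w i = (if i \<in> \<rho>1 ` {..<m} then c ! (i div 3) else if i \<in> \<rho>2 ` {..<m} then c' ! (i div 3) else v0 i)" for i
    have w1: "w (\<rho>1 i) = c ! i" if "i < m" for i using that by (auto simp: w_def \<rho>1_def)
    have w2: "w (\<rho>2 i) = c' ! i" if "i < m" for i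
    proof -
      have "\<rho>2 i \<notin> \<rho>1 ` {..<m}" using arith(3) unfolding \<rho>1_def \<rho>2_def by (metis imageE)
      moreover have "\<rho>2 i div 3 = i" unfolding \<rho>2_def by simp
      ultimately show ?thesis using that by (simp add: w_def)
    qed
    have wV: "w i \<in> P" if "i \<in> V" for i
      using that w1 w2 c nth_mem[of _ c] nth_mem[of _ c'] unfolding V_def by auto
    have w0: "\<forall>i. i \<notin> V \<longrightarrow> w i = v0 i" by (simp add: w_def V_def)
    have wU: "range w \<subseteq> universe ?N"
    proof
      fix x assume "x \<in> range w"
      then obtain i where "x = w i" by blast
      then show "x \<in> universe ?N" using wV[of i] w0 v0U P_U by (cases "i \<in> V") auto
    qed
    have s1: "sat S (\<lambda>i. w (\<rho>1 i)) \<theta> \<longleftrightarrow> sat S (\<lambda>i. c ! i) \<theta>" if "fv \<theta> \<subseteq> {..<m}" for \<theta> and S :: "('f + 'a, 'z, 'a) struct"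
      by (rule sat_cong) (use w1 that in auto)
    have s2: "sat S (\<lambda>i. w (\<rho>2 i)) \<theta> \<longleftrightarrow> sat S (\<lambda>i. c' ! i) \<theta>" if "fv \<theta> \<subseteq> {..<m}" for \<theta> and S :: "('f + 'a, 'z, 'a) struct"
      by (rule sat_cong) (use w2 that in auto)
    have t1: "sat (struct_par ?N) (\<lambda>i. w (\<rho>1 i)) \<phi> \<longleftrightarrow> sat (struct_par ?N) (\<lambda>i. c ! i) \<phi>"
      by (rule sat_cong) (use w1 \<phi>(2) in auto)
    have t2: "sat (struct_par ?N) (\<lambda>i. w (\<rho>2 i)) \<phi> \<longleftrightarrow> sat (struct_par ?N) (\<lambda>i. c' ! i) \<phi>"
      by (rule sat_cong) (use w2 \<phi>(2) in auto)
    have "sat ?N w \<theta>" if \<theta>: "\<theta> \<in> F" for \<theta>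
    proof (cases "\<theta> \<in> base")
      case True
      then consider "\<theta> = gP \<rho>1" | "\<theta> = Neg (gP \<rho>2)" | i where "i \<in> V" "\<theta> = Rel None [Var i]"
        unfolding base_def by blast
      then show ?thesis
      proof cases
        case 1
        then show ?thesis using sat_gP[OF inj(1) dis(1) w0] t1 c(6) by simp
      next
        case 2
        then show ?thesis using sat_gP[OF inj(2) dis(2) w0] t2 c(7) by simp
      next
        case 3
        then show ?thesis using wV by simp
      qed
    next
      case False
      then obtain \<psi> where \<psi>: "\<psi> \<in> \<Psi>" "\<theta> = iff \<psi>" using \<Psi>(3) \<theta> by blast
      then have "\<psi> \<in> All\<Psi>" using \<Psi>(2) by blast
      then show ?thesis
        using sat_g[OF inj(1) dis(1) w0] sat_g[OF inj(2) dis(2) w0] c(5) \<psi> s1[of \<psi>] s2[of \<psi>]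
        by (simp add: iff_def All\<Psi>_def)
    qed
    then show "\<exists>w. range w \<subseteq> universe ?N \<and> (\<forall>i. i \<notin> V \<longrightarrow> w i = v0 i) \<and> (\<forall>\<theta>\<in>F. sat ?N w \<theta>)"
      using wU w0 by blast
  qed
  then obtain w where w: "\<forall>i. i \<notin> V \<longrightarrow> w i = v0 i" "\<forall>\<theta>\<in>\<Phi>. sat ?N w \<theta>" by blast
  define c c' where "c = map (\<lambda>i. w (\<rho>1 i)) [0..<m]" and "c' = map (\<lambda>i. w (\<rho>2 i)) [0..<m]"
  have "w i \<in> P" if "i \<in> V" for i
  proof -
    have "Rel None [Var i] \<in> \<Phi>" using that by (simp add: \<Phi>_def base_def)
    then have "sat ?N w (Rel None [Var i])" using w(2) by blast
    then show ?thesis by simp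
  qed
  then have cP: "set c \<subseteq> P" "set c' \<subseteq> P" by (auto simp: c_def c'_def V_def)
  have s1: "sat (struct_par \<CC>) (\<lambda>i. w (\<rho>1 i)) \<theta> \<longleftrightarrow> sat (struct_par \<CC>) (\<lambda>i. c ! i) \<theta>"
    "sat (struct_par \<CC>) (\<lambda>i. w (\<rho>2 i)) \<theta> \<longleftrightarrow> sat (struct_par \<CC>) (\<lambda>i. c' ! i) \<theta>" if "fv \<theta> \<subseteq> {..<m}" for \<theta>
    by (rule sat_cong, use that in \<open>fastforce simp: c_def c'_def\<close>)+
  have s2: "sat (struct_par ?N) (\<lambda>i. w (\<rho>1 i)) \<phi> \<longleftrightarrow> sat (struct_par ?N) (\<lambda>i. c ! i) \<phi>"
    "sat (struct_par ?N) (\<lambda>i. w (\<rho>2 i)) \<phi> \<longleftrightarrow> sat (struct_par ?N) (\<lambda>i. c' ! i) \<phi>"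
    by (rule sat_cong, use \<phi>(2) in \<open>fastforce simp: c_def c'_def\<close>)+
  have "sat (struct_par ?N) (\<lambda>i. c ! i) \<phi> \<longleftrightarrow> sat (struct_par ?N) (\<lambda>i. c' ! i) \<phi>"
  proof (rule P_tuples_type_transfer[OF _ cP(1) _ cP(2) _ \<phi>])
    fix \<psi> assume \<psi>: "\<psi> \<in> formulas (lang_par L (set b))" "fv \<psi> \<subseteq> {..<m}"
    then have A: "\<psi> \<in> All\<Psi>" by (simp add: All\<Psi>_def)
    then have "sat ?N w (iff \<psi>)" using w(2) by (simp add: \<Phi>_def)
    then show "sat (struct_par \<CC>) (\<lambda>i. c ! i) \<psi> \<longleftrightarrow> sat (struct_par \<CC>) (\<lambda>i. c' ! i) \<psi>"
      using sat_g[OF inj(1) dis(1) w(1) A] sat_g[OF inj(2) dis(2) w(1) A] s1[OF \<psi>(2)]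
      by (auto simp: iff_def)
  qed (simp_all add: c_def c'_def)
  moreover have "sat ?N w (gP \<rho>1)" "sat ?N w (Neg (gP \<rho>2))" using w(2) by (simp_all add: \<Phi>_def base_def)
  ultimately show False
    using sat_gP[OF inj(1) dis(1) w(1)] sat_gP[OF inj(2) dis(2) w(1)] s2 by simp
qed

lemma definable_trace:
  assumes Y: "definable (pair_lang L) (pair_struct \<CC> P) (set b) m Y" "Y \<subseteq> {y. length y = m \<and> set y \<subseteq> P}"
  shows "\<exists>Z. definable L \<CC> (set b) m Z \<and> Y = Z \<inter> {y. length y = m \<and> set y \<subseteq> P}"
proof -
  obtain \<phi> where \<phi>: "\<phi> \<in> formulas (lang_par (pair_lang L) (set b))" "fv \<phi> \<subseteq> {..<m}"
    and Y_def: "Y = {xs. length xs = m \<and> set xs \<subseteq> universe \<CC> \<and> sat (struct_par (pair_struct \<CC> P)) (\<lambda>i. xs ! i) \<phi>}"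
    using Y(1) unfolding definable_def by auto
  obtain \<Psi> where \<Psi>: "finite \<Psi>" "\<Psi> \<subseteq> {\<psi> \<in> formulas (lang_par L (set b)). fv \<psi> \<subseteq> {..<m}}"
    and dec: "\<forall>c c'. length c = m \<and> set c \<subseteq> P \<and> length c' = m \<and> set c' \<subseteq> P \<and>
       (\<forall>\<psi>\<in>\<Psi>. sat (struct_par \<CC>) (\<lambda>i. c ! i) \<psi> \<longleftrightarrow> sat (struct_par \<CC>) (\<lambda>i. c' ! i) \<psi>) \<and>
       sat (struct_par (pair_struct \<CC> P)) (\<lambda>i. c ! i) \<phi> \<longrightarrow>
       sat (struct_par (pair_struct \<CC> P)) (\<lambda>i. c' ! i) \<phi>"
    using finitely_many_formulas_decide[OF \<phi>] by (elim exE conjE) (rule that)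
  define pat where "pat c = {\<psi>\<in>\<Psi>. sat (struct_par \<CC>) (\<lambda>i. c ! i) \<psi>}" for c
  have "\<Psi> \<subseteq> formulas (lang_par L (set b))" using \<Psi>(2) by blast
  then obtain \<chi> where \<chi>: "\<chi> \<in> formulas (lang_par L (set b))" "fv \<chi> \<subseteq> (\<Union>\<psi>\<in>\<Psi>. fv \<psi>)"
    "\<And>(N :: ('f + 'a, 'r, 'a) struct) v. sat N v \<chi> \<longleftrightarrow> {\<psi>\<in>\<Psi>. sat N v \<psi>} \<in> pat ` Y"
    using pattern_formula[OF \<Psi>(1), of "lang_par L (set b)" "pat ` Y"] by blast
  define Z where "Z = {xs. length xs = m \<and> set xs \<subseteq> universe \<CC> \<and> sat (struct_par \<CC>) (\<lambda>i. xs ! i) \<chi>}"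
  have "fv \<chi> \<subseteq> {..<m}" using \<chi>(2) \<Psi>(2) by blast
  then have Z: "definable L \<CC> (set b) m Z" using \<chi>(1) unfolding definable_def Z_def by blast
  have ZY: "xs \<in> Z \<longleftrightarrow> length xs = m \<and> set xs \<subseteq> universe \<CC> \<and> pat xs \<in> pat ` Y" for xs
    by (simp add: Z_def \<chi>(3) pat_def)
  have "y \<in> Y" if y: "y \<in> Z" "length y = m" "set y \<subseteq> P" for y
  proof -
    obtain c where c: "c \<in> Y" "pat y = pat c" using y(1) ZY by blast
    have "sat (struct_par (pair_struct \<CC> P)) (\<lambda>i. y ! i) \<phi>"
    proof (rule dec[rule_format, of c y], intro conjI ballI)
      show "length c = m" "set c \<subseteq> P" using c(1) Y(2) by auto
      show "sat (struct_par \<CC>) (\<lambda>i. c ! i) \<psi> \<longleftrightarrow> sat (struct_par \<CC>) (\<lambda>i. y ! i) \<psi>" if "\<psi> \<in> \<Psi>" for \<psi>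
        using c(2) that unfolding pat_def by auto
      show "sat (struct_par (pair_struct \<CC> P)) (\<lambda>i. c ! i) \<phi>" using c(1) Y_def by simp
    qed (use y in auto)
    then show ?thesis using y P_U Y_def by blast
  qed
  moreover have "y \<in> Z" if "y \<in> Y" for y using that ZY Y_def by simp
  ultimately have "Y = Z \<inter> {y. length y = m \<and> set y \<subseteq> P}" using Y(2) by auto
  then show ?thesis using Z by blast
qed

end

lemma trace_definable:
  fixes L :: "('f, 'r) lang" and \<CC> :: "('f, 'r, 'a) struct"
  assumes Z: "definable L \<CC> B m Z" and P: "P \<subseteq> universe \<CC>"
  shows "definable (pair_lang L) (pair_struct \<CC> P) B m (Z \<inter> {y. length y = m \<and> set y \<subseteq> P})"
proof -
  obtain \<phi> where \<phi>: "\<phi> \<in> formulas (lang_par L B)" "fv \<phi> \<subseteq> {..<m}"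
    and Z_def: "Z = {xs. length xs = m \<and> set xs \<subseteq> universe \<CC> \<and> sat (struct_par \<CC>) (\<lambda>i. xs ! i) \<phi>}"
    using Z unfolding definable_def by blast
  have inj: "inj (\<lambda>i::nat. i)" by (simp add: inj_def)
  define \<phi>' :: "('f + 'a, 'r option) fm" where "\<phi>' = tr (\<lambda>i. i) Inl Some \<phi>"
  have sat': "sat (struct_par (pair_struct \<CC> P)) v \<phi>' \<longleftrightarrow> sat (struct_par \<CC>) v \<phi>" for v
    unfolding \<phi>'_def using \<phi>(1)
    by (intro sat_tr[OF inj, where L = "lang_par L B"])
      (auto simp: tr_compat_def formulas_iff funs_lang_par)
  have wf': "wf_fm (lang_par (pair_lang L) B) \<phi>'" unfolding \<phi>'_def
    by (rule wf_tr[of "lang_par L B"]) (use \<phi>(1) in \<open>auto simp: formulas_iff funs_lang_par rels_pair_lang\<close>)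
  have fv': "fv \<phi>' \<subseteq> {..<m}"
    using fv_tr[OF inj, of "lang_par L B" \<phi> Inl Some] \<phi> unfolding \<phi>'_def by (auto simp: formulas_iff)
  define \<psi> where "\<psi> = Conj \<phi>' (Conjs (map (\<lambda>i. Rel None [Var i]) [0..<m]))"
  have "sat (struct_par (pair_struct \<CC> P)) (\<lambda>i. xs ! i) \<psi> \<longleftrightarrow>
      sat (struct_par \<CC>) (\<lambda>i. xs ! i) \<phi> \<and> set xs \<subseteq> P" if "length xs = m" for xs
    using that by (auto simp: \<psi>_def sat' set_conv_nth)
  then have "Z \<inter> {y. length y = m \<and> set y \<subseteq> P} = {xs. length xs = m \<and> set xs \<subseteq> universe (pair_struct \<CC> P) \<and>
      sat (struct_par (pair_struct \<CC> P)) (\<lambda>i. xs ! i) \<psi>}"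
    using P by (auto simp: Z_def)
  moreover have "\<psi> \<in> formulas (lang_par (pair_lang L) B)" "fv \<psi> \<subseteq> {..<m}"
    using wf' fv' by (auto simp: \<psi>_def formulas_iff rels_pair_lang)
  ultimately show ?thesis unfolding definable_def by blast
qed

theorem lemma4p4:
  fixes L :: "('f, 'r) lang"
    and T :: "('f, 'r) fm set"
    and \<CC> :: "('f, 'r, 'a) struct"
    and \<Omega> \<kappa>\<^sub>0 \<kappa> :: "'k rel"
    and ind :: "'a set \<Rightarrow> 'a set \<Rightarrow> 'a set \<Rightarrow> bool"
    and P :: "'a set"
    and b :: "'a list"
    and Y :: "'a list set"
    and n m :: nat
  assumes "complete_theory L T"
    and "monster_model L T \<Omega> \<CC>"
    and "independence_relation L \<CC> \<Omega> ind"
    and "is_kappa0 \<CC> \<Omega> ind \<kappa>\<^sub>0"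
    and "Card_order \<kappa>" and "\<kappa> <o \<Omega>" and "\<kappa>\<^sub>0 <o \<kappa>" and "|formulas L| <o \<kappa>"
    and "loveliness_first_order L \<CC> \<Omega> ind \<kappa>"
    and "P \<subseteq> universe \<CC>"
    and "monster_model (pair_lang L) (lovely_theory L \<CC> \<Omega> ind \<kappa>) \<Omega> (pair_struct \<CC> P)"
    and "length b = n" and "set b \<subseteq> universe \<CC>"
    and "P_independent \<CC> \<Omega> ind P (set b)"
    and "Y \<subseteq> {y. length y = m \<and> set y \<subseteq> P}"
  shows "definable (pair_lang L) (pair_struct \<CC> P) (set b) m Y \<longleftrightarrow>
    (\<exists>Z. definable L \<CC> (set b) m Z \<and> Y = Z \<inter> {y. length y = m \<and> set y \<subseteq> P})"
proof -
  have mC: "is_struct L \<CC>" "strongly_homogeneous L \<Omega> \<CC>" "Card_order \<Omega>"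
    using assms(2) by (simp_all add: monster_model_def)
  have mN: "is_struct (pair_lang L) (pair_struct \<CC> P)" "saturated (pair_lang L) \<Omega> (pair_struct \<CC> P)"
    "models (pair_struct \<CC> P) (lovely_theory L \<CC> \<Omega> ind \<kappa>)"
    using assms(11) by (simp_all add: monster_model_def)
  have \<kappa>\<^sub>0: "Cinfinite \<kappa>\<^sub>0" "finite_local_bound \<CC> \<Omega> ind \<kappa>\<^sub>0"
    using assms(4) by (simp_all add: is_kappa0_def)
  have \<kappa>: "Cinfinite \<kappa>"
    using \<kappa>\<^sub>0(1) assms(5,7) cinfinite_mono ordLess_imp_ordLeq by blast
  have \<Omega>: "Cinfinite \<Omega>"
    using \<kappa> mC(3) assms(6) cinfinite_mono ordLess_imp_ordLeq by blast
  have natLeq: "natLeq <o \<Omega>"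
    using natLeq_ordLeq_cinfinite[OF \<kappa>] assms(6) ordLeq_ordLess_trans by blast
  have local: "finite_local_bound \<CC> \<Omega> ind \<kappa>"
    unfolding finite_local_bound_def
  proof (intro allI impI)
    fix A B assume AB: "finite A \<and> A \<subseteq> universe \<CC> \<and> small \<CC> \<Omega> B"
    have "\<exists>B0. B0 \<subseteq> B \<and> |B0| <o \<kappa>\<^sub>0 \<and> ind A B0 B"
      by (rule \<kappa>\<^sub>0(2)[unfolded finite_local_bound_def, rule_format, OF AB])
    then show "\<exists>B0\<subseteq>B. |B0| <o \<kappa> \<and> ind A B0 B"
      using assms(7) ordLess_transitive[of _ \<kappa>\<^sub>0 \<kappa>] by auto
  qed
  interpret pair_setting L \<CC> \<Omega> ind \<kappa> P b
    by unfold_locales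
      (fact mC mN \<Omega> \<kappa> natLeq local assms(3,9,10,13,14) ordLess_imp_ordLeq[OF assms(6)])+
  show ?thesis
  proof
    assume "definable (pair_lang L) (pair_struct \<CC> P) (set b) m Y"
    then show "\<exists>Z. definable L \<CC> (set b) m Z \<and> Y = Z \<inter> {y. length y = m \<and> set y \<subseteq> P}"
      by (rule definable_trace[OF _ assms(15)])
  next
    assume "\<exists>Z. definable L \<CC> (set b) m Z \<and> Y = Z \<inter> {y. length y = m \<and> set y \<subseteq> P}"
    then show "definable (pair_lang L) (pair_struct \<CC> P) (set b) m Y"
      using trace_definable[OF _ assms(10)] by blast
  qed
qed

end
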